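(* Let $N\ge5$, $m=\lfloor N/2\rfloor$, and suppose $E\ge1$ is a period of the quasipolynomial $k\mapsto|L_N(k)|$. Then for $0\le r<E$ and $k=Et+r$ with $t\ge0$, $$|L_N(k)|=\sum_{\ell=0}^mp_{r,\ell}\binom{t+m-\ell}{m},$$ where, for $0\le s\le m$, $$p_{r,s}=\sum_{a=0}^s(-1)^a\binom{m+1}a|L_N(E(s-a)+r)|$$ $$=\frac1{|\det V_N|}\sum_{j_1=0}^{d_1-1}\cdots\sum_{j_m=0}^{d_m-1}\ \sum_{a=0}^s(-1)^a\binom{m+1}a\,\xi(\mathbf j)^{E(s-a)+r}\,h^{\boldsymbol\mu}_{R_N(E(s-a)+r)}\bigl(\chi_0(\mathbf j),\dots,\chi_m(\mathbf j)\bigr).$$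
   Context: Notation: $q=e^{2\pi i\tau}$, $\operatorname{Im}\tau>0$; $(x_1,\dots,x_s;q)_\infty=\prod_{i=1}^s\prod_{n\ge0}(1-x_iq^n)$; $\varphi$ is Euler's function; $m=\lfloor N/2\rfloor$. Products: for an even integer $a_0\ge0$ and $\mathbf a=(a_1,\dots,a_m)\in\mathbb Z^m$, $$f^{(N)}_{\mathbf a}(\tau)=q^{\frac N{24}S_1-\frac1{2N}S_2}(q^N;q^N)_\infty^{a_0}\prod_{j=1}^m(q^j,q^{N-j};q^N)_\infty^{a_j},\quad S_1=a_0+2\sum_{j=1}^m a_j,\quad S_2=\sum_{j=1}^m j(N-j)a_j.$$ For an integer $k\ge0$, $L_N(k)$ is the set of all $\mathbf a\in\mathbb Z^m$ such that, with $a_0=2k$, $f^{(N)}_{\mathbf a}\in M_k(\Gamma_1(N))$, the space of holomorphic modular forms of weight $k$ on $\Gamma_1(N)$. A quasipolynomial of degree $d$ and period $E$ is a function $Q(k)=c_d(k)k^d+\dots+c_0(k)$ whose coefficients $c_i(k)$ are periodic functions of period $E$; $|L_N(k)|$ is a quasipolynomial in $k$. Cusps: the cusps of $X_1(N)$ are the $\Gamma_1(N)$-classes $[a/c]$, $\gcd(a,c)=1$, and $g([a/c])=\gcd(c,N)$. Every cusp can be written $[a/(gu)]$ with $g\mid N$, $u$ a unit mod $N/g$, $a\in(\mathbb Z/g\mathbb Z)^\times/\{\pm1\}$, $\gcd(a,gu)=1$. The group $\mathrm{Gal}(\mathbb Q(e^{2\pi i/N})/\mathbb Q)\cong(\mathbb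 Z/N\mathbb Z)^\times$ acts by $\sigma_x[a/(gu)]=[a/(xgu)]$; the orbits correspond to the pairs $(g,a)$ with $g\mid N$, $a\in(\mathbb Z/g\mathbb Z)^\times/\{\pm1\}$, and there are $m+1$ of them. Fix orbit representatives $\mathfrak c_0,\dots,\mathfrak c_m$ with $\mathfrak c_m=[1/N]=[i\infty]$; let $\mu_i=|\mathrm{Orb}(\mathfrak c_i)|$ be the orbit sizes, $\boldsymbol\mu=(\mu_0,\dots,\mu_m)$, and $\mathbf g=(g(\mathfrak c_0),\dots,g(\mathfrak c_{m-1}))^T$. Put $R_N=\frac1{24}\sum_{d\mid N}d\,\varphi(d)\,\varphi(N/d)$. Matrix $A_N$: writing $\mathfrak c_r=[a/c]$, $g=g(\mathfrak c_r)$, $A_N$ is the $m\times m$ matrix with rows indexed by $0\le r\le m-1$, columns by $1\le j\le m$, and entries $\frac g2B_2(\langle ja/g\rangle)$, where $B_2(x)=x^2-x+\frac16$ and $\langle x\rangle=x-\lfloor x\rfloor$. Matrix $B_N$: $B_5=\begin{pmatrix}16&-5\\-4&5\end{pmatrix}$. If $N\ge6$, put $M=N\gcd(2,N)$, let $r_N\in\{0,1,2\}$ with $r_N\equiv2M\pmod3$, $a_N=\frac{-M+5r_N}3$, $b_N=\frac{M-8r_N}3$, let $\mathbf e_1,\dots,\mathbf e_m$ be the standard basis of $\mathbb Z^m$, and let $j_1<\dots<j_r$ be the multiples of $3$ in $\{3,\dots,m\}$. The columns of $B_N$ are the $m$ vectors $16\mathbf e_1-4\mathbf e_2$; $\ a_N\mathbf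 e_1+b_N\mathbf e_2+r_N\mathbf e_3$; $\ \frac{j^2-4}3\mathbf e_1-\frac{j^2-1}3\mathbf e_2+\mathbf e_j$ for $3\le j\le m$, $3\nmid j$; $\ (j_1^2-4)\mathbf e_1-(j_1^2-1)\mathbf e_2+3\mathbf e_{j_1}$; and $\frac{j_t^2-j_1^2}3(\mathbf e_1-\mathbf e_2)-\mathbf e_{j_1}+\mathbf e_{j_t}$ for $2\le t\le r$. Class matrix: $V_N=A_NB_N$, an integer $m\times m$ matrix presenting the $\mathbb Q$-rational cuspidal divisor class group of $X_1(N)$; $P_NV_NQ_N=\operatorname{diag}(d_1,\dots,d_m)$ with $P_N,Q_N\in\operatorname{GL}_m(\mathbb Z)$ is a Smith normal form. Characters: let $\mathbf a^{(1)}=(-3,2)^T$ if $N=5$ and $\mathbf a^{(1)}=(-3,3,-1,0,\dots,0)^T\in\mathbb Z^m$ if $N\ge6$, and let $(\alpha_1,\dots,\alpha_m)^T=-P_N(\frac1{12}\mathbf g+A_N\mathbf a^{(1)})$, an integral vector. With $\omega_i=\exp(2\pi\sqrt{-1}/d_i)$ and $\mathbf j=(j_1,\dots,j_m)$, $0\le j_i\le d_i-1$ (here the $j_i$ are summation indices), $$\xi(\mathbf j)=\prod_{i=1}^m\omega_i^{j_i\alpha_i},\qquad\chi_r(\mathbf j)=\prod_{i=1}^m\omega_i^{j_i(P_N)_{i,r+1}}\ (0\le r\le m-1),\qquad\chi_m(\mathbf j)=1.$$ Weighted complete homogeneous polynomial: $h_n^{\boldsymbol\mu}(x_0,\dots,x_m)=\sum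 x_0^{e_0}\cdots x_m^{e_m}$, the sum over all $(e_0,\dots,e_m)\in\mathbb Z_{\ge0}^{m+1}$ with $\mu_0e_0+\dots+\mu_me_m=n$. *)

theory Defs
  imports
    "HOL-Complex_Analysis.Complex_Analysis"
    "HOL-Number_Theory.Totient"
    "Jordan_Normal_Form.Determinant"
begin

hide_type (open) Finite_Cartesian_Product.vec
hide_const (open) Finite_Cartesian_Product.vec Finite_Cartesian_Product.vec_nth
  Finite_Cartesian_Product.mat Determinants.det
unbundle no vec_syntax
no_notation fps_nth (infixl "$" 75)

section \<open>Modular forms on \<open>\<Gamma>\<^sub>1(N)\<close>\<close>

definition upper_half_plane :: "complex set" where
  "upper_half_plane = {\<tau>. Im \<tau> > 0}"

text \<open>The tuple \<open>(a, b, c, d)\<close> stands for the matrix with rows \<open>(a, b)\<close> and \<open>(c, d)\<close>.\<close>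

definition SL2Z :: "(int \<times> int \<times> int \<times> int) set" where
  "SL2Z = {(a, b, c, d). a * d - b * c = 1}"

definition Gamma1 :: "nat \<Rightarrow> (int \<times> int \<times> int \<times> int) set" where
  "Gamma1 N = {(a, b, c, d) \<in> SL2Z.
     [a = 1] (mod int N) \<and> [d = 1] (mod int N) \<and> [c = 0] (mod int N)}"

fun slash :: "nat \<Rightarrow> (complex \<Rightarrow> complex) \<Rightarrow> int \<times> int \<times> int \<times> int \<Rightarrow> complex \<Rightarrow> complex" where
  "slash k f (a, b, c, d) \<tau> =
     f ((of_int a * \<tau> + of_int b) / (of_int c * \<tau> + of_int d)) / (of_int c * \<tau> + of_int d) ^ k"

text \<open>
  Holomorphy at the cusps is stated as boundedness of \<open>f|\<^sub>k\<gamma>\<close> near \<open>i\<infinity>\<close> for all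
  \<open>\<gamma> \<in> SL\<^sub>2(\<int>)\<close>.
\<close>

definition modular_forms_Gamma1 :: "nat \<Rightarrow> nat \<Rightarrow> (complex \<Rightarrow> complex) set" where
  "modular_forms_Gamma1 N k = {f.
     f holomorphic_on upper_half_plane \<and>
     (\<forall>\<gamma>\<in>Gamma1 N. \<forall>\<tau>\<in>upper_half_plane. slash k f \<gamma> \<tau> = f \<tau>) \<and>
     (\<forall>\<gamma>\<in>SL2Z. \<exists>y>0. bounded (slash k f \<gamma> ` {\<tau>. Im \<tau> \<ge> y}))}"


section \<open>The products and the sets \<open>L\<^sub>N(k)\<close>\<close>

definition qpoch :: "complex \<Rightarrow> complex \<Rightarrow> complex" where
  "qpoch x q = (\<Prod>n. 1 - x * q ^ n)"

text \<open>Vectors are indexed from 0, so \<open>a\<^sub>j\<close> with \<open>1 \<le> j \<le> m\<close> is \<open>a $ (j - 1)\<close>.\<close>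

definition S1 :: "nat \<Rightarrow> nat \<Rightarrow> int vec \<Rightarrow> int" where
  "S1 N a0 a = int a0 + 2 * (\<Sum>j=1..N div 2. a $ (j - 1))"

definition S2 :: "nat \<Rightarrow> int vec \<Rightarrow> int" where
  "S2 N a = (\<Sum>j=1..N div 2. int j * int (N - j) * a $ (j - 1))"

definition prod_fun :: "nat \<Rightarrow> nat \<Rightarrow> int vec \<Rightarrow> complex \<Rightarrow> complex" where
  "prod_fun N a0 a \<tau> =
     (let q = exp (2 * pi * \<i> * \<tau>);
          w = real N / 24 * of_int (S1 N a0 a) - 1 / (2 * real N) * of_int (S2 N a)
      in exp (2 * pi * \<i> * \<tau> * of_real w) * qpoch (q ^ N) (q ^ N) ^ a0 *
         (\<Prod>j=1..N div 2. (qpoch (q ^ j) (q ^ N) * qpoch (q ^ (N - j)) (q ^ N)) powi (a $ (j - 1))))"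

definition L :: "nat \<Rightarrow> nat \<Rightarrow> int vec set" where
  "L N k = {a \<in> carrier_vec (N div 2). prod_fun N (2 * k) a \<in> modular_forms_Gamma1 N k}"

definition quasipolynomial :: "nat \<Rightarrow> nat \<Rightarrow> (nat \<Rightarrow> real) \<Rightarrow> bool" where
  "quasipolynomial D E Q \<longleftrightarrow> (\<exists>c :: nat \<Rightarrow> nat \<Rightarrow> real.
     (\<forall>i\<le>D. \<forall>k. c i (k + E) = c i k) \<and> (\<forall>k. Q k = (\<Sum>i\<le>D. c i k * real k ^ i)))"


section \<open>Cusps of \<open>X\<^sub>1(N)\<close> and their Galois orbits\<close>

text \<open>
  A coprime pair \<open>(a, c)\<close> represents \<open>a/c\<close> in the projective line over the rationals
  (\<open>c = 0\<close> is allowed), with \<open>(a, c)\<close> and \<open>(-a, -c)\<close> representing the same point.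
  \<open>cusp N (a, c)\<close> is the set of all coprime pairs representing a point of the class \<open>[a/c]\<close>.
\<close>

definition cusp :: "nat \<Rightarrow> int \<times> int \<Rightarrow> (int \<times> int) set" where
  "cusp N x = {(\<epsilon> * (p * fst x + q * snd x), \<epsilon> * (r * fst x + s * snd x)) | \<epsilon> p q r s.
     \<epsilon> \<in> {1, -1} \<and> (p, q, r, s) \<in> Gamma1 N}"

definition cusps :: "nat \<Rightarrow> (int \<times> int) set set" where
  "cusps N = {cusp N (a, c) | a c. coprime a c}"

text \<open>
  \<open>\<sigma>\<^sub>x[a/c] = [a/(xc)]\<close>, for \<open>x\<close> coprime to \<open>N\<close> and a representative \<open>a/c\<close> of the cusp with
  \<open>gcd(a, xc) = 1\<close>; such a representative exists, and the result does not depend on it.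
\<close>

definition galois :: "nat \<Rightarrow> int \<Rightarrow> (int \<times> int) set \<Rightarrow> (int \<times> int) set" where
  "galois N x C = (THE D. \<exists>a c. (a, c) \<in> C \<and> coprime a (x * c) \<and> D = cusp N (a, x * c))"

definition galois_orbit :: "nat \<Rightarrow> (int \<times> int) set \<Rightarrow> (int \<times> int) set set" where
  "galois_orbit N C = {galois N x C | x. coprime x (int N)}"

text \<open>
  A choice of orbit representatives \<open>\<cc>\<^sub>i = [a/c]\<close>, \<open>0 \<le> i \<le> m\<close>, where \<open>(a, c) = cs i\<close>
  and the last one is \<open>[i\<infinity>]\<close>.
\<close>

definition cusp_orbit_reps :: "nat \<Rightarrow> (nat \<Rightarrow> int \<times> int) \<Rightarrow> bool" where
  "cusp_orbit_reps N cs \<longleftrightarrow>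
     (\<forall>i\<le>N div 2. coprime (fst (cs i)) (snd (cs i))) \<and>
     bij_betw (\<lambda>i. galois_orbit N (cusp N (cs i))) {..N div 2} (galois_orbit N ` cusps N) \<and>
     cusp N (cs (N div 2)) = cusp N (1, int N)"

definition orbit_size :: "nat \<Rightarrow> (nat \<Rightarrow> int \<times> int) \<Rightarrow> nat \<Rightarrow> nat" where
  "orbit_size N cs i = card (galois_orbit N (cusp N (cs i)))"

definition cusp_gcd :: "nat \<Rightarrow> int \<times> int \<Rightarrow> int" where
  "cusp_gcd N x = gcd (snd x) (int N)"

text \<open>The division by 24 is exact for \<open>N \<ge> 5\<close>.\<close>

definition R :: "nat \<Rightarrow> nat" where
  "R N = (\<Sum>d | d dvd N. d * totient d * totient (N div d)) div 24"


section \<open>The matrices\<close>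

definition B2 :: "rat \<Rightarrow> rat" where
  "B2 x = x\<^sup>2 - x + 1 / 6"

definition A_mat :: "nat \<Rightarrow> (nat \<Rightarrow> int \<times> int) \<Rightarrow> rat mat" where
  "A_mat N cs = mat (N div 2) (N div 2) (\<lambda>(r, j).
     (let a = of_int (fst (cs r)); g = of_int (cusp_gcd N (cs r))
      in g / 2 * B2 (frac (of_nat (j + 1) * a / g))))"

definition B_mat :: "nat \<Rightarrow> rat mat" where
  "B_mat N =
    (if N = 5 then mat_of_rows_list 2 [[16, -5], [-4, 5]]
     else
       (let m = N div 2;
            e = (\<lambda>j. unit_vec m (j - 1) :: rat vec);
            M = N * gcd 2 N;
            rN = of_nat (2 * M mod 3);
            aN = (- of_nat M + 5 * rN) / 3;
            bN = (of_nat M - 8 * rN) / 3;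
            sq = (\<lambda>j. of_nat (j\<^sup>2) :: rat);
            js = filter (\<lambda>j. 3 dvd j) [3..<m + 1];
            j1 = hd js
        in mat_of_cols m (
             [16 \<cdot>\<^sub>v e 1 - 4 \<cdot>\<^sub>v e 2,
              aN \<cdot>\<^sub>v e 1 + bN \<cdot>\<^sub>v e 2 + rN \<cdot>\<^sub>v e 3] @
             map (\<lambda>j. ((sq j - 4) / 3) \<cdot>\<^sub>v e 1 - ((sq j - 1) / 3) \<cdot>\<^sub>v e 2 + e j)
               (filter (\<lambda>j. \<not> 3 dvd j) [3..<m + 1]) @
             [(sq j1 - 4) \<cdot>\<^sub>v e 1 - (sq j1 - 1) \<cdot>\<^sub>v e 2 + 3 \<cdot>\<^sub>v e j1] @
             map (\<lambda>j. ((sq j - sq j1) / 3) \<cdot>\<^sub>v (e 1 - e 2) - e j1 + e j) (tl js))))"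

definition V_mat :: "nat \<Rightarrow> (nat \<Rightarrow> int \<times> int) \<Rightarrow> rat mat" where
  "V_mat N cs = A_mat N cs * B_mat N"

text \<open>
  \<open>d i\<close>, \<open>i < m\<close>, is the elementary divisor \<open>d\<^sub>i\<^sub>+\<^sub>1\<close>; as usual the diagonal entries are
  non-negative and each divides the next. Invertibility of \<open>P\<close> and \<open>Q\<close> is over the integers.
\<close>

definition smith_normal_form ::
    "nat \<Rightarrow> rat mat \<Rightarrow> int mat \<Rightarrow> int mat \<Rightarrow> (nat \<Rightarrow> nat) \<Rightarrow> bool" where
  "smith_normal_form m V P Q d \<longleftrightarrow>
     P \<in> carrier_mat m m \<and> invertible_mat P \<and>
     Q \<in> carrier_mat m m \<and> invertible_mat Q \<and>
     map_mat of_int P * V * map_mat of_int Q = mat_diag m (\<lambda>i. of_nat (d i)) \<and>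
     (\<forall>i. i + 1 < m \<longrightarrow> d i dvd d (i + 1))"


section \<open>Characters and weighted complete homogeneous polynomials\<close>

definition a1_vec :: "nat \<Rightarrow> rat vec" where
  "a1_vec N = (if N = 5 then vec_of_list [-3, 2]
     else vec (N div 2) (\<lambda>i. if i = 0 then -3 else if i = 1 then 3 else if i = 2 then -1 else 0))"

text \<open>The vector below is integral, so taking floors does not change its entries.\<close>

definition alpha :: "nat \<Rightarrow> (nat \<Rightarrow> int \<times> int) \<Rightarrow> int mat \<Rightarrow> int vec" where
  "alpha N cs P = map_vec floor
     (- (map_mat of_int P *\<^sub>v
         ((1 / 12 :: rat) \<cdot>\<^sub>v vec (N div 2) (\<lambda>r. of_int (cusp_gcd N (cs r)))
          + A_mat N cs *\<^sub>v a1_vec N)))"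

definition omega :: "nat \<Rightarrow> complex" where
  "omega n = exp (2 * pi * \<i> / of_nat n)"

definition xi ::
    "nat \<Rightarrow> (nat \<Rightarrow> int \<times> int) \<Rightarrow> int mat \<Rightarrow> (nat \<Rightarrow> nat) \<Rightarrow> (nat \<Rightarrow> nat) \<Rightarrow> complex" where
  "xi N cs P d j = (\<Prod>i<N div 2. omega (d i) powi (int (j i) * alpha N cs P $ i))"

definition chi :: "nat \<Rightarrow> int mat \<Rightarrow> (nat \<Rightarrow> nat) \<Rightarrow> nat \<Rightarrow> (nat \<Rightarrow> nat) \<Rightarrow> complex" where
  "chi N P d r j =
     (if r < N div 2 then \<Prod>i<N div 2. omega (d i) powi (int (j i) * P $$ (i, r)) else 1)"

text \<open>The variables are \<open>x\<^sub>0, \<dots>, x\<^sub>m\<close>, with positive weights \<open>\<mu>\<^sub>0, \<dots>, \<mu>\<^sub>m\<close>.\<close>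

definition weighted_h :: "nat \<Rightarrow> (nat \<Rightarrow> nat) \<Rightarrow> nat \<Rightarrow> (nat \<Rightarrow> complex) \<Rightarrow> complex" where
  "weighted_h m \<mu> n x =
     (\<Sum>e \<in> {e \<in> {..m} \<rightarrow>\<^sub>E UNIV. (\<Sum>i\<le>m. \<mu> i * e i) = n}. \<Prod>i\<le>m. x i ^ e i)"

definition p_coeff :: "nat \<Rightarrow> nat \<Rightarrow> nat \<Rightarrow> nat \<Rightarrow> int" where
  "p_coeff N E r s =
     (\<Sum>a\<le>s. (-1) ^ a * int ((N div 2 + 1) choose a) * int (card (L N (E * (s - a) + r))))"

end

theory Submission
  imports Defs
begin

text \<open>
  Each product is, up to an explicit power of \<open>\<eta>(N\<tau>)\<^sup>2\<close>, a product of Siegel functions. The theta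
  product with the right quasi-periodicity is unique up to a factor, which yields the transformation
  law of Siegel functions under \<open>SL\<^sub>2(\<int>)\<close> with a constant 12th root of unity. Hence \<open>f\<^sub>a\<close> is a
  modular form of weight \<open>k\<close> on \<open>\<Gamma>\<^sub>1(N)\<close> if and only if \<open>k + \<Sum> a\<^sub>j\<close> is divisible by 12,
  \<open>\<Sum> j\<^sup>2 a\<^sub>j\<close> is divisible by \<open>N gcd(2, N)\<close>, and the orders at the cusps are non-negative. The
  vectors satisfying the two congruences form the coset \<open>k a\<^sup>(\<^sup>1\<^sup>) + B\<^sub>N \<int>\<^sup>m\<close>. The weighted sum of
  the orders over the Galois orbits is \<open>k R\<^sub>N\<close>, and \<open>A\<^sub>N\<close> is invertible, so \<open>|L\<^sub>N(k)|\<close> counts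
  effective divisors of degree \<open>k R\<^sub>N\<close> in one class modulo \<open>V\<^sub>N \<int>\<^sup>m\<close>; this is the character sum.
  The count is \<open>O(k\<^sup>m)\<close>, so along each residue class modulo \<open>E\<close> it is a polynomial of degree at
  most \<open>m\<close>, and its expansion in binomial coefficients follows by differencing.
\<close>

section \<open>The \<open>q\<close>-Pochhammer product\<close>

text \<open>Every theta and eta factor picks up the same constant under a given matrix, so the root
  of unity enters only through its power k + sum a_j. Its order is bounded without Dedekind sums:
  the group permutes three half periods, and fourth powers at half periods ignore integer shifts of
  the index, whence 12 = 3 * 4. The matrix with rows (1, 0) and (1, 1) shows that order 12 occurs.
  The factor gcd(2, N) comes from the equal parity of sum j a_j and sum j^2 a_j. The invertibility
  of A_N is the analytic heart of the count. Over all fractions x/N it is a statement about an even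
  function on Z/N averaged against B_2. The finite Fourier coefficients of B_2 are positive, and
  those at 1 and -1 outweigh the rest because pi^2 < 12; this takes the place of the non-vanishing
  of generalized Bernoulli numbers. The order at infinity is never prescribed: the degree relation
  fixes it, so m orders match m exponents. The quasipolynomial hypothesis leaves the degree open,
  and the growth bound is what supplies it.\<close>

lemma convergent_prod_qpoch:
  assumes "norm q < 1"
  shows "convergent_prod (\<lambda>n. 1 - x * q ^ n :: complex)"
proof -
  have "summable (\<lambda>n. norm ((1 - x * q ^ n) - 1))"
    using assms by (auto simp: norm_mult norm_power intro!: summable_mult summable_geometric)
  then show ?thesis
    by (intro abs_convergent_prod_imp_convergent_prod) (simp add: abs_convergent_prod_conv_summable)
qed

lemma qpoch_LIMSEQ:
  assumes "norm q < 1"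
  shows "(\<lambda>n. \<Prod>i<n. 1 - x * q ^ i) \<longlonglongrightarrow> qpoch x q"
  using convergent_prod_LIMSEQ[OF convergent_prod_qpoch[OF assms]]
  unfolding qpoch_def by (simp add: LIMSEQ_lessThan_iff_atMost)

lemma qpoch_rec:
  assumes "norm q < 1"
  shows "qpoch x q = (1 - x) * qpoch (x * q) q"
proof -
  have "(\<lambda>n. \<Prod>i<Suc n. 1 - x * q ^ i) \<longlonglongrightarrow> qpoch x q"
    using qpoch_LIMSEQ[OF assms] by (rule LIMSEQ_Suc)
  moreover have "(\<Prod>i<Suc n. 1 - x * q ^ i) = (1 - x) * (\<Prod>i<n. 1 - x * q * q ^ i)" for n
    by (subst prod.lessThan_Suc_shift) (simp add: mult.assoc)
  moreover have "(\<lambda>n. (1 - x) * (\<Prod>i<n. 1 - x * q * q ^ i)) \<longlonglongrightarrow> (1 - x) * qpoch (x * q) q"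
    by (intro tendsto_intros qpoch_LIMSEQ assms)
  ultimately show ?thesis using LIMSEQ_unique by auto
qed

lemma qpoch_eq_0_iff:
  assumes "norm q < 1"
  shows "qpoch x q = 0 \<longleftrightarrow> (\<exists>n. x * q ^ n = 1)"
proof -
  have "(\<lambda>n. 1 - x * q ^ n) has_prod qpoch x q"
    using convergent_prod_qpoch[OF assms] unfolding qpoch_def by (rule convergent_prod_has_prod)
  then show ?thesis by (auto simp: has_prod_eq_0_iff)
qed

lemma qpoch_holomorphic:
  assumes S: "open S" and x: "x holomorphic_on S" and q: "q holomorphic_on S"
    and q1: "\<And>z. z \<in> S \<Longrightarrow> norm (q z) < 1"
  shows "(\<lambda>z. qpoch (x z) (q z)) holomorphic_on S"
proof (rule holomorphic_uniform_sequence[OF S])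
  show "(\<lambda>z. \<Prod>i<n. 1 - x z * q z ^ i) holomorphic_on S" for n
    by (intro holomorphic_intros x q)
next
  fix z assume "z \<in> S"
  then obtain d where d: "d > 0" "cball z d \<subseteq> S" using S open_contains_cball by blast
  define K where "K = cball z d"
  have K: "compact K" "K \<subseteq> S" "K \<noteq> {}" using d by (auto simp: K_def)
  have cx: "continuous_on K x" and cq: "continuous_on K q"
    using x q K(2) holomorphic_on_imp_continuous_on holomorphic_on_subset by blast+
  obtain X where X: "\<And>w. w \<in> K \<Longrightarrow> norm (x w) \<le> X"
    using compact_imp_bounded[OF compact_continuous_image[OF cx K(1)]]
    by (auto simp: bounded_iff)
  \<comment> \<open>The maximum of |q| over the compact ball is attained, hence still below 1; it is
    the ratio of the majorizing geometric series.\<close>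
  have "continuous_on K (\<lambda>w. norm (q w))" using cq by (intro continuous_intros)
  then obtain w0 where w0: "w0 \<in> K" "\<And>w. w \<in> K \<Longrightarrow> norm (q w) \<le> norm (q w0)"
    using continuous_attains_sup[OF K(1,3)] by blast
  define \<rho> where "\<rho> = norm (q w0)"
  have \<rho>: "0 \<le> \<rho>" "\<rho> < 1" using q1 w0(1) K(2) by (auto simp: \<rho>_def)
  have "uniformly_convergent_on K (\<lambda>N w. \<Sum>n<N. norm ((1 - x w * q w ^ n) - 1))"
  proof (rule Weierstrass_m_test'_ev[where M = "\<lambda>n. X * \<rho> ^ n"])
    show "\<forall>\<^sub>F n in sequentially. \<forall>w\<in>K. norm (norm ((1 - x w * q w ^ n) - 1)) \<le> X * \<rho> ^ n"
    proof (intro always_eventually allI ballI)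
      fix n w assume w: "w \<in> K"
      have "norm (x w) * norm (q w) ^ n \<le> X * \<rho> ^ n"
        using w X[OF w] w0(2)[OF w] 
        by (intro mult_mono power_mono) (auto simp: \<rho>_def intro: order_trans[OF norm_ge_zero])
      then show "norm (norm ((1 - x w * q w ^ n) - 1)) \<le> X * \<rho> ^ n"
        by (simp add: norm_mult norm_power)
    qed
    show "summable (\<lambda>n. X * \<rho> ^ n)" using \<rho> by (intro summable_mult summable_geometric) auto
  qed
  then have "uniformly_convergent_on K (\<lambda>N w. \<Prod>n<N. 1 - x w * q w ^ n)"
    by (intro uniformly_convergent_on_prod' K continuous_intros cx cq)
  then obtain g where g: "uniform_limit K (\<lambda>N w. \<Prod>n<N. 1 - x w * q w ^ n) g sequentially"
    by (auto simp: uniformly_convergent_on_def)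
  have "g w = qpoch (x w) (q w)" if "w \<in> K" for w
    using tendsto_uniform_limitI[OF g that] qpoch_LIMSEQ[of "q w" "x w"] q1 that K(2)
      LIMSEQ_unique by blast
  then have "uniform_limit K (\<lambda>N w. \<Prod>n<N. 1 - x w * q w ^ n) (\<lambda>w. qpoch (x w) (q w)) sequentially"
    using g by (subst (asm) uniform_limit_cong'[where g = "\<lambda>N w. \<Prod>n<N. 1 - x w * q w ^ n" and i = "\<lambda>w. qpoch (x w) (q w)"]) auto
  then show "\<exists>d>0. cball z d \<subseteq> S \<and> uniform_limit (cball z d) (\<lambda>N w. \<Prod>n<N. 1 - x w * q w ^ n)
      (\<lambda>w. qpoch (x w) (q w)) sequentially"
    using d unfolding K_def by blast
qed

text \<open>Factor by factor, |1 - x q^n| lies between 1 - \<rho>^(n+1) and 1 + \<rho>^(n+1), so the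
  extreme values are taken at (\<rho>, \<rho>) and (-\<rho>, \<rho>). Uniform bounds from both sides
  are what later turns growth at a cusp into an exact order.\<close>

lemma qpoch_bounds:
  assumes "0 \<le> \<rho>" "\<rho> < 1"
  shows "\<exists>c>0. \<exists>C>0. \<forall>x q. norm x \<le> \<rho> \<longrightarrow> norm q \<le> \<rho> \<longrightarrow>
    c \<le> norm (qpoch x q) \<and> norm (qpoch x q) \<le> C"
proof -
  define r where "r = complex_of_real \<rho>"
  have nr: "norm r = \<rho>" using assms by (simp add: r_def)
  have r1: "norm r < 1" using nr assms by simp
  have lt: "\<rho> * \<rho> ^ n < 1" for n
    using power_Suc_less_one[of \<rho> n] assms by (cases "\<rho> = 0") auto
  have nlo: "norm (1 - r * r ^ n) = 1 - \<rho> * \<rho> ^ n" for n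
  proof -
    have "1 - r * r ^ n = complex_of_real (1 - \<rho> * \<rho> ^ n)" by (simp add: r_def)
    then show ?thesis using lt[of n] by (metis abs_of_nonneg diff_ge_0_iff_ge less_imp_le norm_of_real)
  qed
  have nhi: "norm (1 - (-r) * r ^ n) = 1 + \<rho> * \<rho> ^ n" for n
  proof -
    have "1 - (-r) * r ^ n = complex_of_real (1 + \<rho> * \<rho> ^ n)" by (simp add: r_def)
    then show ?thesis using assms by (metis (no_types) abs_of_nonneg add_nonneg_nonneg mult_nonneg_nonneg norm_of_real zero_le_one zero_le_power)
  qed
  have nz: "qpoch r r \<noteq> 0"
  proof
    assume "qpoch r r = 0"
    then obtain n where "r * r ^ n = 1" using qpoch_eq_0_iff[OF r1] by blast
    then show False using nlo[of n] lt[of n] by simp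
  qed
  have nz': "qpoch (-r) r \<noteq> 0"
  proof
    assume "qpoch (-r) r = 0"
    then obtain n where "(-r) * r ^ n = 1" using qpoch_eq_0_iff[OF r1] by blast
    then show False using nhi[of n] assms by (smt (verit) mult_nonneg_nonneg norm_zero right_minus_eq zero_le_power)
  qed
  have "norm (qpoch r r) \<le> norm (qpoch x q) \<and> norm (qpoch x q) \<le> norm (qpoch (-r) r)"
    if xq: "norm x \<le> \<rho>" "norm q \<le> \<rho>" for x q
  proof -
    have q1: "norm q < 1" using xq assms by simp
    have le: "norm (x * q ^ n) \<le> \<rho> * \<rho> ^ n" for n
      using xq assms by (auto simp: norm_mult norm_power intro!: mult_mono power_mono)
    have lo: "norm (1 - r * r ^ n) \<le> norm (1 - x * q ^ n)" for n
      unfolding nlo using norm_triangle_ineq2[of 1 "x * q ^ n"] le[of n] by simp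
    have hi: "norm (1 - x * q ^ n) \<le> norm (1 - (-r) * r ^ n)" for n
      unfolding nhi using norm_triangle_ineq4[of 1 "x * q ^ n"] le[of n] by simp
    have L: "(\<lambda>n. norm (\<Prod>i<n. 1 - y * s ^ i)) \<longlonglongrightarrow> norm (qpoch y s)" if "norm s < 1" for y s
      by (intro tendsto_norm qpoch_LIMSEQ that)
    have "norm (qpoch r r) \<le> norm (qpoch x q)"
      by (rule LIMSEQ_le[OF L[OF r1] L[OF q1]]) (use lo in \<open>auto intro!: prod_mono simp flip: prod_norm\<close>)
    moreover have "norm (qpoch x q) \<le> norm (qpoch (-r) r)"
      by (rule LIMSEQ_le[OF L[OF q1] L[OF r1]]) (use hi in \<open>auto intro!: prod_mono simp flip: prod_norm simp del: mult_minus_left\<close>)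
    ultimately show ?thesis by blast
  qed
  then show ?thesis using nz nz' by (intro exI[of _ "norm (qpoch r r)"] conjI exI[of _ "norm (qpoch (-r) r)"]) auto
qed

text \<open>Euler's identity between partitions into distinct and into odd parts, in the variable
  \<open>q\<^sup>2\<close>. Splitting \<open>C\<close> into even and odd powers gives
  \<open>B * F = C\<close>, and doubling gives \<open>A * C = F\<close>, so \<open>C\<close>
  cancels. It makes the product of the three half-period values of the theta function
  constant.\<close>

lemma qpoch_even_odd:
  assumes "norm q < 1"
  shows "qpoch (-(q\<^sup>2)) (q\<^sup>2) * qpoch q (q\<^sup>2) * qpoch (-q) (q\<^sup>2) = 1"
proof -
  have q2: "norm (q\<^sup>2) < 1" using assms by (simp add: norm_power power_less_one_iff abs_square_less_1)
  have q4: "norm (q ^ 4) < 1" using assms by (simp add: norm_power power_less_one_iff)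
  define A where "A = qpoch (-(q\<^sup>2)) (q\<^sup>2)"
  define B where "B = qpoch (q\<^sup>2) (q ^ 4)"
  define C where "C = qpoch (q\<^sup>2) (q\<^sup>2)"
  define F where "F = qpoch (q ^ 4) (q ^ 4)"
  have pow: "q ^ 4 = q\<^sup>2 * q\<^sup>2" "(q\<^sup>2) ^ i * (q\<^sup>2) ^ i = (q ^ 4) ^ i" for i
    by (simp_all flip: power_add power_mult)
  have AC: "A * C = F"
  proof -
    have "(\<lambda>n. (\<Prod>i<n. 1 - (-(q\<^sup>2)) * (q\<^sup>2) ^ i) * (\<Prod>i<n. 1 - q\<^sup>2 * (q\<^sup>2) ^ i)) \<longlonglongrightarrow> A * C"
      unfolding A_def C_def by (intro tendsto_mult qpoch_LIMSEQ q2)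
    moreover have "(\<Prod>i<n. 1 - (-(q\<^sup>2)) * (q\<^sup>2) ^ i) * (\<Prod>i<n. 1 - q\<^sup>2 * (q\<^sup>2) ^ i)
        = (\<Prod>i<n. 1 - q ^ 4 * (q ^ 4) ^ i)" for n
      unfolding prod.distrib[symmetric]
      by (intro prod.cong refl) (simp only: pow(1) power_mult_distrib, simp add: algebra_simps)
    ultimately show ?thesis using qpoch_LIMSEQ[OF q4, of "q ^ 4"] unfolding F_def
      by (simp add: LIMSEQ_unique)
  qed
  have BC: "qpoch q (q\<^sup>2) * qpoch (-q) (q\<^sup>2) = B"
  proof -
    have "(\<lambda>n. (\<Prod>i<n. 1 - q * (q\<^sup>2) ^ i) * (\<Prod>i<n. 1 - (-q) * (q\<^sup>2) ^ i)) \<longlonglongrightarrow> qpoch q (q\<^sup>2) * qpoch (-q) (q\<^sup>2)"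
      by (intro tendsto_mult qpoch_LIMSEQ q2)
    moreover have "(\<Prod>i<n. 1 - q * (q\<^sup>2) ^ i) * (\<Prod>i<n. 1 - (-q) * (q\<^sup>2) ^ i)
        = (\<Prod>i<n. 1 - q\<^sup>2 * (q ^ 4) ^ i)" for n
      unfolding prod.distrib[symmetric]
      by (intro prod.cong refl) (simp only: pow(2)[symmetric], simp add: power2_eq_square algebra_simps)
    ultimately show ?thesis using qpoch_LIMSEQ[OF q4, of "q\<^sup>2"] unfolding B_def
      by (simp add: LIMSEQ_unique)
  qed
  have BF: "B * F = C"
  proof -
    have "(\<lambda>n. (\<Prod>i<n. 1 - q\<^sup>2 * (q ^ 4) ^ i) * (\<Prod>i<n. 1 - q ^ 4 * (q ^ 4) ^ i)) \<longlonglongrightarrow> B * F"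
      unfolding B_def F_def by (intro tendsto_mult qpoch_LIMSEQ q4)
    moreover have "(\<Prod>i<n. 1 - q\<^sup>2 * (q ^ 4) ^ i) * (\<Prod>i<n. 1 - q ^ 4 * (q ^ 4) ^ i)
        = (\<Prod>i<2*n. 1 - q\<^sup>2 * (q\<^sup>2) ^ i)" for n
    proof (induction n)
      case (Suc n)
      have "q\<^sup>2 * (q\<^sup>2) ^ (2 * n) = q\<^sup>2 * (q ^ 4) ^ n" "q\<^sup>2 * (q\<^sup>2) ^ Suc (2 * n) = q ^ 4 * (q ^ 4) ^ n"
        by (simp_all only: power_mult[symmetric] power_add[symmetric]) (rule arg_cong[where f = "power q"], simp)+
      then have "(\<Prod>i<2 * Suc n. 1 - q\<^sup>2 * (q\<^sup>2) ^ i)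
          = (\<Prod>i<2 * n. 1 - q\<^sup>2 * (q\<^sup>2) ^ i) * (1 - q\<^sup>2 * (q ^ 4) ^ n) * (1 - q ^ 4 * (q ^ 4) ^ n)"
        by (simp only: mult_Suc_right prod.lessThan_Suc add_2_eq_Suc)
      then show ?case unfolding Suc.IH[symmetric] prod.lessThan_Suc by (simp only: mult_ac)
    qed simp
    moreover have "(\<lambda>n. \<Prod>i<2*n. 1 - q\<^sup>2 * (q\<^sup>2) ^ i) \<longlonglongrightarrow> C"
      using filterlim_compose[OF qpoch_LIMSEQ[OF q2, of "q\<^sup>2"], of "\<lambda>n. 2 * n"] unfolding C_def
      by (simp add: filterlim_subseq strict_mono_def)
    ultimately show ?thesis by (simp add: LIMSEQ_unique)
  qed
  have "C \<noteq> 0"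
  proof
    assume "C = 0"
    then obtain n where "q\<^sup>2 * (q\<^sup>2) ^ n = 1" using qpoch_eq_0_iff[OF q2] unfolding C_def by blast
    then have "norm (q\<^sup>2) ^ Suc n = 1" by (metis norm_one norm_power power_Suc)
    moreover have "norm (q\<^sup>2) ^ Suc n < 1" by (subst power_less_one_iff) (use q2 in auto)
    ultimately show False by simp
  qed
  moreover have "A * B * C = C" using AC BF by (metis mult.assoc mult.commute)
  ultimately have "A * B = 1" by simp
  then show ?thesis using BC by (simp add: A_def mult.assoc)
qed

section \<open>Theta products and their modular transformation\<close>

definition ee :: "complex \<Rightarrow> complex" where
  "ee x = exp (2 * pi * \<i> * x)"

lemma ee_nonzero [simp]: "ee x \<noteq> 0"
  by (simp add: ee_def)

lemma ee_0 [simp]: "ee 0 = 1"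
  by (simp add: ee_def)

lemma ee_add: "ee (x + y) = ee x * ee y"
  by (simp add: ee_def exp_add algebra_simps)

lemma ee_minus: "ee (- x) = inverse (ee x)"
  by (simp add: ee_def exp_minus)

lemma ee_diff: "ee (x - y) = ee x / ee y"
  by (simp add: ee_def exp_diff algebra_simps)

lemma ee_power: "ee x ^ n = ee (of_nat n * x)"
  by (induction n) (auto simp: ee_add algebra_simps)

lemma ee_powi: "ee x powi n = ee (of_int n * x)"
  by (auto simp: power_int_def ee_power ee_minus[symmetric])

lemma ee_eq_iff: "ee x = ee y \<longleftrightarrow> (\<exists>n. x = y + of_int n)"
proof -
  have "ee x = ee y \<longleftrightarrow> (\<exists>n::int. 2 * pi * \<i> * x = 2 * pi * \<i> * y + (of_int (2 * n) * pi) * \<i>)"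
    unfolding ee_def by (rule exp_eq)
  also have "\<dots> \<longleftrightarrow> (\<exists>n::int. (2 * pi * \<i>) * x = (2 * pi * \<i>) * (y + of_int n))"
    by (simp add: algebra_simps)
  also have "\<dots> \<longleftrightarrow> (\<exists>n. x = y + of_int n)"
    by (subst mult_left_cancel) auto
  finally show ?thesis .
qed

lemma ee_eq_1_iff: "ee x = 1 \<longleftrightarrow> (\<exists>n. x = of_int n)"
  using ee_eq_iff[of x 0] by simp

lemma ee_of_int [simp]: "ee (of_int n) = 1"
  using ee_eq_1_iff by blast

lemma ee_half: "ee (1 / 2) = - 1"
  by (simp add: ee_def exp_pi_i[simplified mult.commute] mult.commute)

lemma ee_half_odd:
  assumes "odd n"
  shows "ee (of_int n / 2) = - 1"
proof -
  obtain k where "n = 2 * k + 1" using assms oddE by blast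
  then have "of_int n / 2 = of_int k + 1 / (2 :: complex)" by (simp add: field_simps)
  then show ?thesis by (simp only: ee_add ee_half ee_of_int) simp
qed

lemma norm_ee: "norm (ee x) = exp (- 2 * pi * Im x)"
  by (simp add: ee_def)

lemma norm_ee_less_1: "Im t > 0 \<Longrightarrow> norm (ee t) < 1"
  by (simp add: norm_ee)

lemma ee_holomorphic [holomorphic_intros]: "f holomorphic_on S \<Longrightarrow> (\<lambda>z. ee (f z)) holomorphic_on S"
  unfolding ee_def by (intro holomorphic_intros)

text \<open>Up to a constant factor this is the Jacobi function theta_1(z | t) divided by eta(t).
  The quotient has weight 0, so its transformation law involves a root of unity and a Gaussian
  factor but no power of c t + d.\<close>

definition jtheta :: "complex \<Rightarrow> complex \<Rightarrow> complex" where
  "jtheta z t = ee (t / 12 - z / 2) * qpoch (ee z) (ee t) * qpoch (ee (t - z)) (ee t)"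

lemma jtheta_holomorphic:
  assumes "open S" "f holomorphic_on S" "g holomorphic_on S" "\<And>z. z \<in> S \<Longrightarrow> Im (g z) > 0"
  shows "(\<lambda>z. jtheta (f z) (g z)) holomorphic_on S"
  unfolding jtheta_def using assms by (intro holomorphic_intros qpoch_holomorphic norm_ee_less_1) auto

text \<open>The square of the Dedekind eta function. Up to the factor -2 pi i it is the derivative
  of \<open>jtheta\<close> at z = 0, and its transformation law is obtained by differentiating that
  of \<open>jtheta\<close>.\<close>

definition eta_sq :: "complex \<Rightarrow> complex" where
  "eta_sq t = ee (t / 12) * (qpoch (ee t) (ee t))\<^sup>2"

text \<open>What remains of \<open>jtheta\<close> after the factor \<open>1 - ee z\<close> is split
  off; its value at 0 is therefore the derivative of \<open>jtheta\<close> there, up to the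
  derivative of that factor.\<close>

definition jtheta' :: "complex \<Rightarrow> complex \<Rightarrow> complex" where
  "jtheta' z t = ee (t / 12 - z / 2) * qpoch (ee (z + t)) (ee t) * qpoch (ee (t - z)) (ee t)"

lemma jtheta_factor:
  assumes "Im t > 0"
  shows "jtheta z t = (1 - ee z) * jtheta' z t"
  unfolding jtheta_def jtheta'_def
  by (subst qpoch_rec[OF norm_ee_less_1[OF assms], of "ee z"]) (simp add: ee_add)

lemma jtheta'_0: "jtheta' 0 t = eta_sq t"
  by (simp add: jtheta'_def eta_sq_def power2_eq_square)

lemma eta_sq_nonzero:
  assumes "Im t > 0"
  shows "eta_sq t \<noteq> 0"
proof -
  have "qpoch (ee t) (ee t) \<noteq> 0"
  proof
    assume "qpoch (ee t) (ee t) = 0"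
    then obtain n where "ee t * ee t ^ n = 1" using qpoch_eq_0_iff[OF norm_ee_less_1[OF assms]] by blast
    then have "norm (ee t) ^ Suc n = 1" by (metis norm_one norm_power power_Suc)
    moreover have "norm (ee t) ^ Suc n < 1" by (subst power_less_one_iff) (use norm_ee_less_1[OF assms] in auto)
    ultimately show False by simp
  qed
  then show ?thesis by (simp add: eta_sq_def)
qed

lemma jtheta_add_1: "jtheta (z + 1) t = - jtheta z t"
proof -
  have e: "ee (x + 1) = ee x" "ee (x - 1) = ee x" for x 
    using ee_of_int[of 1] by (simp_all only: ee_add ee_diff of_int_1) simp_all
  have "ee (t / 12 - (z + 1) / 2) = - ee (t / 12 - z / 2)"
  proof -
    have "t / 12 - (z + 1) / 2 = t / 12 - z / 2 - 1 / 2" by (simp add: field_simps)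
    then show ?thesis by (simp only: ee_diff[of _ "1/2"] ee_half) simp
  qed
  moreover have "ee (t - (z + 1)) = ee (t - z)" using e(2)[of "t - z"] by (simp add: algebra_simps)
  ultimately show ?thesis by (simp add: jtheta_def e)
qed

text \<open>Adding t trades the leading factor \<open>1 - ee z\<close> of one Pochhammer product for
  a factor \<open>1 - ee (- z)\<close> of the other; their quotient is \<open>- ee (- z)\<close>,
  and the rest of the multiplier comes from the prefactor.\<close>

lemma jtheta_add_tau:
  assumes "Im t > 0"
  shows "jtheta (z + t) t = - ee (- t / 2 - z) * jtheta z t"
proof -
  note q = norm_ee_less_1[OF assms]
  define A where "A = qpoch (ee (z + t)) (ee t)"
  define B where "B = qpoch (ee (t - z)) (ee t)"
  have "qpoch (ee z) (ee t) = (1 - ee z) * A" unfolding A_def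
    by (subst qpoch_rec[OF q]) (simp add: ee_add)
  then have 1: "jtheta z t = ee (t / 12 - z / 2) * ((1 - ee z) * A) * B" by (simp add: jtheta_def B_def)
  have "qpoch (ee (t - (z + t))) (ee t) = (1 - ee (- z)) * B" unfolding B_def
    by (subst qpoch_rec[OF q]) (simp flip: ee_add)
  then have 2: "jtheta (z + t) t = ee (t / 12 - (z + t) / 2) * A * ((1 - ee (- z)) * B)"
    by (simp add: jtheta_def A_def)
  have 3: "ee (t / 12 - (z + t) / 2) = ee (- t / 2) * ee (t / 12 - z / 2)"
    unfolding ee_add[symmetric] by (rule arg_cong[where f = ee]) (simp add: field_simps)
  have 4: "1 - ee (- z) = - ee (- z) * (1 - ee z)"
    using ee_nonzero[of z] by (simp add: ee_minus field_simps)
  have 5: "ee (- t / 2 - z) = ee (- t / 2) * ee (- z)"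
    unfolding ee_add[symmetric] by (rule arg_cong[where f = ee]) simp
  show ?thesis unfolding 1 2 3 4 5 by (simp add: mult_ac)
qed

text \<open>Stated for an arbitrary F, because the uniqueness proof needs it for the unknown
  function as well as for \<open>jtheta\<close>. The sign (-1)^(m+n) is written as \<open>ee\<close>
  of a half-integer so that all multipliers combine by adding exponents.\<close>

lemma quasi_periodic_shift:
  assumes F1: "\<And>z. F (z + 1) = - F z" and Ft: "\<And>z. F (z + t) = - ee (- t / 2 - z) * F z"
  shows "F (z + of_int m * t + of_int n) = ee (of_int (m + n) / 2 - (of_int m)\<^sup>2 * t / 2 - of_int m * z) * F z"
proof -
  have 1: "F (z + of_int n) = ee (of_int n / 2) * F z" for z n
  proof (induction n rule: int_induct[where k = 0])
    case (step1 i)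
    have "F (z + of_int (i + 1)) = F (z + of_int i + 1)" by (simp add: add.assoc)
    also have "\<dots> = - (ee (of_int i / 2) * F z)" by (simp add: F1 step1)
    also have "\<dots> = ee (of_int i / 2 + 1 / 2) * F z" by (simp only: ee_add ee_half) simp
    finally show ?case by (simp add: add_divide_distrib)
  next
    case (step2 i)
    have "F (z + of_int (i - 1) + 1) = - F (z + of_int (i - 1))" by (rule F1)
    then have "F (z + of_int (i - 1)) = - F (z + of_int i)" by simp
    also have "\<dots> = - (ee (of_int i / 2) * F z)" by (simp add: step2)
    also have "\<dots> = ee (of_int i / 2 - 1 / 2) * F z" by (simp only: ee_diff ee_half) simp
    finally show ?case by (simp add: diff_divide_distrib)
  qed simp
  have 2: "F (z + of_int m * t) = ee (of_int m / 2 - (of_int m)\<^sup>2 * t / 2 - of_int m * z) * F z" for z m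
  proof (induction m rule: int_induct[where k = 0])
    case (step1 i)
    have "F (z + of_int (i + 1) * t) = F (z + of_int i * t + t)" by (simp add: algebra_simps)
    also have "\<dots> = - ee (- t / 2 - (z + of_int i * t)) * (ee (of_int i / 2 - (of_int i)\<^sup>2 * t / 2 - of_int i * z) * F z)"
      by (simp only: Ft step1)
    also have "\<dots> = ee (1 / 2 + (- t / 2 - (z + of_int i * t)) + (of_int i / 2 - (of_int i)\<^sup>2 * t / 2 - of_int i * z)) * F z"
      by (simp only: ee_add[of "_ + _"] ee_add[of "1/2"] ee_half) simp
    also have "1 / 2 + (- t / 2 - (z + of_int i * t)) + (of_int i / 2 - (of_int i)\<^sup>2 * t / 2 - of_int i * z)
       = of_int (i + 1) / 2 - (of_int (i + 1))\<^sup>2 * t / 2 - of_int (i + 1) * z"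
      by (simp add: field_simps power2_eq_square)
    finally show ?case .
  next
    case (step2 i)
    define w where "w = z + of_int (i - 1) * t"
    have "F (w + t) = - ee (- t / 2 - w) * F w" by (rule Ft)
    moreover have "ee (t / 2 + w) * ee (- t / 2 - w) = 1" by (simp flip: ee_add)
    ultimately have "F w = - ee (t / 2 + w) * F (w + t)" by simp
    also have "w + t = z + of_int i * t" by (simp add: w_def algebra_simps)
    also have "- ee (t / 2 + w) * F (z + of_int i * t) = - ee (t / 2 + w) * (ee (of_int i / 2 - (of_int i)\<^sup>2 * t / 2 - of_int i * z) * F z)"
      by (simp only: step2)
    also have "\<dots> = ee (- 1 / 2 + (t / 2 + w) + (of_int i / 2 - (of_int i)\<^sup>2 * t / 2 - of_int i * z)) * F z"
    proof -
      have "ee (- 1 / 2) = - 1" using ee_minus[of "1/2"] by (simp add: ee_half)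
      then show ?thesis by (simp only: ee_add[of "_ + _"] ee_add[of "- 1/2"]) simp
    qed
    also have "- 1 / 2 + (t / 2 + w) + (of_int i / 2 - (of_int i)\<^sup>2 * t / 2 - of_int i * z)
       = of_int (i - 1) / 2 - (of_int (i - 1))\<^sup>2 * t / 2 - of_int (i - 1) * z"
      by (simp add: field_simps power2_eq_square w_def)
    finally show ?case by (simp add: w_def)
  qed simp
  have "F (z + of_int m * t + of_int n) = ee (of_int n / 2 + (of_int m / 2 - (of_int m)\<^sup>2 * t / 2 - of_int m * z)) * F z"
    by (simp only: 1 2 ee_add) simp
  also have "of_int n / 2 + (of_int m / 2 - (of_int m)\<^sup>2 * t / 2 - of_int m * z) = of_int (m + n) / 2 - (of_int m)\<^sup>2 * t / 2 - of_int m * z"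
    by (simp add: add_divide_distrib)
  finally show ?thesis .
qed

lemmas jtheta_shift = quasi_periodic_shift[of "\<lambda>z. jtheta z t" t for t, OF jtheta_add_1 jtheta_add_tau]

lemma jtheta_eq_0_iff:
  assumes "Im t > 0"
  shows "jtheta z t = 0 \<longleftrightarrow> (\<exists>m n. z = of_int m * t + of_int n)"
proof
  assume "jtheta z t = 0"
  then have "qpoch (ee z) (ee t) = 0 \<or> qpoch (ee (t - z)) (ee t) = 0" by (simp add: jtheta_def)
  then obtain k where "ee z * ee t ^ k = 1 \<or> ee (t - z) * ee t ^ k = 1"
    using qpoch_eq_0_iff[OF norm_ee_less_1[OF assms]] by blast
  then have "ee (z + of_nat k * t) = 1 \<or> ee (t - z + of_nat k * t) = 1" by (simp add: ee_power ee_add)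
  then obtain n where "z + of_nat k * t = of_int n \<or> t - z + of_nat k * t = of_int n"
    unfolding ee_eq_1_iff by blast
  then show "\<exists>m n. z = of_int m * t + of_int n"
  proof
    assume "z + of_nat k * t = of_int n"
    then show ?thesis by (intro exI[of _ "- int k"] exI[of _ n]) (simp add: algebra_simps)
  next
    assume "t - z + of_nat k * t = of_int n"
    then show ?thesis by (intro exI[of _ "int k + 1"] exI[of _ "- n"]) (simp add: algebra_simps)
  qed
next
  assume "\<exists>m n. z = of_int m * t + of_int n"
  then obtain m n where z: "z = of_int m * t + of_int n" by blast
  have "jtheta 0 t = 0" using jtheta_factor[OF assms, of 0] by simp
  then show "jtheta z t = 0" using jtheta_shift[OF assms, of 0 m n] by (simp add: z)
qed

lemma jtheta_holomorphic_z [holomorphic_intros]: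
  assumes "Im t > 0" "f holomorphic_on S"
  shows "(\<lambda>z. jtheta (f z) t) holomorphic_on S"
proof -
  have "(\<lambda>z. jtheta z t) holomorphic_on UNIV"
    using assms by (intro jtheta_holomorphic) auto
  then have "((\<lambda>z. jtheta z t) \<circ> f) holomorphic_on S"
    using holomorphic_on_compose_gen[OF assms(2)] by simp
  then show ?thesis by (simp add: o_def)
qed

lemma jtheta_has_derivative_0:
  assumes "Im t > 0"
  shows "((\<lambda>z. jtheta z t) has_field_derivative - (2 * pi * \<i>) * eta_sq t) (at 0)"
proof -
  have "(\<lambda>z. jtheta' z t) holomorphic_on UNIV"
    unfolding jtheta'_def using assms by (intro holomorphic_intros qpoch_holomorphic norm_ee_less_1) auto
  then obtain D where D: "((\<lambda>z. jtheta' z t) has_field_derivative D) (at 0)"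
    by (metis DERIV_deriv_iff_field_differentiable holomorphic_on_imp_differentiable_at open_UNIV UNIV_I)
  have e: "((\<lambda>z. 1 - ee z) has_field_derivative - (2 * pi * \<i>)) (at 0)"
    unfolding ee_def by (auto intro!: derivative_eq_intros)
  have "((\<lambda>z. (1 - ee z) * jtheta' z t) has_field_derivative
      - (2 * pi * \<i>) * jtheta' 0 t + D * (1 - ee 0)) (at 0)"
    by (rule DERIV_mult[OF e D])
  then show ?thesis
    by (simp add: jtheta'_0 jtheta_factor[OF assms])
qed

lemma lattice_coordinates:
  assumes "Im t > 0"
  obtains m n :: int and x y :: real where "x \<in> {0..1}" "y \<in> {0..1}"
    "z = (of_real x + of_real y * t) + of_int m * t + of_int n"
proof -
  define y0 where "y0 = Im z / Im t"
  define x0 where "x0 = Re z - y0 * Re t"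
  have z: "z = of_real x0 + of_real y0 * t"
    using assms by (simp add: complex_eq_iff x0_def y0_def)
  show thesis
    by (rule that[of "frac x0" "frac y0" "\<lfloor>y0\<rfloor>" "\<lfloor>x0\<rfloor>"])
      (use less_imp_le[OF frac_lt_1] in \<open>auto simp: z, auto simp: frac_def algebra_simps\<close>)
qed

text \<open>The quotient of \<open>F\<close> by the theta product is doubly periodic and entire, hence constant.\<close>

lemma jtheta_unique:
  assumes t: "Im t > 0" and F: "F holomorphic_on UNIV" and F0: "F 0 = 0"
    and F1: "\<And>z. F (z + 1) = - F z" and Ft: "\<And>z. F (z + t) = - ee (- t / 2 - z) * F z"
  shows "\<exists>C. \<forall>z. F z = C * jtheta z t"
proof -
  define L where "L = {z. jtheta z t = 0}"
  define D where "D = - (2 * pi * \<i>) * eta_sq t"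
  have D: "((\<lambda>z. jtheta z t) has_field_derivative D) (at 0)" "D \<noteq> 0"
    using jtheta_has_derivative_0[OF t] eta_sq_nonzero[OF t] by (auto simp: D_def)
  define l where "l = deriv F 0 / D"
  \<comment> \<open>The same value \<open>l\<close>, the limit at 0, serves at all zeros: F and the
    theta product have equal multipliers, so the quotient looks alike near every lattice
    point.\<close>
  define R where "R = (\<lambda>z. if z \<in> L then l else F z / jtheta z t)"
  note shF = quasi_periodic_shift[of F t, OF F1 Ft]
  have shL: "z + of_int m * t + of_int n \<in> L \<longleftrightarrow> z \<in> L" for z m n
    by (simp add: L_def jtheta_shift[OF t])
  have per: "R (z + of_int m * t + of_int n) = R z" for z m n
    using shL by (simp add: R_def jtheta_shift[OF t] shF)
  have L0: "0 \<in> L" using jtheta_factor[OF t, of 0] by (simp add: L_def)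
  have holj: "(\<lambda>z. jtheta z t) holomorphic_on UNIV" by (intro holomorphic_intros t)
  have "open (- L)"
  proof -
    have "closed ((\<lambda>z. jtheta z t) -` {0})"
      using holomorphic_on_imp_continuous_on[OF holj]
      by (intro continuous_closed_vimage) (auto simp: continuous_on_eq_continuous_at[OF open_UNIV])
    moreover have "(\<lambda>z. jtheta z t) -` {0} = L" by (auto simp: L_def)
    ultimately show ?thesis by auto
  qed
  have offL: "R holomorphic_on - L"
  proof -
    have "(\<lambda>z. F z / jtheta z t) holomorphic_on - L"
      using F holj by (intro holomorphic_intros) (auto simp: L_def t intro: holomorphic_on_subset)
    then show ?thesis by (rule holomorphic_transform) (simp add: R_def)
  qed
  obtain r where r: "r > 0" "\<And>z. z \<in> ball 0 r \<Longrightarrow> z \<noteq> 0 \<Longrightarrow> z \<notin> L"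
  proof -
    have "eventually (\<lambda>z. (jtheta z t - jtheta 0 t) / (z - 0) \<noteq> 0) (at 0)"
      using D by (intro tendsto_imp_eventually_ne[of _ D]) (auto simp: has_field_derivative_iff)
    then have "eventually (\<lambda>z. z \<notin> L) (at 0)"
      using L0 by (auto simp: L_def elim: eventually_mono)
    then obtain r where "r > 0" "\<And>z. dist z 0 < r \<Longrightarrow> z \<noteq> 0 \<Longrightarrow> z \<notin> L"
      by (auto simp: eventually_at)
    then show ?thesis by (intro that[of r]) (auto simp: dist_commute)
  qed
  have ball0: "R holomorphic_on ball 0 r"
  proof -
    have "(F has_field_derivative deriv F 0) (at 0)"
      using F by (simp add: holomorphic_derivI)
    then have lim: "(\<lambda>z. F z / jtheta z t) \<midarrow>0\<rightarrow> l"
      by (rule lhopital_complex_simple[OF _ D(1)]) (use F0 L0 D(2) in \<open>auto simp: L_def l_def\<close>)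
    have "(\<lambda>z. F z / jtheta z t) holomorphic_on ball 0 r - {0}"
      using F holj r by (intro holomorphic_intros) (auto simp: L_def t intro: holomorphic_on_subset)
    then have "(\<lambda>z. if z = 0 then l else F z / jtheta z t) holomorphic_on ball 0 r"
      using removable_singularity[OF _ open_ball lim] by blast
    then show ?thesis by (rule holomorphic_transform) (use r L0 in \<open>auto simp: R_def\<close>)
  qed
  have "R analytic_on {z}" for z
  proof (cases "z \<in> L")
    case False
    then show ?thesis using offL \<open>open (- L)\<close> by (auto simp: analytic_at)
  next
    case True
    then obtain m n where z: "z = of_int m * t + of_int n"
      using jtheta_eq_0_iff[OF t] by (auto simp: L_def)
    \<comment> \<open>The singularity at a general lattice point is carried to the one at 0 by
      periodicity.\<close>
    have "(R \<circ> (\<lambda>w. w - z)) holomorphic_on ball z r"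
      by (rule holomorphic_on_compose_gen[OF _ ball0]) (auto intro!: holomorphic_intros simp: dist_norm norm_minus_commute)
    moreover have "(R \<circ> (\<lambda>w. w - z)) w = R w" for w
      using per[of "w - z" m n] by (simp add: z)
    ultimately have "R holomorphic_on ball z r" by (metis holomorphic_transform)
    then show ?thesis using r(1) by (auto simp: analytic_at intro!: exI[of _ "ball z r"])
  qed
  then have holR: "R holomorphic_on UNIV"
    using analytic_on_analytic_at analytic_imp_holomorphic by blast
  have "bounded (range R)"
  proof -
    define K where "K = (\<lambda>(x, y). complex_of_real x + of_real y * t) ` ({0..1} \<times> {0..1})"
    have "compact K" unfolding K_def
      by (intro compact_continuous_image compact_Times) (auto simp: case_prod_unfold intro!: continuous_intros)
    then have "compact (R ` K)"
      using holR by (intro compact_continuous_image) (auto intro: holomorphic_on_imp_continuous_on holomorphic_on_subset)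
    moreover have "range R \<subseteq> R ` K"
    proof clarify
      fix z
      obtain m n :: int and x y :: real where "x \<in> {0..1}" "y \<in> {0..1}"
        and z: "z = (of_real x + of_real y * t) + of_int m * t + of_int n"
        using lattice_coordinates[OF t] by metis
      then have "of_real x + of_real y * t \<in> K" by (auto simp: K_def)
      then show "R z \<in> R ` K" using per unfolding z by (metis imageI)
    qed
    ultimately show ?thesis using compact_imp_bounded bounded_subset by blast
  qed
  then obtain C where C: "R z = C" for z
    using Liouville_theorem[OF holR] by (auto simp: constant_on_def)
  have "F z = C * jtheta z t" for z
  proof (cases "z \<in> L")
    case True
    then obtain m n where z: "z = of_int m * t + of_int n"
      using jtheta_eq_0_iff[OF t] by (auto simp: L_def)
    have "F z = 0" using shF[of 0 m n] F0 by (simp add: z)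
    then show ?thesis using True by (simp add: L_def)
  next
    case False
    then show ?thesis using C[of z] by (auto simp: R_def L_def field_simps)
  qed
  then show ?thesis by blast
qed

section \<open>Transformation under the modular group\<close>

lemma autfac_nonzero:
  assumes "(a, b, c, d) \<in> SL2Z" "Im t > 0"
  shows "of_int c * t + of_int d \<noteq> 0"
proof
  assume 0: "of_int c * t + of_int d = 0"
  then have "Im (of_int c * t + of_int d) = 0" by simp
  then have "of_int c * Im t = 0" by simp
  then have "c = 0" using assms by simp
  then show False using 0 assms by (auto simp: SL2Z_def)
qed

lemma Im_moebius:
  assumes "(a, b, c, d) \<in> SL2Z" "Im t > 0"
  shows "Im ((of_int a * t + of_int b) / (of_int c * t + of_int d)) = Im t / (norm (of_int c * t + of_int d))\<^sup>2"
proof -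
  define j where "j = of_int c * t + of_int d"
  have "a * d - b * c = 1" using assms by (simp add: SL2Z_def)
  then have det: "real_of_int a * of_int d - of_int b * of_int c = 1"
    by (metis of_int_1 of_int_diff of_int_mult)
  have "Im ((of_int a * t + of_int b) / j) = Im ((of_int a * t + of_int b) * cnj j) / (norm j)\<^sup>2"
    by (metis Im_divide_of_real complex_div_cnj of_real_power)
  also have "Im ((of_int a * t + of_int b) * cnj j) = (of_int a * of_int d - of_int b * of_int c) * Im t"
    by (simp add: j_def algebra_simps)
  finally show ?thesis by (simp add: det j_def)
qed

lemma Im_moebius_pos:
  assumes "(a, b, c, d) \<in> SL2Z" "Im t > 0"
  shows "Im ((of_int a * t + of_int b) / (of_int c * t + of_int d)) > 0"
  using autfac_nonzero[OF assms] assms(2) by (simp add: Im_moebius[OF assms])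

text \<open>The value at \<open>z = 1 / 2\<close> of the quotient of the two sides of the transformation law.\<close>

fun theta_char :: "int \<times> int \<times> int \<times> int \<Rightarrow> complex \<Rightarrow> complex" where
  "theta_char (a, b, c, d) t =
    jtheta (1 / (2 * (of_int c * t + of_int d))) ((of_int a * t + of_int b) / (of_int c * t + of_int d))
      * ee (- of_int c / (8 * (of_int c * t + of_int d))) / jtheta (1 / 2) t"

declare theta_char.simps [simp del]

lemma jtheta_half_nonzero:
  assumes "Im t > 0"
  shows "jtheta (1 / 2) t \<noteq> 0"
proof
  assume "jtheta (1 / 2) t = 0"
  then obtain m n where mn: "1 / 2 = of_int m * t + of_int n" using jtheta_eq_0_iff[OF assms] by blast
  from arg_cong[OF mn, of Im] have "m = 0" using assms by simp
  with mn have "complex_of_int (n * 2) = of_int 1" by simp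
  then have "n * 2 = 1" by (simp only: of_int_eq_iff)
  then show False by presburger
qed

text \<open>Divided by the Gaussian factor, the left side is entire in z, vanishes at 0 and has the
  multipliers of \<open>jtheta z t\<close> under z + 1 and z + t, so \<open>jtheta_unique\<close>
  makes it a constant multiple of that function. Evaluation at the non-zero z = 1/2 identifies the
  constant with \<open>theta_char\<close>.\<close>

lemma jtheta_moebius:
  assumes g: "(a, b, c, d) \<in> SL2Z" and t: "Im t > 0"
  defines "j \<equiv> of_int c * t + of_int d"
  shows "jtheta (z / j) ((of_int a * t + of_int b) / j)
    = theta_char (a, b, c, d) t * ee (of_int c * z\<^sup>2 / (2 * j)) * jtheta z t"
proof -
  define t' where "t' = (of_int a * t + of_int b) / j"
  have j: "j \<noteq> 0" unfolding j_def by (rule autfac_nonzero[OF g t])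
  have t': "Im t' > 0" unfolding t'_def j_def by (rule Im_moebius_pos[OF g t])
  have det: "a * d - b * c = 1" using g by (simp add: SL2Z_def)
  then have detc: "complex_of_int a * of_int d = 1 + of_int b * of_int c"
    by (metis of_int_1 of_int_add of_int_mult diff_add_cancel)
  have t'j: "t' * j = of_int a * t + of_int b" using j by (simp add: t'_def)
  have ij: "1 / j = of_int (- c) * t' + of_int a"
  proof -
    have "(of_int (- c) * t' + of_int a) * j = - of_int c * (t' * j) + of_int a * j" by (simp add: algebra_simps)
    also have "\<dots> = 1" unfolding t'j unfolding j_def using detc by (simp add: algebra_simps)
    finally show ?thesis using j by (simp add: field_simps)
  qed
  have tj: "t / j = of_int d * t' + of_int (- b)"
  proof -
    have "(of_int d * t' + of_int (- b)) * j = of_int d * (t' * j) - of_int b * j" by (simp add: algebra_simps)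
    also have "\<dots> = (of_int a * of_int d) * t - of_int b * of_int c * t" unfolding t'j unfolding j_def by (simp add: algebra_simps)
    also have "\<dots> = t" unfolding detc by (simp add: algebra_simps)
    finally show ?thesis using j by (simp add: field_simps)
  qed
  \<comment> \<open>Modulo 2, a - c - a c is (a + 1) (c + 1) - 1, so its being odd means that the
    column (a, c) is not even; likewise for (b, d). These parities produce the minus signs in the
    two multipliers.\<close>
  have odd1: "odd (a - c - a * c)" and odd2: "odd (d - b - b * d)"
    using arg_cong[OF det, of odd] by auto
  define F where "F = (\<lambda>z. ee (- of_int c * z\<^sup>2 / (2 * j)) * jtheta (z / j) t')"
  have "\<exists>C. \<forall>z. F z = C * jtheta z t"
  proof (rule jtheta_unique[OF t])
    show "F holomorphic_on UNIV" unfolding F_def using j t' by (intro holomorphic_intros) auto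
    show "F 0 = 0" using jtheta_eq_0_iff[OF t', of 0] by (auto simp: F_def intro!: exI[of _ 0])
    show "F (z + 1) = - F z" for z
    proof -
      have "(z + 1) / j = z / j + of_int (- c) * t' + of_int a" by (simp only: add_divide_distrib ij add.assoc)
      then have "F (z + 1) = ee (- of_int c * (z + 1)\<^sup>2 / (2 * j)) *
          (ee (of_int (- c + a) / 2 - (of_int (- c))\<^sup>2 * t' / 2 - of_int (- c) * (z / j)) * jtheta (z / j) t')"
        by (simp only: F_def jtheta_shift[OF t'])
      also have "\<dots> = ee (- of_int c * (z + 1)\<^sup>2 / (2 * j) + (of_int (- c + a) / 2 - (of_int (- c))\<^sup>2 * t' / 2 - of_int (- c) * (z / j))) * jtheta (z / j) t'"
        by (simp only: ee_add mult.assoc)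
      also have "- of_int c * (z + 1)\<^sup>2 / (2 * j) + (of_int (- c + a) / 2 - (of_int (- c))\<^sup>2 * t' / 2 - of_int (- c) * (z / j))
        = of_int (a - c - a * c) / 2 + - of_int c * z\<^sup>2 / (2 * j)"
      proof -
        have "- of_int c * (z + 1)\<^sup>2 / (2 * j) + (of_int (- c + a) / 2 - (of_int (- c))\<^sup>2 * t' / 2 - of_int (- c) * (z / j))
          = (of_int (- c + a) / 2 - (of_int c)\<^sup>2 * t' / 2 - of_int c / 2 * (1 / j)) + - of_int c * z\<^sup>2 / (2 * j)"
          using j by (simp add: field_simps power2_eq_square)
        also have "of_int (- c + a) / 2 - (of_int c)\<^sup>2 * t' / 2 - of_int c / 2 * (1 / j) = of_int (a - c - a * c) / 2"
          unfolding ij by (simp add: field_simps power2_eq_square)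
        finally show ?thesis .
      qed
      finally show ?thesis by (simp only: ee_add ee_half_odd[OF odd1] F_def) simp
    qed
    show "F (z + t) = - ee (- t / 2 - z) * F z" for z
    proof -
      have "(z + t) / j = z / j + of_int d * t' + of_int (- b)" by (simp only: add_divide_distrib tj add.assoc)
      then have "F (z + t) = ee (- of_int c * (z + t)\<^sup>2 / (2 * j)) *
          (ee (of_int (d + - b) / 2 - (of_int d)\<^sup>2 * t' / 2 - of_int d * (z / j)) * jtheta (z / j) t')"
        by (simp only: F_def jtheta_shift[OF t'])
      also have "\<dots> = ee (- of_int c * (z + t)\<^sup>2 / (2 * j) + (of_int (d + - b) / 2 - (of_int d)\<^sup>2 * t' / 2 - of_int d * (z / j))) * jtheta (z / j) t'"
        by (simp only: ee_add mult.assoc)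
      also have "- of_int c * (z + t)\<^sup>2 / (2 * j) + (of_int (d + - b) / 2 - (of_int d)\<^sup>2 * t' / 2 - of_int d * (z / j))
        = of_int (d - b - b * d) / 2 + (- t / 2 - z) + - of_int c * z\<^sup>2 / (2 * j)"
      proof -
        have "of_int c * w * t / j + of_int d * (w / j) = (of_int c * t + of_int d) * w / j" for w
          by (simp add: algebra_simps add_divide_distrib)
        then have 1: "of_int c * w * t / j + of_int d * (w / j) = w" for w
          using j by (simp flip: j_def)
        have "of_int d * t' = t / j + of_int b" using tj by simp
        then have "of_int d * (of_int d * t') = of_int d * (t / j) + of_int b * of_int d"
          by (simp only: distrib_left mult.commute)
        then have "(of_int d)\<^sup>2 * t' = of_int d * (t / j) + of_int b * of_int d"
          by (simp only: power2_eq_square mult.assoc)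
        moreover have "of_int c * t * (t / j) + of_int d * (t / j) = t"
          using 1[of t] by simp
        ultimately have 2: "of_int c * t * (t / j) + (of_int d)\<^sup>2 * t' = t + of_int b * of_int d"
          by (simp add: algebra_simps)
        have e: "- of_int c * (z + t)\<^sup>2 / (2 * j) = - of_int c * z\<^sup>2 / (2 * j) - of_int c * z * t / j - of_int c * t * (t / j) / 2"
          using j by (simp add: field_simps power2_eq_square)
        have "- of_int c * (z + t)\<^sup>2 / (2 * j) + (of_int (d + - b) / 2 - (of_int d)\<^sup>2 * t' / 2 - of_int d * (z / j))
          = - of_int c * z\<^sup>2 / (2 * j) - (of_int c * z * t / j + of_int d * (z / j)) 
            - (of_int c * t * (t / j) + (of_int d)\<^sup>2 * t') / 2 + of_int (d - b) / 2"
          by (simp only: e) (simp add: add_divide_distrib diff_divide_distrib)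
        then show ?thesis unfolding 1 2 by (simp add: field_simps)
      qed
      finally show ?thesis by (simp only: ee_add[of "_ + (- t / 2 - z)"] ee_add[of _ "- t / 2 - z"] ee_half_odd[OF odd2] F_def) simp
    qed
  qed
  then obtain C where C: "\<And>z. F z = C * jtheta z t" by blast
  have halves: "(1 / 2) / j = 1 / (2 * j)" "- of_int c * (1 / 2)\<^sup>2 / (2 * j) = - of_int c / (8 * j)"
    by (simp_all add: power2_eq_square)
  have "theta_char (a, b, c, d) t = F (1 / 2) / jtheta (1 / 2) t"
    unfolding theta_char.simps j_def[symmetric] t'_def[symmetric] F_def halves by (simp only: mult.commute)
  also have "\<dots> = C" using C[of "1 / 2"] jtheta_half_nonzero[OF t] by simp
  finally have "theta_char (a, b, c, d) t = C" .
  moreover have "jtheta (z / j) t' = ee (of_int c * z\<^sup>2 / (2 * j)) * F z"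
  proof -
    have "ee (of_int c * z\<^sup>2 / (2 * j)) * ee (- of_int c * z\<^sup>2 / (2 * j)) = 1"
      unfolding ee_add[symmetric] by simp
    then show ?thesis unfolding F_def by (simp add: mult.assoc[symmetric])
  qed
  ultimately show ?thesis by (simp add: C t'_def)
qed

text \<open>Differentiation of the theta law at z = 0: the Gaussian factor has derivative 0 there
  and both theta products vanish, so the derivatives correspond. The inner derivative 1/j is the
  source of the weight.\<close>

lemma eta_sq_moebius:
  assumes g: "(a, b, c, d) \<in> SL2Z" and t: "Im t > 0"
  defines "j \<equiv> of_int c * t + of_int d"
  shows "eta_sq ((of_int a * t + of_int b) / j) = theta_char (a, b, c, d) t * j * eta_sq t"
proof -
  define t' where "t' = (of_int a * t + of_int b) / j"
  define K where "K = - (2 * pi * \<i>)"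
  have j: "j \<noteq> 0" unfolding j_def by (rule autfac_nonzero[OF g t])
  have t': "Im t' > 0" unfolding t'_def j_def by (rule Im_moebius_pos[OF g t])
  have 1: "((\<lambda>z. jtheta (z / j) t') has_field_derivative (K * eta_sq t') * (1 / j)) (at 0)"
    by (rule DERIV_chain2[where g = "\<lambda>z. z / j"]) (use jtheta_has_derivative_0[OF t'] j in \<open>auto intro!: derivative_eq_intros simp: K_def\<close>)
  define E where "E = (\<lambda>z. theta_char (a, b, c, d) t * ee (of_int c * z\<^sup>2 / (2 * j)))"
  have "(E has_field_derivative 0) (at 0)"
    unfolding E_def ee_def using j by (auto intro!: derivative_eq_intros)
  then have "((\<lambda>z. E z * jtheta z t) has_field_derivative 0 * jtheta 0 t + (K * eta_sq t) * E 0) (at 0)"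
    using jtheta_has_derivative_0[OF t] unfolding K_def by (rule DERIV_mult)
  moreover have "(\<lambda>z. E z * jtheta z t) = (\<lambda>z. jtheta (z / j) t')"
    using jtheta_moebius[OF g t] by (simp add: E_def t'_def j_def)
  ultimately have "(K * eta_sq t') * (1 / j) = 0 * jtheta 0 t + (K * eta_sq t) * E 0"
    using DERIV_unique[OF 1] by simp
  then have "K * (eta_sq t' * (1 / j)) = K * (eta_sq t * E 0)" by (simp only: mult.assoc mult_zero_left add_0)
  moreover have "K \<noteq> 0" by (simp add: K_def)
  ultimately have "eta_sq t' * (1 / j) = eta_sq t * E 0" by (simp only: mult_cancel_left) simp
  then show ?thesis using j by (simp add: E_def t'_def field_simps)
qed

section \<open>Siegel functions and the order of the multiplier\<close>

text \<open>
  The Gaussian factor absorbs the quadratic exponent in the transformation law of the theta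
  product, so that the group acts on the index \<open>(u, v)\<close> by matrix multiplication.
\<close>

definition siegel :: "real \<Rightarrow> real \<Rightarrow> complex \<Rightarrow> complex" where
  "siegel u v t = ee (of_real u * (of_real u * t + of_real v) / 2) * jtheta (of_real u * t + of_real v) t"

lemma siegel_moebius:
  assumes g: "(a, b, c, d) \<in> SL2Z" and t: "Im t > 0"
  shows "siegel u v ((of_int a * t + of_int b) / (of_int c * t + of_int d))
    = theta_char (a, b, c, d) t * siegel (u * a + v * c) (u * b + v * d) t"
proof -
  define j where "j = of_int c * t + of_int d"
  define t' where "t' = (of_int a * t + of_int b) / j"
  define u' where "u' = u * a + v * c"
  define z where "z = complex_of_real u' * t + of_real (u * b + v * d)"
  have j: "j \<noteq> 0" unfolding j_def by (rule autfac_nonzero[OF g t])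
  have det: "a * d - b * c = 1" using g by (simp add: SL2Z_def)
  then have det': "a * d = 1 + b * c" by simp
  have detc: "complex_of_int a * of_int d = 1 + of_int b * of_int c"
    unfolding of_int_mult[symmetric] det' by simp
  have zj: "of_real u * t' + of_real v = z / j"
    using j unfolding z_def t'_def u'_def by (simp add: field_simps) (simp add: j_def algebra_simps)
  \<comment> \<open>This identity merges the exponent of the Siegel factor at \<open>t'\<close> with
    the Gaussian exponent of the theta law into the Siegel factor of the transformed index.\<close>
  have "u + of_int c * z = of_real u' * j"
  proof -
    have "u + of_int c * z = complex_of_real u * (1 + of_int b * of_int c) + complex_of_real u * of_int a * of_int c * t
        + complex_of_real v * of_int c * of_int c * t + complex_of_real v * of_int c * of_int d"
      by (simp add: z_def u'_def algebra_simps)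
    also have "\<dots> = of_real u' * j" unfolding detc[symmetric] by (simp add: u'_def j_def algebra_simps)
    finally show ?thesis .
  qed
  then have ex: "u * (z / j) / 2 + of_int c * z\<^sup>2 / (2 * j) = of_real u' * z / 2"
  proof -
    have "u * (z / j) / 2 + of_int c * z\<^sup>2 / (2 * j) = (u + of_int c * z) * z / (2 * j)"
      using j by (simp add: field_simps power2_eq_square)
    also have "\<dots> = of_real u' * z / 2"
      unfolding \<open>u + of_int c * z = of_real u' * j\<close> using j by (simp add: field_simps)
    finally show ?thesis .
  qed
  have "siegel u v t' = ee (u * (z / j) / 2) * (theta_char (a, b, c, d) t * ee (of_int c * z\<^sup>2 / (2 * j)) * jtheta z t)"
    unfolding siegel_def zj using jtheta_moebius[OF g t, of z, folded j_def, folded t'_def] by (simp only:)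
  also have "\<dots> = theta_char (a, b, c, d) t * (ee (of_real u' * z / 2) * jtheta z t)"
    unfolding ex[symmetric] ee_add by (simp add: mult_ac)
  also have "\<dots> = theta_char (a, b, c, d) t * siegel u' (u * b + v * d) t"
    by (simp add: siegel_def z_def)
  finally show ?thesis by (simp add: t'_def j_def u'_def)
qed

text \<open>The Gaussian factor makes the multiplier independent of \<open>t\<close>, so integer
  shifts of the index change a product only by a constant. For the indices used later, the term (u n
  - v m) / 2 is the origin of the congruence on sum j^2 a_j.\<close>

lemma siegel_shift:
  assumes "Im t > 0"
  shows "siegel (u + of_int m) (v + of_int n) t
    = ee (of_int (m + n + m * n) / 2 + of_real (u * n - v * m) / 2) * siegel u v t"
proof -
  define w where "w = complex_of_real u * t + of_real v"
  have w: "of_real (u + of_int m) * t + of_real (v + of_int n) = w + of_int m * t + of_int n"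
    by (simp add: w_def algebra_simps)
  have "siegel (u + of_int m) (v + of_int n) t
     = ee (of_real (u + of_int m) * (w + of_int m * t + of_int n) / 2) *
       (ee (of_int (m + n) / 2 - (of_int m)\<^sup>2 * t / 2 - of_int m * w) * jtheta w t)"
    by (simp only: siegel_def w jtheta_shift[OF assms])
  also have "\<dots> = ee (of_real (u + of_int m) * (w + of_int m * t + of_int n) / 2 + 
       (of_int (m + n) / 2 - (of_int m)\<^sup>2 * t / 2 - of_int m * w)) * jtheta w t"
    by (simp only: ee_add mult.assoc)
  also have "of_real (u + of_int m) * (w + of_int m * t + of_int n) / 2 + 
       (of_int (m + n) / 2 - (of_int m)\<^sup>2 * t / 2 - of_int m * w)
     = (of_int (m + n + m * n) / 2 + of_real (u * n - v * m) / 2) + of_real u * w / 2"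
    by (simp add: w_def field_simps power2_eq_square)
  finally show ?thesis by (simp only: ee_add siegel_def w_def mult.assoc)
qed

text \<open>At half periods the shift multiplier is a fourth root of unity, so fourth powers see the
  numerators only modulo 2.\<close>

lemma siegel_half_pow4:
  assumes "Im t > 0"
  shows "siegel (of_int (m + 2 * k) / 2) (of_int (n + 2 * l) / 2) t ^ 4 = siegel (of_int m / 2) (of_int n / 2) t ^ 4"
proof -
  have "siegel (of_int (m + 2 * k) / 2) (of_int (n + 2 * l) / 2) t
      = siegel (of_int m / 2 + of_int k) (of_int n / 2 + of_int l) t"
    by (simp add: add_divide_distrib)
  also have "\<dots> ^ 4 = ee (4 * (of_int (k + l + k * l) / 2 + of_real (of_int m / 2 * l - of_int n / 2 * k) / 2))
      * siegel (of_int m / 2) (of_int n / 2) t ^ 4"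
    unfolding siegel_shift[OF assms] power_mult_distrib ee_power by simp
  also have "4 * (of_int (k + l + k * l) / 2 + of_real (of_int m / 2 * l - of_int n / 2 * k) / 2)
      = complex_of_int (2 * (k + l + k * l) + m * l - n * k)"
    by (simp add: field_simps)
  finally show ?thesis by (simp only: ee_of_int mult_1_left)
qed

lemma siegel_half_pow4_parity:
  assumes "Im t > 0"
  shows "siegel (of_int m / 2) (of_int n / 2) t ^ 4
    = siegel (of_bool (odd m) / 2) (of_bool (odd n) / 2) t ^ 4"
proof -
  have "m = of_bool (odd m) + 2 * (m div 2)" for m :: int
    by (cases "even m") (auto elim!: evenE oddE)
  from this[of m] this[of n] show ?thesis
    using siegel_half_pow4[OF assms, of "of_bool (odd m)" "m div 2" "of_bool (odd n)" "n div 2"] by simp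
qed

text \<open>With q = e^(pi i t), the three values are, up to constants, the squares of the Weber
  functions, that is, of the three products in \<open>qpoch_even_odd\<close> times powers of q. The
  products multiply to 1 and the powers of q cancel.\<close>

lemma siegel_half_product:
  assumes "Im t > 0"
  shows "siegel (1 / 2) 0 t * siegel 0 (1 / 2) t * siegel (1 / 2) (1 / 2) t = 2 * ee (- 3 / 8)"
proof -
  define q where "q = ee (t / 2)"
  have q2: "ee t = q\<^sup>2" unfolding q_def ee_power by simp
  have q1: "norm q < 1" unfolding q_def using assms by (intro norm_ee_less_1) simp
  have q21: "norm (q\<^sup>2) < 1" using norm_ee_less_1[OF assms] q2 by simp
  define A where "A = qpoch (-(q\<^sup>2)) (q\<^sup>2)"
  define B where "B = qpoch q (q\<^sup>2)"
  define C where "C = qpoch (-q) (q\<^sup>2)"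
  have ABC: "A * B * C = 1" using qpoch_even_odd[OF q1] by (simp add: A_def B_def C_def)
  have h: "ee (x + 1 / 2) = - ee x" "ee (x - 1 / 2) = - ee x" for x
    by (simp_all only: ee_add ee_diff ee_half) auto
  have "siegel (1 / 2) 0 t = ee (t / 8) * (ee (t / 12 - t / 4) * B * B)"
  proof -
    have "ee (t - t / 2) = q" by (simp add: q_def)
    then show ?thesis by (simp add: siegel_def jtheta_def B_def q2 q_def[symmetric])
  qed
  moreover have "siegel 0 (1 / 2) t = ee (t / 12 - 1 / 4) * (2 * A * A)"
  proof -
    have "qpoch (- 1) (q\<^sup>2) = 2 * A"
      unfolding A_def by (subst qpoch_rec[OF q21]) simp
    moreover have "ee (t - 1 / 2) = - (q\<^sup>2)" using h(2)[of t] q2 by simp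
    ultimately show ?thesis by (simp add: siegel_def jtheta_def A_def ee_half q2)
  qed
  moreover have "siegel (1 / 2) (1 / 2) t = ee ((t / 2 + 1 / 2) / 4) * (ee (t / 12 - (t / 2 + 1 / 2) / 2) * C * C)"
  proof -
    have "ee (t / 2 + 1 / 2) = - q" using h(1)[of "t / 2"] by (simp add: q_def)
    moreover have "t - (t / 2 + 1 / 2) = t / 2 - 1 / 2" by (simp add: field_simps)
    then have "ee (t - (t / 2 + 1 / 2)) = - q" using h(2)[of "t / 2"] by (simp only: q_def)
    ultimately show ?thesis by (simp add: siegel_def jtheta_def C_def q2)
  qed
  ultimately have "siegel (1 / 2) 0 t * siegel 0 (1 / 2) t * siegel (1 / 2) (1 / 2) t
     = 2 * (A * B * C) * (A * B * C) * (ee (t / 8) * ee (t / 12 - t / 4) * ee (t / 12 - 1 / 4) *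
        ee ((t / 2 + 1 / 2) / 4) * ee (t / 12 - (t / 2 + 1 / 2) / 2))"
    by (simp only: mult_ac)
  also have "ee (t / 8) * ee (t / 12 - t / 4) * ee (t / 12 - 1 / 4) * ee ((t / 2 + 1 / 2) / 4) * ee (t / 12 - (t / 2 + 1 / 2) / 2) = ee (- 3 / 8)"
    unfolding ee_add[symmetric] by (rule arg_cong[where f = ee]) (simp add: field_simps)
  finally show ?thesis by (simp add: ABC)
qed

text \<open>
  The group permutes the three half periods modulo \<open>\<int>\<^sup>2\<close>, and the product of the three
  values does not depend on the point of the upper half plane.
\<close>

lemma theta_char_pow_12:
  assumes g: "(a, b, c, d) \<in> SL2Z" and t: "Im t > 0"
  shows "theta_char (a, b, c, d) t ^ 12 = 1"
proof -
  define t' where "t' = (of_int a * t + of_int b) / (of_int c * t + of_int d)"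
  define C where "C = theta_char (a, b, c, d) t"
  have t': "Im t' > 0" unfolding t'_def by (rule Im_moebius_pos[OF g t])
  define G where "G = (\<lambda>m n :: int. siegel (of_int m / 2) (of_int n / 2) t ^ 4)"
  have par: "G m n = G (of_bool (odd m)) (of_bool (odd n))" for m n
    unfolding G_def using siegel_half_pow4_parity[OF t] by simp
  have "a * d - b * c = 1" using g by (simp add: SL2Z_def)
  from arg_cong[OF this, of odd] have par': "(odd a \<and> odd d) \<noteq> (odd b \<and> odd c)" by auto
  have G3: "G a b * G c d * G (a + c) (b + d) = G 1 0 * G 0 1 * G 1 1"
    using par' unfolding par[of a b] par[of c d] par[of "a + c" "b + d"]
    by (cases "even a"; cases "even b"; cases "even c"; cases "even d") auto
  have tr: "siegel (of_int m / 2) (of_int n / 2) t' ^ 4 = C ^ 4 * G (m * a + n * c) (m * b + n * d)" for m n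
    unfolding t'_def siegel_moebius[OF g t] C_def G_def power_mult_distrib
    by (simp add: add_divide_distrib)
  have 1: "(siegel (1 / 2) 0 s * siegel 0 (1 / 2) s * siegel (1 / 2) (1 / 2) s) ^ 4 = (2 * ee (- 3 / 8)) ^ 4"
    if "Im s > 0" for s using siegel_half_product[OF that] by simp
  have "(2 * ee (- 3 / 8)) ^ 4 = siegel (1 / 2) 0 t' ^ 4 * siegel 0 (1 / 2) t' ^ 4 * siegel (1 / 2) (1 / 2) t' ^ 4"
    unfolding power_mult_distrib[symmetric] by (simp only: 1[OF t'])
  also have "\<dots> = C ^ 4 * G a b * (C ^ 4 * G c d) * (C ^ 4 * G (a + c) (b + d))"
    using tr[of 1 0] tr[of 0 1] tr[of 1 1] by simp
  also have "\<dots> = (C ^ 4 * C ^ 4 * C ^ 4) * (G a b * G c d * G (a + c) (b + d))"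
    by (simp only: mult_ac)
  also have "C ^ 4 * C ^ 4 * C ^ 4 = C ^ 12" by (simp flip: power_add)
  also have "G a b * G c d * G (a + c) (b + d) = (2 * ee (- 3 / 8)) ^ 4"
    unfolding G3 using 1[OF t] by (simp add: G_def power_mult_distrib)
  finally show ?thesis by (simp add: C_def)
qed

text \<open>A continuous function on the connected half plane whose values are 12th roots of unity
  cannot vary.\<close>

lemma theta_char_const:
  assumes g: "(a, b, c, d) \<in> SL2Z" and t: "Im t > 0"
  shows "theta_char (a, b, c, d) t = theta_char (a, b, c, d) \<i>"
proof -
  let ?H = "{z. Im z > 0}"
  have 1: "(\<lambda>t. (of_int a * t + of_int b) / (of_int c * t + of_int d)) holomorphic_on ?H"
    using autfac_nonzero[OF g] by (intro holomorphic_intros) auto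
  have 2: "(\<lambda>t. 1 / (2 * (of_int c * t + of_int d))) holomorphic_on ?H"
    using autfac_nonzero[OF g] by (intro holomorphic_intros) (auto simp del: distrib_left_numeral)
  have op: "open ?H" by (rule open_halfspace_Im_gt)
  have "theta_char (a, b, c, d) holomorphic_on ?H"
    unfolding theta_char.simps
    by (intro holomorphic_intros jtheta_holomorphic[OF op 2 1] jtheta_holomorphic[OF op])
       (use autfac_nonzero[OF g] jtheta_half_nonzero Im_moebius_pos[OF g] in \<open>auto simp del: distrib_left_numeral\<close>)
  then have "continuous_on ?H (theta_char (a, b, c, d))"
    by (rule holomorphic_on_imp_continuous_on)
  moreover have "finite (theta_char (a, b, c, d) ` ?H)"
    by (rule finite_subset[OF _ finite_nth_roots[of 12 1]]) (use theta_char_pow_12[OF g] in auto)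
  moreover have "connected ?H" using convex_halfspace_Im_gt by (rule convex_connected)
  ultimately have "theta_char (a, b, c, d) constant_on ?H"
    using continuous_finite_range_constant by blast
  then show ?thesis using t by (fastforce simp: constant_on_def)
qed

text \<open>As a Moebius map this is S T^(-1) S, where S is t -> -1/t and T is t -> t + 1. Since S
  fixes i, the values of \<open>eta_sq\<close> at i and i - 1 determine the multiplier. It is a
  primitive 12th root of unity, which is what forces divisibility by 12 in the invariance
  criterion.\<close>

lemma theta_char_lower_unipotent:
  assumes t: "Im t > 0"
  shows "theta_char (1, 0, 1, 1) t = ee (- 1 / 12)"
proof -
  have el: "(1, 0, 1, 1) \<in> SL2Z" "(0, -1, 1, 0) \<in> SL2Z" "(1, -1, 0, 1) \<in> SL2Z" "(0, -1, 1, -1) \<in> SL2Z"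
    by (auto simp: SL2Z_def)
  define C where "C = (\<lambda>g. theta_char g \<i>)"
  have C: "eta_sq ((of_int a * t + of_int b) / (of_int c * t + of_int d)) = C (a, b, c, d) * (of_int c * t + of_int d) * eta_sq t"
    if "(a, b, c, d) \<in> SL2Z" "Im t > 0" for a b c d t
    using eta_sq_moebius[OF that] theta_char_const[OF that] by (simp add: C_def)
  have i: "Im \<i> > 0" "Im (- 1 / \<i>) > 0" "Im (\<i> - 1) > 0" by simp_all
  have ie: "eta_sq \<i> \<noteq> 0" by (rule eta_sq_nonzero) simp
  have "eta_sq (\<i> - 1) = C (1, -1, 0, 1) * eta_sq \<i>"
    using C[OF el(3) i(1)] by simp
  moreover have "eta_sq (\<i> - 1) = ee (- 1 / 12) * eta_sq \<i>"
  proof -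
    have "ee (\<i> - 1) = ee \<i>" using ee_of_int[of 1] by (simp only: ee_diff of_int_1) simp
    moreover have "(\<i> - 1) / 12 = - 1 / 12 + \<i> / 12" by (simp add: field_simps)
    then have "ee ((\<i> - 1) / 12) = ee (- 1 / 12) * ee (\<i> / 12)" by (simp only: ee_add)
    ultimately show ?thesis by (simp add: eta_sq_def)
  qed
  ultimately have T: "C (1, -1, 0, 1) = ee (- 1 / 12)" using ie by simp
  have "eta_sq (- 1 / (\<i> - 1)) = C (0, -1, 1, 0) * (\<i> - 1) * eta_sq (\<i> - 1)"
    using C[OF el(2) i(3)] by simp
  also have "\<dots> = C (0, -1, 1, 0) * (\<i> - 1) * C (1, -1, 0, 1) * eta_sq \<i>"
    using C[OF el(3) i(1)] by simp
  finally have 1: "eta_sq (- 1 / (\<i> - 1)) = C (0, -1, 1, 0) * (\<i> - 1) * C (1, -1, 0, 1) * eta_sq \<i>" .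
  have ii: "- 1 / \<i> = \<i>" by (simp add: field_simps)
  have "eta_sq \<i> = C (0, -1, 1, 0) * \<i> * eta_sq \<i>"
    using C[OF el(2) i(1)] ii by simp
  then have S: "C (0, -1, 1, 0) * \<i> = 1" using ie by simp
  have "eta_sq (\<i> / (\<i> + 1)) = C (1, 0, 1, 1) * (\<i> + 1) * eta_sq \<i>"
    using C[OF el(1) i(1)] by simp
  moreover have "\<i> / (\<i> + 1) = - 1 / (\<i> - 1)"
    by (auto simp: complex_eq_iff Re_divide Im_divide power2_eq_square)
  ultimately have "C (1, 0, 1, 1) * (\<i> + 1) = C (0, -1, 1, 0) * (\<i> - 1) * C (1, -1, 0, 1)"
    using 1 ie by simp
  also have "\<dots> = (C (0, -1, 1, 0) * \<i>) * C (1, -1, 0, 1) * (\<i> + 1)"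
    by (simp add: algebra_simps)
  finally have "C (1, 0, 1, 1) * (\<i> + 1) = ee (- 1 / 12) * (\<i> + 1)" unfolding S T by simp
  moreover have "\<i> + 1 \<noteq> 0" by (simp add: complex_eq_iff)
  ultimately have "C (1, 0, 1, 1) = ee (- 1 / 12)" by (metis mult_right_cancel)
  then show ?thesis using theta_char_const[OF el(1) t] by (simp add: C_def)
qed

text \<open>For 0 <= u < 1 and Im t >= 1, the infinite products stay between positive constants, so
  the size is that of the exponential prefactor. Its exponent combines u^2/2 from the Gaussian
  factor with 1/12 - u/2 from the theta product, which is half of B_2(u).\<close>

lemma siegel_bounds_aux:
  assumes u: "0 \<le> u" "u < 1" and uv: "u = 0 \<Longrightarrow> v \<notin> \<int>"
  shows "\<exists>c>0. \<exists>C>0. \<forall>t. Im t \<ge> 1 \<longrightarrow>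
    c * exp (- pi * (u\<^sup>2 - u + 1 / 6) * Im t) \<le> norm (siegel u v t) \<and>
    norm (siegel u v t) \<le> C * exp (- pi * (u\<^sup>2 - u + 1 / 6) * Im t)"
proof -
  \<comment> \<open>For u = 0 the first argument \<open>ee v\<close> has norm 1. Splitting off one
    factor, the constant \<open>K\<close>, replaces it by \<open>ee (t + v)\<close>; this is the
    case \<open>u0 = 1\<close>. The hypothesis on v keeps \<open>K\<close> positive.\<close>
  define u0 where "u0 = (if u = 0 then 1 else u)"
  define K where "K = (if u = 0 then norm (1 - ee (of_real v)) else 1)"
  define \<rho> where "\<rho> = max (exp (- 2 * pi * u0)) (exp (- 2 * pi * (1 - u)))"
  have "ee (of_real v) \<noteq> 1" if "u = 0"
  proof
    assume "ee (of_real v) = 1"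
    then obtain n where "complex_of_real v = of_int n" unfolding ee_eq_1_iff by blast
    then have "v = of_int n" by (metis of_real_eq_iff of_real_of_int_eq)
    then show False using uv that by simp
  qed
  then have K: "K > 0" by (simp add: K_def)
  have u0: "0 < u0" "u0 \<le> 1" using u by (auto simp: u0_def)
  have \<rho>: "0 \<le> \<rho>" "\<rho> < 1" using u0 u by (auto simp: \<rho>_def le_max_iff_disj)
  obtain c C where cC: "c > 0" "C > 0"
      "\<And>x q. norm x \<le> \<rho> \<Longrightarrow> norm q \<le> \<rho> \<Longrightarrow> c \<le> norm (qpoch x q) \<and> norm (qpoch x q) \<le> C"
    using qpoch_bounds[OF \<rho>] by blast
  have "K * c * c * exp (- pi * (u\<^sup>2 - u + 1 / 6) * Im t) \<le> norm (siegel u v t) \<and>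
    norm (siegel u v t) \<le> K * C * C * exp (- pi * (u\<^sup>2 - u + 1 / 6) * Im t)" if t: "Im t \<ge> 1" for t
  proof -
    define z where "z = complex_of_real u * t + of_real v"
    define x where "x = ee (of_real u0 * t + of_real v)"
    have t0: "Im t > 0" using t by simp
    have "Im t * u0 \<ge> u0" "Im t * (1 - u) \<ge> 1 - u" using t u u0 by (auto simp: mult_le_cancel_right1)
    moreover have "norm x = exp (- 2 * pi * (Im t * u0))"
      by (simp add: norm_ee x_def mult_ac)
    moreover have "norm (ee (t - z)) = exp (- 2 * pi * (Im t * (1 - u)))"
      by (simp add: norm_ee z_def algebra_simps)
    ultimately have "norm x \<le> exp (- 2 * pi * u0)" "norm (ee (t - z)) \<le> exp (- 2 * pi * (1 - u))"
      by simp_all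
    then have nx: "norm x \<le> \<rho>" "norm (ee (t - z)) \<le> \<rho>"
      by (simp_all add: \<rho>_def le_max_iff_disj)
    have "u0 \<le> Im t" using u0 t by linarith
    then have nq: "norm (ee t) \<le> \<rho>"
      by (auto simp: norm_ee \<rho>_def le_max_iff_disj)
    have x: "norm (qpoch (ee z) (ee t)) = K * norm (qpoch x (ee t))"
    proof (cases "u = 0")
      case True
      then show ?thesis
        by (subst qpoch_rec[OF norm_ee_less_1[OF t0]]) (simp add: x_def z_def K_def u0_def norm_mult ee_add mult.commute)
    next
      case False
      then show ?thesis by (simp add: x_def z_def K_def u0_def)
    qed
    define y where "y = of_real u * z / 2 + (t / 12 - z / 2)"
    have "siegel u v t = ee y * qpoch (ee z) (ee t) * qpoch (ee (t - z)) (ee t)"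
      unfolding y_def ee_add by (simp add: siegel_def z_def jtheta_def)
    moreover have "norm (ee y) = exp (- pi * (u\<^sup>2 - u + 1 / 6) * Im t)"
      by (simp add: norm_ee y_def z_def algebra_simps power2_eq_square)
    ultimately have n: "norm (siegel u v t) = K * norm (qpoch x (ee t)) * norm (qpoch (ee (t - z)) (ee t)) *
        exp (- pi * (u\<^sup>2 - u + 1 / 6) * Im t)"
      by (simp add: norm_mult x)
    show ?thesis unfolding n
      using cC(3)[OF nx(1) nq] cC(3)[OF nx(2) nq] cC(1,2) K
      by (intro conjI mult_right_mono mult_mono) auto
  qed
  then show ?thesis using K cC(1,2) by (intro exI[of _ "K * c * c"] exI[of _ "K * C * C"] conjI) auto
qed

lemma siegel_bounds:
  assumes uv: "u \<notin> \<int> \<or> v \<notin> \<int>"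
  shows "\<exists>c>0. \<exists>C>0. \<forall>t. Im t \<ge> 1 \<longrightarrow>
    c * exp (- pi * ((frac u)\<^sup>2 - frac u + 1 / 6) * Im t) \<le> norm (siegel u v t) \<and>
    norm (siegel u v t) \<le> C * exp (- pi * ((frac u)\<^sup>2 - frac u + 1 / 6) * Im t)"
proof -
  have "norm (siegel u v t) = norm (siegel (frac u) v t)" if "Im t \<ge> 1" for t
  proof -
    have "siegel u v t = siegel (frac u + of_int \<lfloor>u\<rfloor>) (v + of_int 0) t" by (simp add: frac_def)
    also have "\<dots> = ee (of_int (\<lfloor>u\<rfloor> + 0 + \<lfloor>u\<rfloor> * 0) / 2 + of_real (frac u * of_int 0 - v * of_int \<lfloor>u\<rfloor>) / 2) * siegel (frac u) v t"
      using that by (intro siegel_shift) simp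
    finally show ?thesis by (simp add: norm_mult norm_ee)
  qed
  moreover have "frac u = 0 \<Longrightarrow> v \<notin> \<int>" using uv frac_eq_0_iff by blast
  ultimately show ?thesis
    using siegel_bounds_aux[of "frac u" v] by (simp add: frac_lt_1 del: frac_eq_0_iff)
qed

section \<open>The products as functions on the upper half plane\<close>

text \<open>|f| is comparable to |q|^X near infinity, so X is the order of f in q. The bound from
  below makes the notion closed under inverses, as negative exponents require.\<close>

definition exp_order :: "(complex \<Rightarrow> complex) \<Rightarrow> real \<Rightarrow> bool" where
  "exp_order f X \<longleftrightarrow> (\<exists>c>0. \<exists>C>0. \<forall>t. Im t \<ge> 1 \<longrightarrow>
     c * exp (- 2 * pi * X * Im t) \<le> norm (f t) \<and> norm (f t) \<le> C * exp (- 2 * pi * X * Im t))"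

lemma exp_order_const: "x \<noteq> 0 \<Longrightarrow> exp_order (\<lambda>_. x) 0"
  unfolding exp_order_def by (intro exI[of _ "norm x"] conjI) auto

lemma exp_order_mult:
  assumes "exp_order f X" "exp_order g Y"
  shows "exp_order (\<lambda>t. f t * g t) (X + Y)"
proof -
  obtain c C where f: "c > 0" "C > 0" "\<And>t. Im t \<ge> 1 \<Longrightarrow>
     c * exp (- 2 * pi * X * Im t) \<le> norm (f t) \<and> norm (f t) \<le> C * exp (- 2 * pi * X * Im t)"
    using assms(1) unfolding exp_order_def by blast
  obtain d D where g: "d > 0" "D > 0" "\<And>t. Im t \<ge> 1 \<Longrightarrow>
     d * exp (- 2 * pi * Y * Im t) \<le> norm (g t) \<and> norm (g t) \<le> D * exp (- 2 * pi * Y * Im t)"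
    using assms(2) unfolding exp_order_def by blast
  have e: "exp (- 2 * pi * (X + Y) * s) = exp (- 2 * pi * X * s) * exp (- 2 * pi * Y * s)" for s
    by (simp add: algebra_simps flip: exp_add)
  have "(c * d) * exp (- 2 * pi * (X + Y) * Im t) \<le> norm (f t * g t)
      \<and> norm (f t * g t) \<le> (C * D) * exp (- 2 * pi * (X + Y) * Im t)" if t: "Im t \<ge> 1" for t
  proof
    have "(c * exp (- 2 * pi * X * Im t)) * (d * exp (- 2 * pi * Y * Im t)) \<le> norm (f t) * norm (g t)"
      using f(3)[OF t] g(3)[OF t] f(1) g(1) by (intro mult_mono) auto
    then show "(c * d) * exp (- 2 * pi * (X + Y) * Im t) \<le> norm (f t * g t)"
      unfolding e norm_mult by (simp add: mult_ac)
    have "norm (f t) * norm (g t) \<le> (C * exp (- 2 * pi * X * Im t)) * (D * exp (- 2 * pi * Y * Im t))"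
      using f(3)[OF t] g(3)[OF t] f(2) g(2) by (intro mult_mono) auto
    then show "norm (f t * g t) \<le> (C * D) * exp (- 2 * pi * (X + Y) * Im t)"
      unfolding e norm_mult by (simp add: mult_ac)
  qed
  then show ?thesis unfolding exp_order_def using f(1,2) g(1,2)
    by (intro exI[of _ "c * d"] exI[of _ "C * D"] conjI) auto
qed

lemma exp_order_inverse:
  assumes "exp_order f X"
  shows "exp_order (\<lambda>t. inverse (f t)) (- X)"
proof -
  obtain c C where f: "c > 0" "C > 0" "\<And>t. Im t \<ge> 1 \<Longrightarrow>
     c * exp (- 2 * pi * X * Im t) \<le> norm (f t) \<and> norm (f t) \<le> C * exp (- 2 * pi * X * Im t)"
    using assms(1) unfolding exp_order_def by blast
  have "inverse C * exp (- 2 * pi * (- X) * Im t) \<le> norm (inverse (f t)) \<and>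
      norm (inverse (f t)) \<le> inverse c * exp (- 2 * pi * (- X) * Im t)" if t: "Im t \<ge> 1" for t
  proof -
    have e: "exp (- 2 * pi * (- X) * Im t) = inverse (exp (- 2 * pi * X * Im t))"
      by (simp flip: exp_minus)
    have p: "0 < c * exp (- 2 * pi * X * Im t)" using f(1) by simp
    then have "0 < norm (f t)" using f(3)[OF t] by linarith
    then have "inverse (C * exp (- 2 * pi * X * Im t)) \<le> inverse (norm (f t))"
      "inverse (norm (f t)) \<le> inverse (c * exp (- 2 * pi * X * Im t))"
      using f(3)[OF t] p by (blast intro: le_imp_inverse_le)+
    then show ?thesis unfolding e inverse_mult_distrib[symmetric] norm_inverse by blast
  qed
  then show ?thesis unfolding exp_order_def using f(1,2)
    by (intro exI[of _ "inverse C"] exI[of _ "inverse c"] conjI) auto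
qed

lemma exp_order_power:
  assumes "exp_order f X"
  shows "exp_order (\<lambda>t. f t ^ n) (n * X)"
proof (induction n)
  case 0
  then show ?case using exp_order_const[of 1] by simp
next
  case (Suc n)
  show ?case using exp_order_mult[OF assms Suc] by (simp add: algebra_simps)
qed

lemma exp_order_powi:
  assumes "exp_order f X"
  shows "exp_order (\<lambda>t. f t powi n) (n * X)"
proof (cases "n \<ge> 0")
  case True
  then show ?thesis using exp_order_power[OF assms, of "nat n"] by (simp add: power_int_def)
next
  case False
  then show ?thesis using exp_order_power[OF exp_order_inverse[OF assms], of "nat (- n)"]
    by (simp add: power_int_def)
qed

lemma exp_order_prod:
  assumes "\<And>i. i \<in> I \<Longrightarrow> exp_order (f i) (X i)"
  shows "exp_order (\<lambda>t. \<Prod>i\<in>I. f i t) (\<Sum>i\<in>I. X i)"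
  using assms
proof (induction I rule: infinite_finite_induct)
  case (insert i I)
  then show ?case using exp_order_mult[of "f i" "X i"] by simp
qed (use exp_order_const[of 1] in simp_all)

lemma exp_order_siegel:
  assumes "u \<notin> \<int> \<or> v \<notin> \<int>"
  shows "exp_order (siegel u v) (((frac u)\<^sup>2 - frac u + 1 / 6) / 2)"
proof -
  have e: "- 2 * pi * (((frac u)\<^sup>2 - frac u + 1 / 6) / 2) * s = - pi * ((frac u)\<^sup>2 - frac u + 1 / 6) * s" for s
    by simp
  show ?thesis unfolding exp_order_def e using siegel_bounds[OF assms] by simp
qed

lemma exp_order_eta_sq: "exp_order eta_sq (1 / 12)"
proof -
  define \<rho> where "\<rho> = exp (- 2 * pi)"
  have \<rho>: "0 \<le> \<rho>" "\<rho> < 1" by (auto simp: \<rho>_def)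
  obtain c C where cC: "c > 0" "C > 0"
      "\<And>x q. norm x \<le> \<rho> \<Longrightarrow> norm q \<le> \<rho> \<Longrightarrow> c \<le> norm (qpoch x q) \<and> norm (qpoch x q) \<le> C"
    using qpoch_bounds[OF \<rho>] by blast
  have "exp_order (\<lambda>t. qpoch (ee t) (ee t)) 0"
    unfolding exp_order_def using cC by (intro exI[of _ c] exI[of _ C] conjI) (auto simp: norm_ee \<rho>_def)
  moreover have "exp_order (\<lambda>t. ee (t / 12)) (1 / 12)"
    unfolding exp_order_def by (intro exI[of _ 1] conjI) (auto simp: norm_ee)
  ultimately show ?thesis
    unfolding eta_sq_def using exp_order_mult[OF _ exp_order_power[of _ 0 2], of _ "1 / 12"] by simp
qed

text \<open>The j-th factor is the Siegel function at j times the torsion point (x, y), so a matrix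
  acts on the whole product through one index. The weight comes from the power of
  \<open>eta_sq\<close> alone.\<close>

definition klein_prod :: "nat \<Rightarrow> nat \<Rightarrow> int vec \<Rightarrow> real \<Rightarrow> real \<Rightarrow> complex \<Rightarrow> complex" where
  "klein_prod N k a x y w =
     eta_sq w ^ k * (\<Prod>j=1..N div 2. siegel (real j * x) (real j * y) w powi (a $ (j - 1)))"

definition coord_sum :: "nat \<Rightarrow> int vec \<Rightarrow> int" where
  "coord_sum N a = (\<Sum>j=1..N div 2. a $ (j - 1))"

definition coord_sum2 :: "nat \<Rightarrow> int vec \<Rightarrow> int" where
  "coord_sum2 N a = (\<Sum>j=1..N div 2. (int j)\<^sup>2 * a $ (j - 1))"

text \<open>For \<open>x = p / g\<close>, the order at a cusp \<open>[p / c]\<close> with \<open>g = gcd(c, N)\<close>, divided by \<open>g\<close>.\<close>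

definition cusp_order :: "nat \<Rightarrow> nat \<Rightarrow> int vec \<Rightarrow> real \<Rightarrow> real" where
  "cusp_order N k a x = real k / 12 + (\<Sum>j=1..N div 2. a $ (j - 1) *
     (((frac (real j * x))\<^sup>2 - frac (real j * x) + 1 / 6) / 2))"

lemma exp_order_klein_prod:
  assumes "\<And>j. j \<in> {1..N div 2} \<Longrightarrow> real j * x \<notin> \<int> \<or> real j * y \<notin> \<int>"
  shows "exp_order (klein_prod N k a x y) (cusp_order N k a x)"
proof -
  have "exp_order (\<lambda>w. eta_sq w ^ k * (\<Prod>j=1..N div 2. siegel (real j * x) (real j * y) w powi (a $ (j - 1))))
    (real k * (1 / 12) + (\<Sum>j=1..N div 2. a $ (j - 1) *
     (((frac (real j * x))\<^sup>2 - frac (real j * x) + 1 / 6) / 2)))"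
    using assms by (intro exp_order_mult exp_order_prod exp_order_power exp_order_powi exp_order_eta_sq exp_order_siegel)
  then show ?thesis unfolding klein_prod_def cusp_order_def by simp
qed

lemma klein_prod_moebius:
  assumes g: "(a, b, c, d) \<in> SL2Z" and w: "Im w > 0"
  shows "klein_prod N k v x y ((of_int a * w + of_int b) / (of_int c * w + of_int d))
    = theta_char (a, b, c, d) w powi (int k + coord_sum N v) * (of_int c * w + of_int d) ^ k *
      klein_prod N k v (x * a + y * c) (x * b + y * d) w"
proof -
  define C where "C = theta_char (a, b, c, d) w"
  have C0: "C \<noteq> 0" using theta_char_pow_12[OF g w] by (auto simp: C_def)
  define S where "S = (\<lambda>j. siegel (real j * (x * a + y * c)) (real j * (x * b + y * d)) w powi (v $ (j - 1)))"
  have "siegel (real j * x) (real j * y) ((of_int a * w + of_int b) / (of_int c * w + of_int d)) powi (v $ (j - 1))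
     = C powi (v $ (j - 1)) * S j" for j
    unfolding siegel_moebius[OF g w] C_def S_def by (simp add: power_int_mult_distrib algebra_simps)
  then have "klein_prod N k v x y ((of_int a * w + of_int b) / (of_int c * w + of_int d))
    = (C * (of_int c * w + of_int d) * eta_sq w) ^ k * ((\<Prod>j=1..N div 2. C powi (v $ (j - 1))) * (\<Prod>j=1..N div 2. S j))"
    unfolding klein_prod_def eta_sq_moebius[OF g w] C_def by (simp add: prod.distrib)
  also have "(\<Prod>j=1..N div 2. C powi (v $ (j - 1))) = C powi (coord_sum N v)"
  proof -
    have "(\<Prod>j\<in>J. C powi (v $ (j - 1))) = C powi (\<Sum>j\<in>J. v $ (j - 1))" for J
      using C0 by (induction J rule: infinite_finite_induct) (auto simp: power_int_add)
    then show ?thesis by (simp add: coord_sum_def)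
  qed
  also have "(C * (of_int c * w + of_int d) * eta_sq w) ^ k * (C powi (coord_sum N v) * (\<Prod>j=1..N div 2. S j))
    = C powi (int k + coord_sum N v) * (of_int c * w + of_int d) ^ k * (eta_sq w ^ k * (\<Prod>j=1..N div 2. S j))"
    using C0 by (simp add: power_int_add power_mult_distrib mult_ac)
  finally show ?thesis by (simp add: klein_prod_def C_def S_def)
qed

text \<open>At N t and index j/N, the Siegel prefactor contributes the power j^2/(2N) - j/2 + N/12
  of q, and each \<open>eta_sq\<close> contributes N/12. Summed with the exponents this is N S_1/24
  - S_2/(2N), so the fractional power in \<open>prod_fun\<close> is exactly the one for which
  nothing is left over.\<close>

lemma prod_fun_eq_klein_prod:
  assumes N: "N > 0" and t: "Im t > 0"
  shows "prod_fun N (2 * k) a t = klein_prod N k a (1 / real N) 0 (of_nat N * t)"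
proof -
  define q where "q = exp (2 * pi * \<i> * t)"
  have q: "q = ee t" by (simp add: q_def ee_def)
  have qN: "q ^ n = ee (of_nat n * t)" for n by (simp add: q ee_power)
  define Q where "Q = (\<lambda>j. qpoch (q ^ j) (q ^ N) * qpoch (q ^ (N - j)) (q ^ N))"
  define e where "e = (\<lambda>j. (of_nat j)\<^sup>2 / (2 * of_nat N) * t + of_nat N * t / 12 - of_nat j * t / 2)"
  have eta: "eta_sq (of_nat N * t) ^ k = ee (of_nat k * (of_nat N * t / 12)) * qpoch (q ^ N) (q ^ N) ^ (2 * k)"
    by (simp add: eta_sq_def power_mult_distrib ee_power qN power_mult)
  have sg: "siegel (real j * (1 / real N)) (real j * 0) (of_nat N * t) powi (a $ (j - 1))
      = ee (of_int (a $ (j - 1)) * e j) * Q j powi (a $ (j - 1))" if "j \<in> {1..N div 2}" for j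
  proof -
    have j: "j \<le> N" using that by auto
    have z: "complex_of_real (real j * (1 / real N)) * (of_nat N * t) + of_real (real j * 0) = of_nat j * t"
      using N by simp
    have "siegel (real j * (1 / real N)) (real j * 0) (of_nat N * t)
      = ee (of_real (real j * (1 / real N)) * (of_nat j * t) / 2) * (ee (of_nat N * t / 12 - of_nat j * t / 2)
         * qpoch (ee (of_nat j * t)) (ee (of_nat N * t)) * qpoch (ee (of_nat N * t - of_nat j * t)) (ee (of_nat N * t)))"
      unfolding siegel_def z jtheta_def by simp
    also have "\<dots> = ee (of_real (real j * (1 / real N)) * (of_nat j * t) / 2 + (of_nat N * t / 12 - of_nat j * t / 2)) * Q j"
      unfolding ee_add Q_def qN using j by (simp add: of_nat_diff left_diff_distrib)
    also have "of_real (real j * (1 / real N)) * (of_nat j * t) / 2 + (of_nat N * t / 12 - of_nat j * t / 2) = e j"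
      by (simp add: e_def power2_eq_square mult_ac)
    finally show ?thesis by (simp add: power_int_mult_distrib ee_powi)
  qed
  define w where "w = real N / 24 * of_int (S1 N (2 * k) a) - 1 / (2 * real N) * of_int (S2 N a)"
  have prod_ee: "(\<Prod>j\<in>J. ee (f j)) = ee (\<Sum>j\<in>J. f j)" for f and J :: "nat set"
    by (induction J rule: infinite_finite_induct) (auto simp: ee_add)
  have wt: "of_nat k * (of_nat N * t / 12) + (\<Sum>j=1..N div 2. of_int (a $ (j - 1)) * e j) = t * of_real w"
  proof -
    have "(\<Sum>j=1..N div 2. of_int (a $ (j - 1)) * e j)
      = (\<Sum>j=1..N div 2. t * of_real (real N / 24 * (2 * of_int (a $ (j - 1))) - 1 / (2 * real N) * of_int (int j * int (N - j) * a $ (j - 1))))"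
    proof (intro sum.cong refl)
      fix j assume "j \<in> {1..N div 2}"
      then have "j \<le> N" by auto
      then have c: "int (N - j) = int N - int j" by (simp add: of_nat_diff)
      show "of_int (a $ (j - 1)) * e j = t * of_real (real N / 24 * (2 * of_int (a $ (j - 1))) - 1 / (2 * real N) * of_int (int j * int (N - j) * a $ (j - 1)))"
        unfolding c using N by (simp add: e_def field_simps power2_eq_square)
    qed
    also have "\<dots> = t * of_real (\<Sum>j=1..N div 2. real N / 24 * (2 * of_int (a $ (j - 1))) - 1 / (2 * real N) * of_int (int j * int (N - j) * a $ (j - 1)))"
      by (simp only: of_real_sum sum_distrib_left)
    also have "(\<Sum>j=1..N div 2. real N / 24 * (2 * of_int (a $ (j - 1))) - 1 / (2 * real N) * of_int (int j * int (N - j) * a $ (j - 1)))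
      = real N / 24 * (2 * of_int (\<Sum>j=1..N div 2. a $ (j - 1))) - 1 / (2 * real N) * of_int (S2 N a)"
      unfolding S2_def of_int_sum by (simp only: sum_distrib_left sum_subtractf)
    finally show ?thesis unfolding w_def S1_def by (simp only:) (simp add: field_simps)
  qed
  have "klein_prod N k a (1 / real N) 0 (of_nat N * t)
     = ee (of_nat k * (of_nat N * t / 12)) * qpoch (q ^ N) (q ^ N) ^ (2 * k) *
       ((\<Prod>j=1..N div 2. ee (of_int (a $ (j - 1)) * e j)) * (\<Prod>j=1..N div 2. Q j powi (a $ (j - 1))))"
  proof -
    have "(\<Prod>j=1..N div 2. siegel (real j * (1 / real N)) (real j * 0) (of_nat N * t) powi (a $ (j - 1)))
      = (\<Prod>j=1..N div 2. ee (of_int (a $ (j - 1)) * e j) * Q j powi (a $ (j - 1)))"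
      by (intro prod.cong refl sg)
    then show ?thesis unfolding klein_prod_def eta by (simp only: prod.distrib)
  qed
  also have "\<dots> = ee (t * of_real w) * qpoch (q ^ N) (q ^ N) ^ (2 * k) * (\<Prod>j=1..N div 2. Q j powi (a $ (j - 1)))"
    unfolding prod_ee wt[symmetric] ee_add by (simp only: mult_ac)
  also have "\<dots> = prod_fun N (2 * k) a t"
    by (simp add: prod_fun_def Let_def q_def w_def Q_def ee_def mult_ac)
  finally show ?thesis ..
qed

section \<open>Holomorphy and absence of zeros\<close>

lemma siegel_nonzero:
  assumes t: "Im t > 0" and uv: "u \<notin> \<int> \<or> v \<notin> \<int>"
  shows "siegel u v t \<noteq> 0"
proof
  assume "siegel u v t = 0"
  then obtain m n where mn: "of_real u * t + of_real v = of_int m * t + of_int n"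
    using jtheta_eq_0_iff[OF t] by (auto simp: siegel_def)
  from arg_cong[OF mn, of Im] have u: "u = of_int m" using t by simp
  with arg_cong[OF mn, of Re] have "v = of_int n" by simp
  with u uv show False by simp
qed

lemma eta_sq_holomorphic: "eta_sq holomorphic_on {z. Im z > 0}"
  unfolding eta_sq_def
  by (intro holomorphic_intros qpoch_holomorphic open_halfspace_Im_gt norm_ee_less_1) auto

lemma siegel_holomorphic: "siegel u v holomorphic_on {z. Im z > 0}"
  unfolding siegel_def
  by (intro holomorphic_intros jtheta_holomorphic open_halfspace_Im_gt) auto

lemma of_nat_div_not_Ints:
  assumes "j \<in> {1..N div 2}" "N \<ge> 2"
  shows "real j * (1 / real N) \<notin> \<int>"
proof
  assume "real j * (1 / real N) \<in> \<int>"
  then obtain n where n: "real j * (1 / real N) = of_int n" by (auto elim: Ints_cases)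
  then have "real_of_int (int j) = real_of_int (n * int N)" using assms by (simp add: field_simps)
  then have "int j = n * int N" by (simp only: of_int_eq_iff)
  then have "int N dvd int j" by simp
  then have "N dvd j" by simp
  then have "N \<le> j" using assms by (intro dvd_imp_le) auto
  moreover have "j < N" using assms by auto
  ultimately show False by simp
qed

lemma klein_prod_nonzero:
  assumes "Im t > 0" "N \<ge> 2"
  shows "klein_prod N k a (1 / real N) 0 t \<noteq> 0"
  using siegel_nonzero[OF assms(1)] eta_sq_nonzero[OF assms(1)] of_nat_div_not_Ints assms(2)
  by (auto simp: klein_prod_def)

lemma prod_fun_holomorphic:
  assumes "N \<ge> 2"
  shows "prod_fun N (2 * k) a holomorphic_on upper_half_plane"
proof -
  have "klein_prod N k a (1 / real N) 0 holomorphic_on {z. Im z > 0}"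
    unfolding klein_prod_def
    using siegel_nonzero of_nat_div_not_Ints assms 
    by (intro holomorphic_intros eta_sq_holomorphic siegel_holomorphic) auto
  then have "(klein_prod N k a (1 / real N) 0 \<circ> (\<lambda>t. of_nat N * t)) holomorphic_on {z. Im z > 0}"
    by (intro holomorphic_on_compose_gen[where t = "{z. Im z > 0}"]) (use assms in \<open>auto intro!: holomorphic_intros\<close>)
  then show ?thesis unfolding upper_half_plane_def
    by (rule holomorphic_transform) (use assms in \<open>auto simp: prod_fun_eq_klein_prod\<close>)
qed

section \<open>Invariance under \<open>Gamma1\<close>\<close>

declare slash.simps [simp del]

text \<open>The products are evaluated at N t, and conjugation by diag(N, 1) turns rows (a, b), (c,
  d) into rows (a, N b), (c/N, d), again integral.\<close>

lemma Gamma1_cases: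
  assumes "(a, b, c, d) \<in> Gamma1 N"
  obtains s c' where "a = 1 + int N * s" "c = int N * c'" "(a, int N * b, c', d) \<in> SL2Z" "(a, b, c, d) \<in> SL2Z"
proof -
  have 1: "(a, b, c, d) \<in> SL2Z" "[a = 1] (mod int N)" "[c = 0] (mod int N)"
    using assms by (auto simp: Gamma1_def)
  from 1(2) have "int N dvd a - 1" by (simp add: cong_iff_dvd_diff)
  then obtain s where "a - 1 = int N * s" by blast
  then have s: "a = 1 + int N * s" by simp
  from 1(3) obtain c' where c: "c = int N * c'" by (auto simp: cong_0_iff)
  have "(a, int N * b, c', d) \<in> SL2Z" using 1(1) by (simp add: SL2Z_def c mult_ac)
  with s c 1(1) show ?thesis using that by blast
qed

text \<open>For a = 1 + N s, the conjugated matrix moves the index (1/N, 0) to (1/N + s, b), hence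
  the j-th factor by (j s, j b). This is the total exponent of the resulting shift multipliers,
  weighted with v.\<close>

definition gamma1_exponent :: "nat \<Rightarrow> int vec \<Rightarrow> int \<Rightarrow> int \<Rightarrow> real" where
  "gamma1_exponent N v s b = ((s + b) * (\<Sum>j=1..N div 2. int j * v $ (j - 1)) + coord_sum2 N v * s * b) / 2
     + coord_sum2 N v * b / (2 * real N)"

lemma klein_prod_shift:
  assumes N: "N > 0" and w: "Im w > 0"
  shows "klein_prod N k v ((1 + real N * of_int s) / N) (of_int b) w
    = ee (of_real (gamma1_exponent N v s b)) * klein_prod N k v (1 / real N) 0 w"
proof -
  define x where "x = (\<lambda>j. real_of_int ((s + b) * int j + (int j)\<^sup>2 * s * b) / 2 + real_of_int ((int j)\<^sup>2 * b) / (2 * real N))"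
  have sg: "siegel (real j * ((1 + real N * of_int s) / N)) (real j * of_int b) w powi (v $ (j - 1))
      = ee (of_real (of_int (v $ (j - 1)) * x j)) * siegel (real j * (1 / real N)) (real j * 0) w powi (v $ (j - 1))" for j
  proof -
    have "siegel (real j * ((1 + real N * of_int s) / N)) (real j * of_int b) w
       = siegel (real j * (1 / real N) + of_int (int j * s)) (real j * 0 + of_int (int j * b)) w"
      using N by (simp add: field_simps)
    also have "\<dots> = ee (of_int (int j * s + int j * b + int j * s * (int j * b)) / 2 +
        of_real (real j * (1 / real N) * of_int (int j * b) - real j * 0 * of_int (int j * s)) / 2) * siegel (real j * (1 / real N)) (real j * 0) w"
      by (rule siegel_shift[OF w])
    also have "of_int (int j * s + int j * b + int j * s * (int j * b)) / 2 +
        of_real (real j * (1 / real N) * of_int (int j * b) - real j * 0 * of_int (int j * s)) / 2 = complex_of_real (x j)"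
      using N by (simp add: x_def field_simps power2_eq_square)
    finally show ?thesis by (simp add: power_int_mult_distrib ee_powi)
  qed
  have prod_ee: "(\<Prod>j\<in>J. ee (f j)) = ee (\<Sum>j\<in>J. f j)" for f and J :: "nat set"
    by (induction J rule: infinite_finite_induct) (auto simp: ee_add)
  have "(\<Sum>j=1..N div 2. of_int (v $ (j - 1)) * x j) = gamma1_exponent N v s b"
  proof -
    have "(\<Sum>j=1..N div 2. of_int (v $ (j - 1)) * x j)
      = (\<Sum>j=1..N div 2. (real_of_int (s + b) / 2) * of_int (int j * v $ (j - 1)) + 
         (of_int (s * b) / 2 + of_int b / (2 * real N)) * of_int ((int j)\<^sup>2 * v $ (j - 1)))"
      by (intro sum.cong refl) (simp add: x_def algebra_simps add_divide_distrib)
    also have "\<dots> = (real_of_int (s + b) / 2) * of_int (\<Sum>j=1..N div 2. int j * v $ (j - 1)) + 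
         (of_int (s * b) / 2 + of_int b / (2 * real N)) * of_int (coord_sum2 N v)"
      unfolding coord_sum2_def of_int_sum by (simp only: sum.distrib sum_distrib_left[symmetric])
    also have "\<dots> = gamma1_exponent N v s b"
      unfolding gamma1_exponent_def by (simp add: algebra_simps add_divide_distrib)
    finally show ?thesis .
  qed
  then show ?thesis
    unfolding klein_prod_def sg prod.distrib prod_ee of_real_sum[symmetric] by (simp only: mult_ac)
qed

lemma slash_prod_fun_Gamma1:
  assumes N: "N \<ge> 2" and g: "(a, b, c, d) \<in> SL2Z" "a = 1 + int N * s" "c = int N * c'"
    "(a, int N * b, c', d) \<in> SL2Z" and t: "Im t > 0"
  shows "slash k (prod_fun N (2 * k) v) (a, b, c, d) t
    = theta_char (a, int N * b, c', d) (of_nat N * t) powi (int k + coord_sum N v) *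
      ee (of_real (gamma1_exponent N v s b)) * prod_fun N (2 * k) v t"
proof -
  define j where "j = of_int c * t + of_int d"
  define t' where "t' = (of_int a * t + of_int b) / j"
  have j: "j \<noteq> 0" unfolding j_def by (rule autfac_nonzero[OF g(1) t])
  have t': "Im t' > 0" unfolding t'_def j_def by (rule Im_moebius_pos[OF g(1) t])
  have w: "Im (of_nat N * t) > 0" using N t by simp
  have j': "of_int c' * (of_nat N * t) + of_int d = j" by (simp add: j_def g(3))
  have Nt': "of_nat N * t' = (of_int a * (of_nat N * t) + of_int (int N * b)) / j"
    by (simp add: t'_def algebra_simps)
  have "prod_fun N (2 * k) v t' = klein_prod N k v (1 / real N) 0 (of_nat N * t')"
    using N t' by (intro prod_fun_eq_klein_prod) auto
  also have "\<dots> = theta_char (a, int N * b, c', d) (of_nat N * t) powi (int k + coord_sum N v) * j ^ k *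
      klein_prod N k v (1 / real N * a + 0 * c') (1 / real N * (int N * b) + 0 * d) (of_nat N * t)"
    unfolding Nt' using klein_prod_moebius[OF g(4) w, of N k v "1 / real N" 0] unfolding j' by simp
  also have "1 / real N * a + 0 * c' = (1 + real N * of_int s) / N" by (simp add: g(2))
  also have "1 / real N * (int N * b) + 0 * d = of_int b" using N by simp
  also have "klein_prod N k v ((1 + real N * of_int s) / N) (of_int b) (of_nat N * t)
     = ee (of_real (gamma1_exponent N v s b)) * klein_prod N k v (1 / real N) 0 (of_nat N * t)"
    using N w by (intro klein_prod_shift) auto
  also have "klein_prod N k v (1 / real N) 0 (of_nat N * t) = prod_fun N (2 * k) v t"
    using N t by (intro prod_fun_eq_klein_prod[symmetric]) auto
  finally show ?thesis using j by (simp add: slash.simps t'_def j_def)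
qed

text \<open>Two matrices give necessity. Rows (1, 0), (N, 1) become (1, 0), (1, 1) after
  conjugation; the index does not move and the multiplier is a primitive 12th root of unity. Once 12
  divides \<open>n\<close>, translation by 1 is left with its shift multiplier, which says that 2 N
  divides N S + T. Since j^2 and j have equal parity, so have T and S, and the condition becomes N
  gcd(2, N) | T.\<close>

lemma prod_fun_Gamma1_invariant_iff:
  assumes N: "N \<ge> 2"
  shows "(\<forall>\<gamma>\<in>Gamma1 N. \<forall>\<tau>\<in>upper_half_plane. slash k (prod_fun N (2 * k) v) \<gamma> \<tau> = prod_fun N (2 * k) v \<tau>)
    \<longleftrightarrow> 12 dvd int k + coord_sum N v \<and> int (N * gcd 2 N) dvd coord_sum2 N v"
    (is "?inv \<longleftrightarrow> _")
proof
  define S where "S = (\<Sum>j=1..N div 2. int j * v $ (j - 1))"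
  define T where "T = coord_sum2 N v"
  define n where "n = int k + coord_sum N v"
  have par: "even T = even S"
  proof -
    have "T - S = (\<Sum>j=1..N div 2. (int j * (int j - 1)) * v $ (j - 1))"
      by (simp add: T_def S_def coord_sum2_def flip: sum_subtractf) (simp add: algebra_simps power2_eq_square)
    moreover have "even \<dots>" by (intro dvd_sum) auto
    ultimately have "even (T - S)" by simp
    then show ?thesis by auto
  qed
  have pf0: "prod_fun N (2 * k) v t \<noteq> 0" if "Im t > 0" for t
    using that N klein_prod_nonzero[of "of_nat N * t" N k v] by (subst prod_fun_eq_klein_prod) auto
  {
    assume inv: ?inv
    have ch: "theta_char (a, int N * b, c', d) (of_nat N * \<i>) powi n * ee (of_real (gamma1_exponent N v s b)) = 1"
      if "(a, b, c, d) \<in> Gamma1 N" "a = 1 + int N * s" "c = int N * c'" for a b c d s c'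
    proof -
      have 1: "(a, b, c, d) \<in> SL2Z" using that by (auto simp: Gamma1_def)
      have 2: "(a, int N * b, c', d) \<in> SL2Z" using 1 that(3) by (simp add: SL2Z_def mult_ac)
      have "slash k (prod_fun N (2 * k) v) (a, b, c, d) \<i> = prod_fun N (2 * k) v \<i>"
        using inv that(1) by (auto simp: upper_half_plane_def)
      then show ?thesis
        unfolding slash_prod_fun_Gamma1[OF N 1 that(2,3) 2, of \<i>, simplified] n_def
        using pf0[of \<i>] by simp
    qed
    have "theta_char (1, 0, 1, 1) (of_nat N * \<i>) powi n = 1"
      using ch[of 1 0 "int N" 1 0 1] by (simp add: Gamma1_def SL2Z_def cong_0_iff gamma1_exponent_def)
    then have "ee (- 1 / 12) powi n = 1" using N by (subst (asm) theta_char_lower_unipotent) auto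
    then have "ee (of_int n * (- 1 / 12)) = 1" by (simp only: ee_powi)
    then obtain z where "of_int n * (- 1 / 12) = complex_of_int z" unfolding ee_eq_1_iff by blast
    then have "complex_of_int (- n) = of_int (12 * z)" by (simp add: field_simps)
    then have "- n = 12 * z" by (simp only: of_int_eq_iff)
    then have n12: "n = 12 * (- z)" by simp
    have el: "(1, int N, 0, 1) \<in> SL2Z" by (simp add: SL2Z_def)
    have "theta_char (1, int N, 0, 1) (of_nat N * \<i>) ^ 12 = 1"
      using N by (intro theta_char_pow_12[OF el]) auto
    then have "theta_char (1, int N, 0, 1) (of_nat N * \<i>) powi n = 1"
      unfolding n12 power_int_mult by simp
    then have "ee (of_real (gamma1_exponent N v 0 1)) = 1"
      using ch[of 1 1 0 1 0 0] by (simp add: Gamma1_def SL2Z_def)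
    then obtain z where "complex_of_real (gamma1_exponent N v 0 1) = of_int z" unfolding ee_eq_1_iff by blast
    then have "gamma1_exponent N v 0 1 = of_int z" by (metis of_real_eq_iff of_real_of_int_eq)
    then have "real_of_int (int N * S + T) = of_int (2 * int N * z)"
      using N by (simp add: gamma1_exponent_def field_simps S_def T_def)
    then have e: "int N * S + T = 2 * int N * z" by (simp only: of_int_eq_iff)
    have "int (N * gcd 2 N) dvd T"
    proof (cases "even N")
      case False
      then have "gcd 2 N = 1" by (metis coprime_iff_gcd_eq_1 coprime_left_2_iff_odd)
      moreover have "T = int N * (2 * z - S)" using e by (simp add: algebra_simps)
      ultimately show ?thesis by simp
    next
      case True
      then have gc: "gcd 2 N = 2" by (metis gcd_nat.absorb1)
      have "even T" using e True by (metis dvd_add_right_iff dvd_mult2 dvd_mult_right dvd_triv_left even_of_nat mult.assoc)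
      then obtain S' where "S = 2 * S'" using par by (auto elim: evenE)
      then have "T = int N * 2 * (z - S')" using e by (simp add: algebra_simps)
      then show ?thesis by (simp add: gc)
    qed
    then show "12 dvd int k + coord_sum N v \<and> int (N * gcd 2 N) dvd coord_sum2 N v"
      using n12 by (auto simp: n_def T_def)
  }
  {
    assume A: "12 dvd int k + coord_sum N v \<and> int (N * gcd 2 N) dvd coord_sum2 N v"
    then obtain n' where n': "n = 12 * n'" by (auto simp: n_def)
    obtain V where V: "T = int (N * gcd 2 N) * V" using A by (auto simp: T_def)
    have ex: "ee (of_real (gamma1_exponent N v s b)) = 1"
      if "(1 + int N * s, int N * b, c', d) \<in> SL2Z" for s b c' d
    proof -
      have det: "(1 + int N * s) * d - int N * b * c' = 1" using that by (simp add: SL2Z_def)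
      have "\<exists>z. int N * ((s + b) * S + T * s * b) + T * b = 2 * int N * z"
      proof (cases "even N")
        case False
        then have "gcd 2 N = 1" by (metis coprime_iff_gcd_eq_1 coprime_left_2_iff_odd)
        then have TV: "T = int N * V" using V by simp
        \<comment> \<open>For odd N the numbers S, T and V have one parity, so modulo 2 the sum is s
          (b + 1) S. If s is odd, the determinant condition read modulo 2 forces b to be
          odd.\<close>
        have "even ((s + b) * S + T * s * b + V * b)"
          using par False det[THEN arg_cong[where f = even]] by (auto simp: TV)
        then obtain z where "(s + b) * S + T * s * b + V * b = 2 * z" by (rule evenE)
        then have "int N * ((s + b) * S + T * s * b + V * b) = int N * (2 * z)" by simp
        then have "int N * ((s + b) * S + T * s * b) + T * b = 2 * int N * z"
          by (simp add: TV algebra_simps)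
        then show ?thesis by blast
      next
        case True
        then have gc: "gcd 2 N = 2" by (metis gcd_nat.absorb1)
        have TV: "T = 2 * int N * V" using V by (simp add: gc)
        then have "even S" using par by simp
        then obtain S' where S': "S = 2 * S'" by (auto elim: evenE)
        show ?thesis
          by (intro exI[of _ "(s + b) * S' + int N * V * s * b + V * b"]) (simp add: TV S' algebra_simps)
      qed
      then obtain z where z: "int N * ((s + b) * S + T * s * b) + T * b = 2 * int N * z" by blast
      have "real_of_int (int N * ((s + b) * S + T * s * b) + T * b) = gamma1_exponent N v s b * (2 * real N)"
        using N by (simp add: gamma1_exponent_def S_def T_def field_simps)
      then have "gamma1_exponent N v s b = of_int z" unfolding z using N by simp
      then show ?thesis by simp
    qed
    show ?inv
    proof (intro ballI)
      fix \<gamma> t assume \<gamma>: "\<gamma> \<in> Gamma1 N" and "t \<in> upper_half_plane"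
      then have t: "Im t > 0" by (simp add: upper_half_plane_def)
      obtain a b c d where abcd: "\<gamma> = (a, b, c, d)" by (metis prod_cases4)
      obtain s c' where g: "a = 1 + int N * s" "c = int N * c'" "(a, int N * b, c', d) \<in> SL2Z" "(a, b, c, d) \<in> SL2Z"
        using Gamma1_cases \<gamma> unfolding abcd by metis
      have "theta_char (a, int N * b, c', d) (of_nat N * t) ^ 12 = 1"
        using N t by (intro theta_char_pow_12[OF g(3)]) auto
      then have "theta_char (a, int N * b, c', d) (of_nat N * t) powi n = 1"
        unfolding n' power_int_mult by simp
      then show "slash k (prod_fun N (2 * k) v) \<gamma> t = prod_fun N (2 * k) v t"
        unfolding abcd slash_prod_fun_Gamma1[OF N g(4,1,2,3) t] n_def using ex g(1,3) by simp
    qed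
  }
qed

section \<open>Boundedness at the cusps\<close>

lemma coprime_bezout_diff:
  fixes a b :: int
  assumes "coprime a b"
  shows "\<exists>x y. x * a - y * b = 1"
proof -
  obtain u v where "u * a + v * b = gcd a b" using bezout_int by blast
  then have "u * a - (- v) * b = 1" using assms by simp
  then show ?thesis by blast
qed

text \<open>The matrix diag(N, 1) times the given one factors as (D p, y; r', x) times the upper
  triangular (G, B; 0, D), with G = gcd(r, N) and G D = N. Hence the slashed function has the
  absolute value of the Klein product with index (p/G, y/N) at (G t + B) / D, up to the constant
  D^k, and boundedness is the sign of its exponential order.\<close>

lemma prod_fun_cusp_bounded_iff:
  assumes N: "N \<ge> 2" and g: "(p, q, r, s) \<in> SL2Z"
  shows "(\<exists>y>0. bounded (slash k (prod_fun N (2 * k) v) (p, q, r, s) ` {\<tau>. Im \<tau> \<ge> y}))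
    \<longleftrightarrow> cusp_order N k v (of_int p / of_int (gcd r (int N))) \<ge> 0"
proof -
  define G where "G = gcd r (int N)"
  obtain D where D: "int N = G * D" by (metis G_def dvdE gcd_dvd2)
  obtain r' where r': "r = G * r'" by (metis G_def dvdE gcd_dvd1)
  have G0: "G > 0" using N by (simp add: G_def gcd_pos_int)
  then have D0: "D > 0" using D N by (smt (verit) mult_nonneg_nonpos of_nat_0_less_iff zero_less_mult_iff not_numeral_le_zero gr0I)
  have det: "p * s - q * r = 1" using g by (simp add: SL2Z_def)
  have "coprime D r'"
  proof -
    have "gcd (G * r') (G * D) = G" by (simp only: r'[symmetric] D[symmetric] G_def[symmetric])
    then have "gcd r' D = 1" using G0 by (simp add: gcd_mult_distrib_int[symmetric])
    then show ?thesis by (simp add: coprime_iff_gcd_eq_1 gcd.commute)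
  qed
  moreover have "coprime p r'"
  proof (rule coprimeI)
    fix x assume "x dvd p" "x dvd r'"
    then have "x dvd p * s - q * r" by (simp add: r')
    then show "is_unit x" by (simp add: det)
  qed
  ultimately have "coprime (D * p) r'" by simp
  then obtain x y where xy: "x * (D * p) - y * r' = 1"
    using coprime_bezout_diff by blast
  \<comment> \<open>The upper right entry of the triangular factor, found by multiplying with the
    inverse of (D p, y; r', x).\<close>
  define B where "B = x * int N * q - y * s"
  have g2: "(D * p, y, r', x) \<in> SL2Z" using xy by (simp add: SL2Z_def algebra_simps)
  have i1: "r' * B + x * D = s"
  proof -
    have "r' * B + x * D = x * (int N * r') * q - (y * r') * s + x * D" by (simp add: B_def algebra_simps)
    also have "int N * r' = D * r" by (simp add: D r' mult_ac)
    also have "y * r' = x * (D * p) - 1" using xy by simp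
    also have "x * (D * r) * q - (x * (D * p) - 1) * s + x * D = s + x * D * (1 - (p * s - q * r))"
      by (simp add: algebra_simps)
    finally show ?thesis by (simp add: det)
  qed
  have i2: "p * B + y = G * q"
  proof -
    have "p * B + y = x * int N * p * q - y * (p * s) + y" by (simp add: B_def algebra_simps)
    also have "p * s = 1 + q * r" using det by simp
    also have "x * int N * p * q - y * (1 + q * r) + y = G * q * (x * (D * p) - y * r')"
      by (simp add: D r' algebra_simps)
    finally show ?thesis by (simp add: xy)
  qed
  define u where "u = (\<lambda>t. (of_int G * t + of_int B) / (of_int D :: complex))"
  define \<kappa> where "\<kappa> = real_of_int G / of_int D"
  have \<kappa>: "\<kappa> > 0" using G0 D0 by (simp add: \<kappa>_def)
  have Imu: "Im (u t) = \<kappa> * Im t" for t by (simp add: u_def \<kappa>_def Im_divide power2_eq_square)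
  define X where "X = cusp_order N k v (of_int p / of_int G)"
  have nrm: "norm (slash k (prod_fun N (2 * k) v) (p, q, r, s) t)
      = norm (klein_prod N k v (of_int p / of_int G) (of_int y / real N) (u t)) / of_int D ^ k"
    if t: "Im t > 0" for t
  proof -
    define j where "j = of_int r * t + of_int s"
    define t' where "t' = (of_int p * t + of_int q) / j"
    have j: "j \<noteq> 0" unfolding j_def by (rule autfac_nonzero[OF g t])
    have t': "Im t' > 0" unfolding t'_def j_def by (rule Im_moebius_pos[OF g t])
    have w: "Im (u t) > 0" using \<kappa> t by (simp add: Imu)
    have Dc: "complex_of_int D \<noteq> 0" using D0 by simp
    have e1: "of_int r' * u t + of_int x = j / of_int D"
    proof -
      have "of_int r' * u t + of_int x = (of_int (G * r') * t + of_int (r' * B + x * D)) / of_int D"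
        using Dc by (simp add: u_def field_simps)
      then show ?thesis unfolding i1 r'[symmetric] j_def .
    qed
    have e2: "of_int (D * p) * u t + of_int y = of_int G * (of_int p * t + of_int q)"
    proof -
      have "of_int (D * p) * u t + of_int y = of_int G * of_int p * t + of_int (p * B + y)"
        using Dc by (simp add: u_def field_simps)
      then show ?thesis unfolding i2 by (simp add: algebra_simps)
    qed
    have Nt': "of_nat N * t' = (of_int (D * p) * u t + of_int y) / (of_int r' * u t + of_int x)"
    proof -
      have "complex_of_nat N = of_int G * of_int D" using D by (metis of_int_mult of_int_of_nat_eq)
      then show ?thesis unfolding e1 e2 t'_def using Dc j by (simp add: field_simps)
    qed
    have "prod_fun N (2 * k) v t' = klein_prod N k v (1 / real N) 0 (of_nat N * t')"
      using N t' by (intro prod_fun_eq_klein_prod) auto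
    also have "\<dots> = theta_char (D * p, y, r', x) (u t) powi (int k + coord_sum N v) * (j / of_int D) ^ k *
       klein_prod N k v (1 / real N * of_int (D * p) + 0 * of_int r') (1 / real N * of_int y + 0 * of_int x) (u t)"
      unfolding Nt' using klein_prod_moebius[OF g2 w, of N k v "1 / real N" 0] unfolding e1 by simp
    also have "1 / real N * of_int (D * p) + 0 * of_int r' = of_int p / of_int G"
    proof -
      have "real N = of_int G * of_int D" using D by (metis of_int_mult of_int_of_nat_eq)
      then show ?thesis using G0 D0 by simp
    qed
    finally have "prod_fun N (2 * k) v t' / j ^ k = theta_char (D * p, y, r', x) (u t) powi (int k + coord_sum N v) *
       klein_prod N k v (of_int p / of_int G) (of_int y / real N) (u t) / of_int D ^ k"
      using j by (simp add: power_divide)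
    moreover have "norm (theta_char (D * p, y, r', x) (u t)) = 1"
    proof -
      have "norm (theta_char (D * p, y, r', x) (u t)) ^ 12 = 1"
        using theta_char_pow_12[OF g2 w] by (metis norm_one norm_power)
      then show ?thesis using power_eq_1_iff[of "norm (theta_char (D * p, y, r', x) (u t))" 12] by simp
    qed
    ultimately show ?thesis using D0 by (simp add: slash.simps t'_def j_def norm_mult norm_divide norm_power norm_power_int)
  qed
  have "exp_order (klein_prod N k v (of_int p / of_int G) (of_int y / real N)) X"
    unfolding X_def
  proof (rule exp_order_klein_prod)
    fix i assume i: "i \<in> {1..N div 2}"
    have "real N = of_int G * of_int D" using D by (metis of_int_mult of_int_of_nat_eq)
    \<comment> \<open>An integral combination of the two index coordinates equals 1/N, so i times
      the index cannot be integral in both coordinates for 0 < i < N.\<close>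
    then have "real i * (1 / real N) = real i * (of_int (x * (D * p) - y * r') / real N)" by (simp add: xy)
    also have "\<dots> = of_int x * (real i * (of_int p / of_int G)) - of_int r' * (real i * (of_int y / real N))"
      using \<open>real N = of_int G * of_int D\<close> G0 D0 by (simp add: field_simps)
    finally have "real i * (1 / real N) = of_int x * (real i * (of_int p / of_int G)) - of_int r' * (real i * (of_int y / real N))" .
    then show "real i * (of_int p / of_int G) \<notin> \<int> \<or> real i * (of_int y / real N) \<notin> \<int>"
      using of_nat_div_not_Ints[OF i N] by (metis Ints_diff Ints_mult Ints_of_int)
  qed
  then obtain c C where cC: "c > 0" "C > 0" "\<And>w. Im w \<ge> 1 \<Longrightarrow> 
      c * exp (- 2 * pi * X * Im w) \<le> norm (klein_prod N k v (of_int p / of_int G) (of_int y / real N) w) \<and>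
      norm (klein_prod N k v (of_int p / of_int G) (of_int y / real N) w) \<le> C * exp (- 2 * pi * X * Im w)"
    unfolding exp_order_def by blast
  let ?f = "slash k (prod_fun N (2 * k) v) (p, q, r, s)"
  have Dk: "real_of_int D ^ k > 0" using D0 by simp
  show ?thesis unfolding G_def[symmetric] X_def[symmetric]
  proof
    assume X: "X \<ge> 0"
    have "norm (?f t) \<le> C / of_int D ^ k" if "Im t \<ge> 1 / \<kappa>" for t
    proof -
      have "0 < 1 / \<kappa>" using \<kappa> by simp
      then have t: "Im t > 0" using that by linarith
      have u1: "Im (u t) \<ge> 1" using that \<kappa> by (simp add: Imu field_simps)
      have "norm (klein_prod N k v (of_int p / of_int G) (of_int y / real N) (u t)) \<le> C * exp (- 2 * pi * X * Im (u t))"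
        using cC(3)[OF u1] by blast
      also have "\<dots> \<le> C * 1" using cC(2) X u1 by (intro mult_left_mono) (auto intro!: mult_nonneg_nonneg)
      finally show ?thesis using Dk by (simp add: nrm[OF t] divide_right_mono)
    qed
    then show "\<exists>y>0. bounded (?f ` {\<tau>. Im \<tau> \<ge> y})"
      using \<kappa> by (intro exI[of _ "1 / \<kappa>"] conjI boundedI[of _ "C / of_int D ^ k"]) auto
  next
    assume "\<exists>y>0. bounded (?f ` {\<tau>. Im \<tau> \<ge> y})"
    then obtain y0 M where y0: "y0 > 0" "\<And>t. Im t \<ge> y0 \<Longrightarrow> norm (?f t) \<le> M"
      by (auto simp: bounded_iff)
    show "X \<ge> 0"
    proof (rule ccontr)
      assume "\<not> X \<ge> 0"
      define E where "E = - 2 * pi * X * \<kappa>"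
      have E: "E > 0" using \<open>\<not> X \<ge> 0\<close> \<kappa> by (auto simp: E_def mult_less_0_iff)
      have bd: "c / of_int D ^ k * exp (E * s) \<le> M" if s: "s \<ge> y0" "s \<ge> 1 / \<kappa>" for s
      proof -
        define t where "t = Complex 0 s"
        have t: "Im t > 0" using s y0 by (simp add: t_def)
        have u1: "Im (u t) \<ge> 1" using s \<kappa> by (simp add: Imu t_def field_simps)
        have "c * exp (E * s) \<le> norm (klein_prod N k v (of_int p / of_int G) (of_int y / real N) (u t))"
          using cC(3)[OF u1] by (simp add: E_def Imu t_def mult_ac)
        then have "c * exp (E * s) / of_int D ^ k \<le> norm (?f t)"
          using Dk by (simp add: nrm[OF t] divide_right_mono)
        also have "\<dots> \<le> M" using y0(2)[of t] s by (simp add: t_def)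
        finally show ?thesis by simp
      qed
      define c' where "c' = c / of_int D ^ k"
      have c': "c' > 0" using cC(1) Dk by (simp add: c'_def)
      define s where "s = Max {y0, 1 / \<kappa>, M / (c' * E)}"
      have s: "s \<ge> y0" "s \<ge> 1 / \<kappa>" "s \<ge> M / (c' * E)" by (auto simp: s_def)
      have "E * s < exp (E * s)" using exp_ge_add_one_self[of "E * s"] by linarith
      then have "c' * (E * s) < c' * exp (E * s)" using c' by simp
      also have "\<dots> \<le> M" using bd[OF s(1,2)] by (simp add: c'_def)
      finally have "c' * E * s < M" by (simp add: mult.assoc)
      moreover have "M \<le> c' * E * s" using s(3) c' E by (simp add: field_simps)
      ultimately show False by simp
    qed
  qed
qed

lemma L_iff:
  assumes N: "N \<ge> 2" and a: "a \<in> carrier_vec (N div 2)"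
  shows "a \<in> L N k \<longleftrightarrow> 12 dvd int k + coord_sum N a \<and> int (N * gcd 2 N) dvd coord_sum2 N a \<and>
    (\<forall>p r. coprime p r \<longrightarrow> cusp_order N k a (of_int p / of_int (gcd r (int N))) \<ge> 0)"
proof -
  have "(\<forall>\<gamma>\<in>SL2Z. \<exists>y>0. bounded (slash k (prod_fun N (2 * k) a) \<gamma> ` {\<tau>. Im \<tau> \<ge> y}))
     \<longleftrightarrow> (\<forall>p r. coprime p r \<longrightarrow> cusp_order N k a (of_int p / of_int (gcd r (int N))) \<ge> 0)"
    (is "?A \<longleftrightarrow> ?B")
  proof
    assume A: ?A
    show ?B
    proof (intro allI impI)
      fix p r :: int assume "coprime p r"
      then obtain s q where "s * p - q * r = 1"
        using coprime_bezout_diff by blast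
      then have g: "(p, q, r, s) \<in> SL2Z" by (simp add: SL2Z_def mult.commute)
      with A show "cusp_order N k a (of_int p / of_int (gcd r (int N))) \<ge> 0"
        using prod_fun_cusp_bounded_iff[OF N g] by blast
    qed
  next
    assume B: ?B
    show ?A
    proof
      fix \<gamma> assume \<gamma>: "\<gamma> \<in> SL2Z"
      obtain p q r s where pqrs: "\<gamma> = (p, q, r, s)" by (metis prod_cases4)
      have "p * s - q * r = 1" using \<gamma> by (simp add: pqrs SL2Z_def)
      then have "coprime p r" by (metis coprimeI dvd_diff dvd_mult dvd_mult2)
      then show "\<exists>y>0. bounded (slash k (prod_fun N (2 * k) a) \<gamma> ` {\<tau>. Im \<tau> \<ge> y})"
        using B prod_fun_cusp_bounded_iff[OF N \<gamma>[unfolded pqrs]] unfolding pqrs by blast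
    qed
  qed
  then show ?thesis
    using a prod_fun_Gamma1_invariant_iff[OF N, of k a] prod_fun_holomorphic[OF N, of k a]
    unfolding L_def modular_forms_Gamma1_def by simp
qed

section \<open>Cusps and Galois orbits\<close>

text \<open>Taking for \<open>q\<close> the product of the primes that divide x but not a, every
  prime divisor of x divides exactly one of a and q c.\<close>

lemma coprime_shift_exists:
  fixes a c x :: int
  assumes "coprime a c" "x \<noteq> 0"
  shows "\<exists>q. coprime (a + q * c) x"
proof -
  define A where "A = {p \<in> prime_factors x. \<not> p dvd a}"
  define q where "q = \<Prod>A"
  have fin: "finite A" by (simp add: A_def)
  have "coprime (a + q * c) x"
  proof (rule ccontr)
    assume "\<not> coprime (a + q * c) x"
    then have "\<not> is_unit (gcd (a + q * c) x)" by (metis is_unit_gcd)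
    moreover have "gcd (a + q * c) x \<noteq> 0" using assms(2) by simp
    ultimately obtain p where p: "prime p" "p dvd gcd (a + q * c) x"
      using prime_divisor_exists by blast
    then have pd: "p dvd a + q * c" "p dvd x" by auto
    then have px: "p \<in> prime_factors x" using p(1) assms(2) by (simp add: in_prime_factors_iff)
    show False
    proof (cases "p dvd a")
      case True
      then have "p dvd q * c" using pd(1) by (simp add: dvd_add_right_iff)
      moreover have "\<not> p dvd c" using True assms(1) p(1) by (meson coprime_common_divisor not_prime_unit)
      ultimately have "p dvd q" using p(1) by (simp add: prime_dvd_mult_iff)
      then obtain p' where p': "p' \<in> A" "p dvd p'"
        unfolding q_def using prime_dvd_prod_iff[OF fin p(1), of "\<lambda>x. x"] by auto
      then have "p = p'" using p(1) by (auto simp: A_def in_prime_factors_iff intro: primes_dvd_imp_eq)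
      then show False using p' True by (simp add: A_def)
    next
      case False
      then have "p \<in> A" using px by (simp add: A_def)
      then have "p dvd q" unfolding q_def using fin by (rule dvd_prodI[rotated])
      then show False using False pd(1) by (simp add: dvd_add_left_iff)
    qed
  qed
  then show ?thesis by blast
qed

text \<open>The classical criterion for equivalence of cusps: c modulo N and a modulo gcd(c, N), up
  to a common sign. It makes sense for pairs that are not coprime, so the Galois action can be
  written as c -> x c with no change of representative.\<close>

definition cusp_rel :: "nat \<Rightarrow> int \<Rightarrow> int \<Rightarrow> int \<Rightarrow> int \<Rightarrow> bool" where
  "cusp_rel N a c a' c' \<longleftrightarrow>
     (\<exists>e\<in>{1, -1}. [c' = e * c] (mod int N) \<and> [a' = e * a] (mod gcd c (int N)))"

definition cusp_class :: "nat \<Rightarrow> int \<Rightarrow> int \<Rightarrow> (int \<times> int) set" where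
  "cusp_class N a c = {(a', c'). coprime a' c' \<and> cusp_rel N a c a' c'}"

lemma cusp_rel_gcd:
  assumes "cusp_rel N a c a' c'"
  shows "gcd c' (int N) = gcd c (int N)"
proof -
  obtain e where e: "e \<in> {1, -1}" "[c' = e * c] (mod int N)" using assms unfolding cusp_rel_def by blast
  from cong_gcd_eq[OF e(2)] have "gcd c' (int N) = gcd (e * c) (int N)" by simp
  then show ?thesis using e(1) by auto
qed

lemma cusp_rel_sym:
  assumes "cusp_rel N a c a' c'"
  shows "cusp_rel N a' c' a c"
proof -
  obtain e where e: "e \<in> {1, -1}" "[c' = e * c] (mod int N)" "[a' = e * a] (mod gcd c (int N))"
    using assms unfolding cusp_rel_def by blast
  have "e * e = 1" using e(1) by auto
  then have "[e * c' = c] (mod int N)" "[e * a' = a] (mod gcd c (int N))"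
    using cong_scalar_left[OF e(2), of e] cong_scalar_left[OF e(3), of e] by (simp_all flip: mult.assoc)
  then show ?thesis unfolding cusp_rel_def cusp_rel_gcd[OF assms] using e(1) cong_sym by blast
qed

lemma cusp_rel_trans:
  assumes "cusp_rel N a c a' c'" "cusp_rel N a' c' a'' c''"
  shows "cusp_rel N a c a'' c''"
proof -
  obtain e where e: "e \<in> {1, -1}" "[c' = e * c] (mod int N)" "[a' = e * a] (mod gcd c (int N))"
    using assms(1) unfolding cusp_rel_def by blast
  obtain f where f: "f \<in> {1, -1}" "[c'' = f * c'] (mod int N)" "[a'' = f * a'] (mod gcd c (int N))"
    using assms(2) unfolding cusp_rel_def cusp_rel_gcd[OF assms(1)] by blast
  have "[c'' = f * (e * c)] (mod int N)" using f(2) cong_scalar_left[OF e(2)] cong_trans by blast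
  moreover have "[a'' = f * (e * a)] (mod gcd c (int N))" using f(3) cong_scalar_left[OF e(3)] cong_trans by blast
  moreover have "f * e \<in> {1, -1}" using e(1) f(1) by auto
  ultimately show ?thesis unfolding cusp_rel_def by (metis mult.assoc)
qed

lemma cusp_class_eqI:
  assumes "cusp_rel N a c a' c'"
  shows "cusp_class N a' c' = cusp_class N a c"
  using assms cusp_rel_trans cusp_rel_sym unfolding cusp_class_def by blast

text \<open>For the harder inclusion, a translation first makes the numerators congruent modulo N.
  Two coprime columns congruent modulo N are then completed to matrices of determinant 1 whose
  second columns are congruent as well; the quotient of these matrices is congruent to the
  identity.\<close>

lemma cusp_eq_cusp_class:
  assumes N: "N > 0" and ac: "coprime a c"
  shows "cusp N (a, c) = cusp_class N a c"
proof (intro equalityI subsetI)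
  fix z assume "z \<in> cusp N (a, c)"
  then obtain e p q r s where z: "z = (e * (p * a + q * c), e * (r * a + s * c))" and e: "e \<in> {1, -1}"
    and g: "(p, q, r, s) \<in> Gamma1 N" unfolding cusp_def fst_conv snd_conv by blast
  have det: "p * s - q * r = 1" and cg: "int N dvd p - 1" "int N dvd s - 1" "int N dvd r"
    using g by (auto simp: Gamma1_def SL2Z_def cong_iff_dvd_diff)
  have "coprime (p * a + q * c) (r * a + s * c)"
  proof (rule coprimeI)
    fix x assume x: "x dvd p * a + q * c" "x dvd r * a + s * c"
    then have "x dvd s * (p * a + q * c) - q * (r * a + s * c)" "x dvd p * (r * a + s * c) - r * (p * a + q * c)"
      by (meson dvd_diff dvd_mult)+
    moreover have "s * (p * a + q * c) - q * (r * a + s * c) = (p * s - q * r) * a"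
      "p * (r * a + s * c) - r * (p * a + q * c) = (p * s - q * r) * c" by (simp_all add: algebra_simps)
    ultimately have "x dvd a" "x dvd c" by (simp_all add: det)
    then show "is_unit x" using ac by (meson coprime_common_divisor)
  qed
  then have cop: "coprime (e * (p * a + q * c)) (e * (r * a + s * c))" using e by auto
  have "int N dvd r * a + (s - 1) * c" using cg by (intro dvd_add) auto
  then have "[r * a + s * c = c] (mod int N)" by (simp add: cong_iff_dvd_diff algebra_simps)
  then have 1: "[e * (r * a + s * c) = e * c] (mod int N)" by (rule cong_scalar_left)
  have "gcd c (int N) dvd (p - 1) * a + q * c" using cg by (intro dvd_add) (auto intro: dvd_trans[OF gcd_dvd2] dvd_mult2)
  then have "[p * a + q * c = a] (mod gcd c (int N))" by (simp add: cong_iff_dvd_diff algebra_simps)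
  then have 2: "[e * (p * a + q * c) = e * a] (mod gcd c (int N))" by (rule cong_scalar_left)
  show "z \<in> cusp_class N a c" unfolding z cusp_class_def cusp_rel_def using cop 1 2 e by auto
next
  fix z assume "z \<in> cusp_class N a c"
  then obtain a' c' e where z: "z = (a', c')" "coprime a' c'" and e: "e \<in> {1, -1}" "[c' = e * c] (mod int N)"
    "[a' = e * a] (mod gcd c (int N))" unfolding cusp_class_def cusp_rel_def by blast
  have ee: "e * e = 1" using e(1) by auto
  define a1 where "a1 = e * a'"
  define c1 where "c1 = e * c'"
  have z1: "z = (e * a1, e * c1)" using ee by (simp add: z a1_def c1_def flip: mult.assoc)
  have cop1: "coprime a1 c1" using z(2) e(1) by (auto simp: a1_def c1_def)
  have cc: "[c1 = c] (mod int N)" "[a1 = a] (mod gcd c (int N))"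
    using cong_scalar_left[OF e(2), of e] cong_scalar_left[OF e(3), of e] ee
    by (simp_all add: a1_def c1_def flip: mult.assoc)
  obtain \<beta> where \<beta>: "c1 = c + int N * \<beta>" using cc(1)
    by (metis cong_iff_dvd_diff dvdE add.commute diff_add_cancel)
  obtain w where w: "a1 = a + gcd c (int N) * w" using cc(2)
    by (metis cong_iff_dvd_diff dvdE add.commute diff_add_cancel)
  obtain u v where uv: "u * c + v * int N = gcd c (int N)" using bezout_int by blast
  \<comment> \<open>Bezout splits the discrepancy gcd(c, N) w into a multiple of c, absorbed by a
    translation, and a multiple of N.\<close>
  define q0 where "q0 = w * u"
  define a2 where "a2 = a + q0 * c"
  define \<alpha> where "\<alpha> = v * w"
  have \<alpha>: "a1 = a2 + int N * \<alpha>" unfolding w uv[symmetric] a2_def q0_def \<alpha>_def by (simp add: algebra_simps)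
  have "coprime a2 c"
  proof (rule coprimeI)
    fix x assume x: "x dvd a2" "x dvd c"
    then have "x dvd a" by (simp add: a2_def dvd_add_left_iff)
    then show "is_unit x" using x(2) ac by (meson coprime_common_divisor)
  qed
  then obtain d b where e1: "d * a2 - b * c = 1" using coprime_bezout_diff by blast
  obtain d1 b1 where e2: "d1 * a1 - b1 * c1 = 1" using coprime_bezout_diff[OF cop1] by blast
  \<comment> \<open>Completions of one column differ by multiples of that column; this multiple
    makes the new second column congruent to (b, d) modulo N.\<close>
  define n where "n = b * d1 - d * b1"
  define b' where "b' = b1 + n * a1"
  define d' where "d' = d1 + n * c1"
  define p where "p = a1 * d - b' * c"
  define q where "q = b' * a2 - a1 * b"
  define r where "r = c1 * d - d' * c"
  define s where "s = d' * a2 - c1 * b"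
  have e2': "d' * a1 - b' * c1 = 1" using e2 by (simp add: d'_def b'_def algebra_simps)
  have det: "p * s - q * r = 1"
  proof -
    have "p * s - q * r = (d' * a1 - b' * c1) * (d * a2 - b * c)"
      by (simp add: p_def q_def r_def s_def algebra_simps)
    then show ?thesis by (simp add: e1 e2')
  qed
  have p1: "p - 1 = int N * (\<alpha> * d + \<alpha> * d * b1 * c - b * b1 * c * \<beta>)"
  proof -
    have A: "d * a1 = 1 + b * c + int N * \<alpha> * d" using e1 unfolding \<alpha> by (simp add: algebra_simps)
    have B: "d1 * a1 = 1 + b1 * c1" using e2 by simp
    have "p - 1 = d * a1 - b1 * c - b * c * (d1 * a1) + b1 * c * (d * a1) - 1"
      by (simp add: p_def b'_def n_def algebra_simps)
    also have "\<dots> = int N * (\<alpha> * d + \<alpha> * d * b1 * c - b * b1 * c * \<beta>)"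
      unfolding A B \<beta> by (simp add: algebra_simps)
    finally show ?thesis .
  qed
  have r0: "r = int N * (\<beta> * d - c * b * d1 * \<beta> + c * \<alpha> * d * d1)"
  proof -
    have A: "d * a1 = 1 + b * c + int N * \<alpha> * d" using e1 unfolding \<alpha> by (simp add: algebra_simps)
    have B: "b1 * c1 = d1 * a1 - 1" using e2 by simp
    have "r = c1 * d - d1 * c - b * c * d1 * c1 + d * c * (b1 * c1)"
      by (simp add: r_def d'_def n_def algebra_simps)
    also have "\<dots> = c1 * d - d1 * c - b * c * d1 * c1 + c * d1 * (d * a1) - d * c"
      unfolding B by (simp add: algebra_simps)
    also have "\<dots> = int N * (\<beta> * d - c * b * d1 * \<beta> + c * \<alpha> * d * d1)"
      unfolding A \<beta> by (simp add: algebra_simps)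
    finally show ?thesis .
  qed
  have s1: "s - 1 = q * r - (p - 1) * s" using det by (simp add: algebra_simps)
  have Np: "int N dvd p - 1" and Nr: "int N dvd r" by (simp_all add: p1 r0)
  then have Ns: "int N dvd s - 1" unfolding s1 by (intro dvd_diff) auto
  have "(p, p * q0 + q, r, r * q0 + s) \<in> Gamma1 N"
  proof -
    have "p * (r * q0 + s) - (p * q0 + q) * r = p * s - q * r" by (simp add: algebra_simps)
    moreover have "int N dvd r * q0 + (s - 1)" using Nr Ns by (intro dvd_add) auto
    then have "int N dvd r * q0 + s - 1" by (simp add: algebra_simps)
    ultimately show ?thesis using Np Nr det by (simp add: Gamma1_def SL2Z_def cong_iff_dvd_diff)
  qed
  moreover have "p * a + (p * q0 + q) * c = a1" "r * a + (r * q0 + s) * c = c1"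
  proof -
    have "p * a + (p * q0 + q) * c = p * a2 + q * c" by (simp add: a2_def algebra_simps)
    also have "\<dots> = a1 * (d * a2 - b * c)" by (simp add: p_def q_def algebra_simps)
    finally show "p * a + (p * q0 + q) * c = a1" by (simp add: e1)
    have "r * a + (r * q0 + s) * c = r * a2 + s * c" by (simp add: a2_def algebra_simps)
    also have "\<dots> = c1 * (d * a2 - b * c)" by (simp add: r_def s_def algebra_simps)
    finally show "r * a + (r * q0 + s) * c = c1" by (simp add: e1)
  qed
  ultimately show "z \<in> cusp N (a, c)" unfolding cusp_def z1 using e(1) by force
qed

section \<open>The Galois action and its orbits\<close>

lemma cusp_rel_mult_unit:
  assumes x: "coprime x (int N)" and r: "cusp_rel N a c a' c'"
  shows "cusp_rel N a (x * c) a' (x * c')"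
proof -
  obtain e where e: "e \<in> {1, -1}" "[c' = e * c] (mod int N)" "[a' = e * a] (mod gcd c (int N))"
    using r unfolding cusp_rel_def by blast
  have "gcd (x * c) (int N) = gcd c (int N)" using x by (simp add: gcd_mult_left_left_cancel coprime_commute)
  then show ?thesis unfolding cusp_rel_def using e cong_scalar_left[OF e(2), of x]
    by (metis mult.left_commute)
qed

text \<open>The description in \<open>galois\<close> is satisfiable because a may be moved by
  multiples of c inside the cusp until it is coprime to x, and unique because multiplying c by a
  unit respects \<open>cusp_rel\<close>. The right side uses \<open>cusp_class\<close> since a and x
  c themselves may share a factor.\<close>

lemma galois_cusp:
  assumes N: "N \<ge> 2" and ac: "coprime a c" and x: "coprime x (int N)"
  shows "galois N x (cusp N (a, c)) = cusp_class N a (x * c)"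
proof -
  have N0: "N > 0" using N by simp
  have uniq: "D = cusp_class N a (x * c)"
    if "(a1, c1) \<in> cusp N (a, c)" "coprime a1 (x * c1)" "D = cusp N (a1, x * c1)" for D a1 c1
  proof -
    have "D = cusp_class N a1 (x * c1)" using that(2,3) cusp_eq_cusp_class[OF N0] by simp
    moreover have "cusp_rel N a c a1 c1"
      using that(1) unfolding cusp_eq_cusp_class[OF N0 ac] by (simp add: cusp_class_def)
    ultimately show ?thesis using cusp_class_eqI[OF cusp_rel_mult_unit[OF x]] by simp
  qed
  have "x \<noteq> 0" using x N by auto
  then obtain q where q: "coprime (a + q * c) x" using coprime_shift_exists[OF ac] by blast
  have "coprime (a + q * c) c"
    using ac by (metis coprime_iff_gcd_eq_1 gcd.commute gcd_add_mult mult.commute add.commute)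
  then have cop: "coprime (a + q * c) (x * c)" using q by simp
  have "(1, q, 0, 1) \<in> Gamma1 N" by (simp add: Gamma1_def SL2Z_def)
  then have "(a + q * c, c) \<in> cusp N (a, c)" unfolding cusp_def by force
  with cop uniq have ex: "\<exists>a1 c1. (a1, c1) \<in> cusp N (a, c) \<and> coprime a1 (x * c1) \<and> cusp_class N a (x * c) = cusp N (a1, x * c1)"
    by metis
  show ?thesis unfolding galois_def
    by (rule the_equality) (use ex uniq in blast)+
qed

lemma galois_orbit_cusp:
  assumes "N \<ge> 2" "coprime a c"
  shows "galois_orbit N (cusp N (a, c)) = {cusp_class N a (x * c) | x. coprime x (int N)}"
  unfolding galois_orbit_def using galois_cusp[OF assms] by auto

text \<open>Applied in both directions, it shows that orbits with a common point are equal; an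
  inverse of y modulo N transports the relation.\<close>

lemma galois_orbit_subset:
  assumes N: "N \<ge> 2" and ac: "coprime a c" and ac': "coprime a' c'"
    and x: "coprime x (int N)" and y: "coprime y (int N)"
    and r: "cusp_rel N a (x * c) a' (y * c')"
  shows "galois_orbit N (cusp N (a', c')) \<subseteq> galois_orbit N (cusp N (a, c))"
proof
  fix D assume "D \<in> galois_orbit N (cusp N (a', c'))"
  then obtain z where z: "coprime z (int N)" "D = cusp_class N a' (z * c')"
    unfolding galois_orbit_cusp[OF N ac'] by blast
  obtain y' where y': "[y * y' = 1] (mod int N)" using cong_solve_coprime_int[OF y] by blast
  have y'N: "coprime y' (int N)"
    using y' by (metis cong_imp_coprime cong_sym coprime_1_left coprime_mult_left_iff)
  have "cusp_rel N a (z * y' * (x * c)) a' (z * y' * (y * c'))"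
    using r z(1) y'N by (intro cusp_rel_mult_unit) auto
  moreover have "cusp_rel N a' (z * y' * (y * c')) a' (z * c')"
  proof -
    have "[z * c' * (y * y') = z * c' * 1] (mod int N)" by (rule cong_scalar_left[OF y'])
    then have "[z * c' = z * y' * (y * c')] (mod int N)" by (simp add: mult_ac cong_sym)
    then show ?thesis unfolding cusp_rel_def by (intro bexI[of _ 1]) auto
  qed
  ultimately have "cusp_rel N a (z * y' * (x * c)) a' (z * c')" by (rule cusp_rel_trans)
  then have "D = cusp_class N a (z * y' * (x * c))" using z(2) cusp_class_eqI by simp
  moreover have "coprime (z * y' * x) (int N)" using z(1) y'N x by simp
  ultimately show "D \<in> galois_orbit N (cusp N (a, c))"
    unfolding galois_orbit_cusp[OF N ac] by (auto simp: mult.assoc intro!: exI[of _ "z * y' * x"])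
qed

section \<open>Counting cusps by residues\<close>

text \<open>
  The pairs \<open>(c, a)\<close> with \<open>c\<close> modulo \<open>N\<close> and \<open>a\<close> modulo \<open>gcd(c, N)\<close>; for \<open>N \<ge> 5\<close> each cusp
  corresponds to exactly two of them, which differ by sign.
\<close>

definition cusp_keys :: "nat \<Rightarrow> (int \<times> int) set" where
  "cusp_keys N = {(c, \<alpha>). c \<in> {0..<int N} \<and> \<alpha> \<in> {0..<gcd c (int N)} \<and> coprime \<alpha> (gcd c (int N))}"

lemma finite_cusp_keys: "finite (cusp_keys N)"
proof (rule finite_subset)
  show "cusp_keys N \<subseteq> {0..<int N} \<times> {0..<int N}"
  proof (clarsimp simp: cusp_keys_def)
    fix c \<alpha> assume *: "0 \<le> c" "c < int N" "\<alpha> < gcd c (int N)"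
    then have "gcd c (int N) \<le> int N" by (intro gcd_le2_int) auto
    then show "\<alpha> < int N" using * by linarith
  qed
qed auto

lemma cusp_key_rep:
  assumes N: "N > 0" and k: "coprime \<alpha> (gcd c (int N))"
  shows "\<exists>a' c'. coprime a' c' \<and> cusp_rel N \<alpha> c a' c'"
proof -
  \<comment> \<open>The residue 0 is represented by N, because the shift argument asks for a
    non-zero modulus.\<close>
  define c' where "c' = (if c = 0 then int N else c)"
  have c': "c' \<noteq> 0" "[c' = c] (mod int N)" "gcd c' (int N) = gcd c (int N)" using N by (auto simp: c'_def cong_def)
  obtain t where t: "coprime (\<alpha> + t * gcd c (int N)) c'" using coprime_shift_exists[OF k c'(1)] by blast
  have "cusp_rel N \<alpha> c (\<alpha> + t * gcd c (int N)) c'"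
    unfolding cusp_rel_def using c' by (intro bexI[of _ 1]) (auto simp: cong_iff_dvd_diff)
  with t show ?thesis by blast
qed

lemma cusp_class_eqD:
  assumes "N > 0" "coprime \<alpha> (gcd c (int N))" "cusp_class N \<alpha> c = cusp_class N \<alpha>' c'"
  shows "cusp_rel N \<alpha> c \<alpha>' c'"
proof -
  obtain a1 c1 where 1: "coprime a1 c1" "cusp_rel N \<alpha> c a1 c1" using cusp_key_rep[OF assms(1,2)] by blast
  then have "(a1, c1) \<in> cusp_class N \<alpha>' c'" using assms(3) by (auto simp: cusp_class_def)
  then have "cusp_rel N \<alpha>' c' a1 c1" by (simp add: cusp_class_def)
  then show ?thesis using 1(2) cusp_rel_trans cusp_rel_sym by blast
qed

lemma coprime_gcd_right_int: "coprime a c \<Longrightarrow> coprime a (gcd c (n::int))"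
  by (meson coprime_divisors dvd_refl gcd_dvd1)

text \<open>If (c, \<alpha>) agreed with its negative, then N | 2 c and G | 2 \<alpha> with G =
  gcd(c, N); as \<alpha> is a unit modulo G, this gives G | 2, then N | 2 G | 4, against N >=
  5.\<close>

lemma cusp_keys_fiber:
  assumes N: "N \<ge> 5" and k: "(c, \<alpha>) \<in> cusp_keys N"
  shows "card {(c', \<alpha>') \<in> cusp_keys N. cusp_class N \<alpha>' c' = cusp_class N \<alpha> c} = 2"
proof -
  define G where "G = gcd c (int N)"
  define c2 where "c2 = (- c) mod int N"
  define \<alpha>2 where "\<alpha>2 = (- \<alpha>) mod G"
  have N0: "N > 0" using N by simp
  have k': "0 \<le> c" "c < int N" "0 \<le> \<alpha>" "\<alpha> < G" "coprime \<alpha> G" using k by (auto simp: cusp_keys_def G_def)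
  have G0: "G > 0" using k' by linarith
  have r2: "cusp_rel N \<alpha> c \<alpha>2 c2"
    unfolding cusp_rel_def G_def[symmetric] by (intro bexI[of _ "-1"]) (auto simp: c2_def \<alpha>2_def cong_def)
  have G2: "gcd c2 (int N) = G" using cusp_rel_gcd[OF r2] by (simp add: G_def)
  have k2: "(c2, \<alpha>2) \<in> cusp_keys N"
    unfolding cusp_keys_def using N0 G0 k'(5) G2 by (simp add: c2_def \<alpha>2_def coprime_mod_left_iff)
  have ne: "(c, \<alpha>) \<noteq> (c2, \<alpha>2)"
  proof
    assume "(c, \<alpha>) = (c2, \<alpha>2)"
    then have "c = (- c) mod int N" "\<alpha> = (- \<alpha>) mod G" by (auto simp: c2_def \<alpha>2_def)
    then have "[c = - c] (mod int N)" "[\<alpha> = - \<alpha>] (mod G)" by (metis cong_mod_right cong_refl)+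
    then have "int N dvd c - - c" "G dvd \<alpha> - - \<alpha>" by (simp_all only: cong_iff_dvd_diff)
    then have d: "int N dvd 2 * c" "G dvd 2 * \<alpha>" by (metis diff_minus_eq_add mult_2)+
    have "G dvd 2" using d(2) k'(5) by (metis coprime_commute coprime_dvd_mult_left_iff)
    have "int N dvd gcd (2 * c) (2 * int N)" using d(1) by simp
    also have "gcd (2 * c) (2 * int N) = 2 * G" using gcd_mult_distrib_int[of 2 c "int N"] by (simp add: G_def)
    also have "2 * G dvd 2 * 2" using \<open>G dvd 2\<close> by (intro mult_dvd_mono) auto
    finally have "int N \<le> 4" by (intro zdvd_imp_le) auto
    then show False using N by simp
  qed
  have "{(c', \<alpha>') \<in> cusp_keys N. cusp_class N \<alpha>' c' = cusp_class N \<alpha> c} = {(c, \<alpha>), (c2, \<alpha>2)}"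
  proof (intro equalityI subsetI)
    fix z assume "z \<in> {(c', \<alpha>') \<in> cusp_keys N. cusp_class N \<alpha>' c' = cusp_class N \<alpha> c}"
    then obtain c' \<alpha>' where z: "z = (c', \<alpha>')" "(c', \<alpha>') \<in> cusp_keys N" "cusp_class N \<alpha>' c' = cusp_class N \<alpha> c" by auto
    have r: "cusp_rel N \<alpha> c \<alpha>' c'" using k'(5) z(3) N0 by (intro cusp_class_eqD) (auto simp: G_def)
    then have "gcd c' (int N) = G" using cusp_rel_gcd G_def by metis
    then have b: "0 \<le> c'" "c' < int N" "0 \<le> \<alpha>'" "\<alpha>' < G" using z(2) by (auto simp: cusp_keys_def)
    obtain e where e: "e \<in> {1, -1}" "[c' = e * c] (mod int N)" "[\<alpha>' = e * \<alpha>] (mod G)"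
      using r unfolding cusp_rel_def G_def by blast
    then have "c' = (e * c) mod int N" "\<alpha>' = (e * \<alpha>) mod G" using b by (simp_all add: cong_def)
    then show "z \<in> {(c, \<alpha>), (c2, \<alpha>2)}" using e(1) k' by (auto simp: z(1) c2_def \<alpha>2_def)
  next
    fix z assume "z \<in> {(c, \<alpha>), (c2, \<alpha>2)}"
    then show "z \<in> {(c', \<alpha>') \<in> cusp_keys N. cusp_class N \<alpha>' c' = cusp_class N \<alpha> c}"
      using k k2 cusp_class_eqI[OF r2] by auto
  qed
  then show ?thesis using ne by simp
qed

lemma cusp_reps_coprime:
  assumes "cusp_orbit_reps N cs" "i \<le> N div 2"
  shows "coprime (fst (cs i)) (snd (cs i))"
  using assms by (simp add: cusp_orbit_reps_def)

lemma galois_orbit_rep: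
  assumes N: "N \<ge> 5" and cs: "cusp_orbit_reps N cs" and pr: "coprime p r"
  shows "\<exists>i\<le>N div 2. galois_orbit N (cusp N (p, r)) = galois_orbit N (cusp N (cs i))"
proof -
  have "galois_orbit N (cusp N (p, r)) \<in> galois_orbit N ` cusps N"
    using pr unfolding cusps_def by blast
  also have "\<dots> = (\<lambda>i. galois_orbit N (cusp N (cs i))) ` {..N div 2}"
    using cs unfolding cusp_orbit_reps_def bij_betw_def by simp
  finally show ?thesis by auto
qed

lemma galois_orbit_cs:
  assumes "N \<ge> 5" "cusp_orbit_reps N cs" "i \<le> N div 2"
  shows "galois_orbit N (cusp N (cs i)) = {cusp_class N (fst (cs i)) (x * snd (cs i)) | x. coprime x (int N)}"
  using galois_orbit_cusp[OF _ cusp_reps_coprime[OF assms(2,3)], of N] assms(1) by simp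

lemma cusp_rep_exists:
  assumes N: "N \<ge> 5" and cs: "cusp_orbit_reps N cs" and pr: "coprime p r"
  shows "\<exists>i\<le>N div 2. cusp_gcd N (cs i) = gcd r (int N) \<and>
    (\<exists>e\<in>{1,-1}. [p = e * fst (cs i)] (mod gcd r (int N)))"
proof -
  obtain i where i: "i \<le> N div 2" "galois_orbit N (cusp N (p, r)) = galois_orbit N (cusp N (cs i))"
    using galois_orbit_rep[OF assms] by blast
  have "cusp_class N p (1 * r) \<in> galois_orbit N (cusp N (p, r))"
    using N by (subst galois_orbit_cusp[OF _ pr]) (auto intro!: exI[of _ 1])
  then obtain x where x: "coprime x (int N)" "cusp_class N p r = cusp_class N (fst (cs i)) (x * snd (cs i))"
    unfolding i(2) galois_orbit_cs[OF N cs i(1)] by auto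
  have "cusp_rel N p r (fst (cs i)) (x * snd (cs i))"
    using N x(2) pr by (intro cusp_class_eqD coprime_gcd_right_int) auto
  then have rel: "cusp_rel N (fst (cs i)) (x * snd (cs i)) p r" by (rule cusp_rel_sym)
  have "gcd (x * snd (cs i)) (int N) = gcd (snd (cs i)) (int N)"
    using x(1) by (simp add: gcd_mult_left_left_cancel coprime_commute)
  with cusp_rel_gcd[OF rel] rel i(1) show ?thesis
    unfolding cusp_rel_def cusp_gcd_def by auto
qed

lemma cusp_key_of_class:
  assumes N: "N > 0" and c: "coprime a (gcd c (int N))"
  shows "(c mod int N, a mod gcd c (int N)) \<in> cusp_keys N"
    "cusp_class N (a mod gcd c (int N)) (c mod int N) = cusp_class N a c"
proof -
  have g: "gcd c (int N) > 0" using N by (simp add: gcd_pos_int)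
  have "gcd (c mod int N) (int N) = gcd c (int N)" by (metis gcd_red_int gcd.commute)
  then show "(c mod int N, a mod gcd c (int N)) \<in> cusp_keys N"
    using N g c by (simp add: cusp_keys_def coprime_mod_left_iff)
  show "cusp_class N (a mod gcd c (int N)) (c mod int N) = cusp_class N a c"
    by (rule cusp_class_eqI) (auto simp: cusp_rel_def intro!: bexI[of _ 1])
qed

lemma finite_galois_orbit_cs:
  assumes N: "N \<ge> 5" and cs: "cusp_orbit_reps N cs" and i: "i \<le> N div 2"
  shows "finite (galois_orbit N (cusp N (cs i)))"
proof (rule finite_subset)
  show "galois_orbit N (cusp N (cs i)) \<subseteq> (\<lambda>(c, a). cusp_class N a c) ` cusp_keys N"
  proof
    fix D assume "D \<in> galois_orbit N (cusp N (cs i))"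
    then obtain x where x: "coprime x (int N)" "D = cusp_class N (fst (cs i)) (x * snd (cs i))"
      unfolding galois_orbit_cs[OF assms] by blast
    have "gcd (x * snd (cs i)) (int N) = gcd (snd (cs i)) (int N)"
      using x(1) by (simp add: gcd_mult_left_left_cancel coprime_commute)
    then have "coprime (fst (cs i)) (gcd (x * snd (cs i)) (int N))"
      using coprime_gcd_right_int[OF cusp_reps_coprime[OF cs i]] by simp
    moreover have "N > 0" using N by simp
    ultimately have key: "(x * snd (cs i) mod int N, fst (cs i) mod gcd (x * snd (cs i)) (int N)) \<in> cusp_keys N"
      "cusp_class N (fst (cs i) mod gcd (x * snd (cs i)) (int N)) (x * snd (cs i) mod int N) = D"
      using cusp_key_of_class x(2) by auto
    show "D \<in> (\<lambda>(c, a). cusp_class N a c) ` cusp_keys N"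
      using imageI[OF key(1), of "\<lambda>(c, a). cusp_class N a c"] by (simp add: key(2))
  qed
qed (simp add: finite_cusp_keys)

lemma orbit_size_pos:
  assumes "N \<ge> 5" "cusp_orbit_reps N cs" "i \<le> N div 2"
  shows "orbit_size N cs i > 0"
proof -
  have "cusp_class N (fst (cs i)) (1 * snd (cs i)) \<in> galois_orbit N (cusp N (cs i))"
    unfolding galois_orbit_cs[OF assms] using coprime_1_left by blast
  then show ?thesis unfolding orbit_size_def using finite_galois_orbit_cs[OF assms]
    by (metis card_gt_0_iff empty_iff)
qed

text \<open>Each cusp of the i-th orbit owns two keys, and F is constant on all keys of the orbit
  because it is even and periodic. The orbits are known only through arbitrary representatives,
  whereas the sum over keys can be evaluated by grouping according to the gcd.\<close>

lemma sum_over_cusps: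
  fixes F :: "int \<Rightarrow> int \<Rightarrow> real"
  assumes N: "N \<ge> 5" and cs: "cusp_orbit_reps N cs"
    and F: "\<And>g a a' e. e \<in> {1, -1} \<Longrightarrow> [a' = e * a] (mod g) \<Longrightarrow> F g a' = F g a"
  shows "(\<Sum>(c, \<alpha>)\<in>cusp_keys N. F (gcd c (int N)) \<alpha>)
    = 2 * (\<Sum>i\<le>N div 2. real (orbit_size N cs i) * F (cusp_gcd N (cs i)) (fst (cs i)))"
proof -
  have N0: "N > 0" and N2: "N \<ge> 2" using N by auto
  define Ob where "Ob = (\<lambda>i. galois_orbit N (cusp N (cs i)))"
  define K where "K = (\<lambda>i. {(c, \<alpha>) \<in> cusp_keys N. cusp_class N \<alpha> c \<in> Ob i})"
  have finK: "finite (K i)" for i unfolding K_def by (rule finite_subset[OF _ finite_cusp_keys]) auto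
  have ObI: "D \<in> Ob i \<longleftrightarrow> (\<exists>x. coprime x (int N) \<and> D = cusp_class N (fst (cs i)) (x * snd (cs i)))"
    if "i \<le> N div 2" for D i unfolding Ob_def galois_orbit_cs[OF N cs that] by blast
  have cover: "cusp_keys N = (\<Union>i\<le>N div 2. K i)"
  proof (intro equalityI subsetI)
    fix z assume z: "z \<in> cusp_keys N"
    obtain c \<alpha> where ca: "z = (c, \<alpha>)" by force
    have "coprime \<alpha> (gcd c (int N))" using z by (simp add: ca cusp_keys_def)
    then obtain a1 c1 where 1: "coprime a1 c1" "cusp_rel N \<alpha> c a1 c1" using cusp_key_rep[OF N0] by blast
    obtain i where i: "i \<le> N div 2" "galois_orbit N (cusp N (a1, c1)) = Ob i"
      using galois_orbit_rep[OF N cs 1(1)] unfolding Ob_def by blast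
    have "cusp_class N a1 (1 * c1) \<in> Ob i"
      unfolding i(2)[symmetric] galois_orbit_cusp[OF N2 1(1)] using coprime_1_left by blast
    then have "z \<in> K i" using z cusp_class_eqI[OF 1(2)] by (simp add: K_def ca)
    then show "z \<in> (\<Union>i\<le>N div 2. K i)" using i(1) by blast
  qed (auto simp: K_def)
  have disj: "i = j" if ij: "i \<le> N div 2" "j \<le> N div 2" "z \<in> K i" "z \<in> K j" for i j z
  proof -
    obtain c \<alpha> where ca: "z = (c, \<alpha>)" by force
    have cop: "coprime \<alpha> (gcd c (int N))" using ij by (simp add: ca K_def cusp_keys_def)
    obtain x where x: "coprime x (int N)" "cusp_class N \<alpha> c = cusp_class N (fst (cs i)) (x * snd (cs i))"
      using ij(1,3) ObI by (auto simp: K_def ca)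
    obtain y where y: "coprime y (int N)" "cusp_class N \<alpha> c = cusp_class N (fst (cs j)) (y * snd (cs j))"
      using ij(2,4) ObI by (auto simp: K_def ca)
    have ri: "cusp_rel N \<alpha> c (fst (cs i)) (x * snd (cs i))" by (rule cusp_class_eqD[OF N0 cop x(2)])
    have rj: "cusp_rel N \<alpha> c (fst (cs j)) (y * snd (cs j))" by (rule cusp_class_eqD[OF N0 cop y(2)])
    have rij: "cusp_rel N (fst (cs i)) (x * snd (cs i)) (fst (cs j)) (y * snd (cs j))"
      using ri rj cusp_rel_sym cusp_rel_trans by blast
    have "Ob j \<subseteq> Ob i" unfolding Ob_def
      using galois_orbit_subset[OF N2 cusp_reps_coprime[OF cs ij(1)] cusp_reps_coprime[OF cs ij(2)] x(1) y(1) rij] by simp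
    moreover have "Ob i \<subseteq> Ob j" unfolding Ob_def
      using galois_orbit_subset[OF N2 cusp_reps_coprime[OF cs ij(2)] cusp_reps_coprime[OF cs ij(1)] y(1) x(1) cusp_rel_sym[OF rij]] by simp
    ultimately have "Ob i = Ob j" by blast
    moreover have "inj_on Ob {..N div 2}" using cs unfolding cusp_orbit_reps_def bij_betw_def Ob_def by simp
    ultimately show "i = j" using ij(1,2) by (auto dest: inj_onD)
  qed
  have cardK: "card (K i) = 2 * orbit_size N cs i" if i: "i \<le> N div 2" for i
  proof -
    have "K i = (\<Union>D\<in>Ob i. {(c, \<alpha>) \<in> cusp_keys N. cusp_class N \<alpha> c = D})" by (auto simp: K_def)
    also have "card \<dots> = (\<Sum>D\<in>Ob i. card {(c, \<alpha>) \<in> cusp_keys N. cusp_class N \<alpha> c = D})"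
    proof (rule card_UN_disjoint)
      show "finite (Ob i)" unfolding Ob_def by (rule finite_galois_orbit_cs[OF N cs i])
      show "\<forall>D\<in>Ob i. finite {(c, \<alpha>) \<in> cusp_keys N. cusp_class N \<alpha> c = D}"
        by (intro ballI finite_subset[OF _ finite_cusp_keys]) auto
    qed auto
    also have "\<dots> = (\<Sum>D\<in>Ob i. 2)"
    proof (rule sum.cong)
      fix D assume "D \<in> Ob i"
      then obtain x where x: "coprime x (int N)" "D = cusp_class N (fst (cs i)) (x * snd (cs i))" using ObI[OF i] by blast
      have "gcd (x * snd (cs i)) (int N) = gcd (snd (cs i)) (int N)"
        using x(1) by (simp add: gcd_mult_left_left_cancel coprime_commute)
      then have "coprime (fst (cs i)) (gcd (x * snd (cs i)) (int N))"
        using coprime_gcd_right_int[OF cusp_reps_coprime[OF cs i]] by simp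
      note key = cusp_key_of_class[OF N0 this]
      show "card {(c, \<alpha>) \<in> cusp_keys N. cusp_class N \<alpha> c = D} = 2"
        using cusp_keys_fiber[OF N key(1)] unfolding key(2) x(2) .
    qed simp
    finally show ?thesis by (simp add: Ob_def orbit_size_def)
  qed
  have FK: "F (gcd c (int N)) \<alpha> = F (cusp_gcd N (cs i)) (fst (cs i))" if i: "i \<le> N div 2" and k: "(c, \<alpha>) \<in> K i" for i c \<alpha>
  proof -
    have cop: "coprime \<alpha> (gcd c (int N))" using k by (simp add: K_def cusp_keys_def)
    obtain x where x: "coprime x (int N)" "cusp_class N \<alpha> c = cusp_class N (fst (cs i)) (x * snd (cs i))"
      using i k ObI by (auto simp: K_def)
    have r: "cusp_rel N (fst (cs i)) (x * snd (cs i)) \<alpha> c"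
      by (rule cusp_rel_sym[OF cusp_class_eqD[OF N0 cop x(2)]])
    have g: "gcd (x * snd (cs i)) (int N) = gcd (snd (cs i)) (int N)"
      using x(1) by (simp add: gcd_mult_left_left_cancel coprime_commute)
    obtain e where "e \<in> {1, -1}" "[\<alpha> = e * fst (cs i)] (mod gcd (snd (cs i)) (int N))"
      using r unfolding cusp_rel_def g by blast
    then have "F (gcd (snd (cs i)) (int N)) \<alpha> = F (gcd (snd (cs i)) (int N)) (fst (cs i))" by (rule F)
    then show ?thesis using cusp_rel_gcd[OF r] g by (simp add: cusp_gcd_def)
  qed
  have "(\<Sum>(c, \<alpha>)\<in>cusp_keys N. F (gcd c (int N)) \<alpha>) = (\<Sum>i\<le>N div 2. \<Sum>(c, \<alpha>)\<in>K i. F (gcd c (int N)) \<alpha>)"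
    unfolding cover by (intro sum.UNION_disjoint) (use finK disj in blast)+
  also have "\<dots> = (\<Sum>i\<le>N div 2. \<Sum>z\<in>K i. F (cusp_gcd N (cs i)) (fst (cs i)))"
    by (intro sum.cong refl) (use FK in auto)
  also have "\<dots> = (\<Sum>i\<le>N div 2. 2 * (real (orbit_size N cs i) * F (cusp_gcd N (cs i)) (fst (cs i))))"
    by (intro sum.cong refl) (simp add: cardK)
  finally show ?thesis by (simp add: sum_distrib_left)
qed

section \<open>Sums over cusps as divisor sums\<close>

lemma nat_gcd_int: "a \<ge> 0 \<Longrightarrow> gcd (nat a) n = nat (gcd a (int n))"
  by (metis gcd_int_int_eq int_nat_eq nat_int)

lemma sum_coprime_residues:
  fixes f :: "int \<Rightarrow> real"
  assumes per: "\<And>a b. [a = b] (mod int g) \<Longrightarrow> f a = f b" and g: "g > 0"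
  shows "(\<Sum>\<alpha> | \<alpha> \<in> {0..<int g} \<and> coprime \<alpha> (int g). f \<alpha>) = (\<Sum>\<alpha>\<in>totatives g. f (int \<alpha>))"
\<comment> \<open>For g = 1 the residue is 0 while \<open>totatives 1\<close> is {1}; otherwise both
  sides run over the same numbers.\<close>
proof (cases "g = 1")
  case True
  then have "{\<alpha>. \<alpha> \<in> {0..<int g} \<and> coprime \<alpha> (int g)} = {0}" by auto
  moreover have "f 0 = f 1" using True by (intro per) auto
  ultimately show ?thesis using True by simp
next
  case False
  have "bij_betw int (totatives g) {\<alpha>. \<alpha> \<in> {0..<int g} \<and> coprime \<alpha> (int g)}"
  proof (rule bij_betwI')
    fix y assume y: "y \<in> {\<alpha>. \<alpha> \<in> {0..<int g} \<and> coprime \<alpha> (int g)}"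
    have "y \<noteq> 0" using y False g by auto
    then have "nat y \<in> totatives g" using y by (auto simp: totatives_def coprime_int_iff nat_le_iff[symmetric])
       (metis coprime_int_iff int_nat_eq nat_0_le)
    then show "\<exists>x\<in>totatives g. y = int x" using y by (intro bexI[of _ "nat y"]) auto
  next
    fix x assume x: "x \<in> totatives g"
    have "x \<noteq> g" using x False by (auto simp: totatives_def)
    then show "int x \<in> {\<alpha>. \<alpha> \<in> {0..<int g} \<and> coprime \<alpha> (int g)}" using x by (auto simp: totatives_def)
  qed auto
  then show ?thesis by (rule sum.reindex_bij_betw[symmetric])
qed

lemma sum_by_gcd:
  fixes f :: "nat \<Rightarrow> real"
  assumes n: "n > 0"
  shows "(\<Sum>k\<in>{0<..n}. f k) = (\<Sum>d | d dvd n. \<Sum>k\<in>totatives (n div d). f (k * d))"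
proof -
  have "(\<Sum>k\<in>{0<..n}. f k) = (\<Sum>d | d dvd n. \<Sum>k | k \<in> {0<..n} \<and> gcd k n = d. f k)"
    by (subst sum.group[of "{0<..n}" "{d. d dvd n}" "\<lambda>k. gcd k n"]) (use n in auto)
  also have "\<dots> = (\<Sum>d | d dvd n. \<Sum>k\<in>totatives (n div d). f (k * d))"
  proof (rule sum.cong[OF refl])
    fix d assume "d \<in> {d. d dvd n}"
    then have "bij_betw (\<lambda>k. k * d) (totatives (n div d)) {k \<in> {0<..n}. gcd k n = d}"
      using n by (intro bij_betw_totatives_gcd_eq) auto
    then show "(\<Sum>k | k \<in> {0<..n} \<and> gcd k n = d. f k) = (\<Sum>k\<in>totatives (n div d). f (k * d))"
      by (rule sum.reindex_bij_betw[symmetric])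
  qed
  finally show ?thesis .
qed

lemma sum_cusp_keys:
  fixes F :: "int \<Rightarrow> int \<Rightarrow> real"
  assumes N: "N > 0" and F: "\<And>g a a'. [a' = a] (mod g) \<Longrightarrow> F g a' = F g a"
  shows "(\<Sum>(c, \<alpha>)\<in>cusp_keys N. F (gcd c (int N)) \<alpha>)
    = (\<Sum>g | g dvd N. real (totient (N div g)) * (\<Sum>\<alpha>\<in>totatives g. F (int g) (int \<alpha>)))"
proof -
  define W where "W = (\<lambda>g::nat. \<Sum>\<alpha>\<in>totatives g. F (int g) (int \<alpha>))"
  have "cusp_keys N = (SIGMA c:{0..<int N}. {\<alpha>. \<alpha> \<in> {0..<gcd c (int N)} \<and> coprime \<alpha> (gcd c (int N))})"
    by (auto simp: cusp_keys_def)
  then have "(\<Sum>(c, \<alpha>)\<in>cusp_keys N. F (gcd c (int N)) \<alpha>)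
    = (\<Sum>c\<in>{0..<int N}. \<Sum>\<alpha> | \<alpha> \<in> {0..<gcd c (int N)} \<and> coprime \<alpha> (gcd c (int N)). F (gcd c (int N)) \<alpha>)"
    by (subst sum.Sigma) (auto intro: finite_subset[of _ "{0..<gcd _ (int N)}"])
  also have "\<dots> = (\<Sum>c\<in>{0..<int N}. W (nat (gcd c (int N))))"
  proof (intro sum.cong refl)
    fix c
    define g where "g = nat (gcd c (int N))"
    have g: "gcd c (int N) = int g" "g > 0" using N by (simp_all add: g_def gcd_pos_int)
    show "(\<Sum>\<alpha> | \<alpha> \<in> {0..<gcd c (int N)} \<and> coprime \<alpha> (gcd c (int N)). F (gcd c (int N)) \<alpha>) = W (nat (gcd c (int N)))"
      unfolding g(1) W_def nat_int by (rule sum_coprime_residues) (use F g in auto)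
  qed
  also have "\<dots> = (\<Sum>c\<in>{..<N}. W (gcd c N))"
    by (rule sum.reindex_bij_witness[of _ int nat]) (auto simp: nat_gcd_int)
  also have "\<dots> = (\<Sum>c\<in>{0<..N}. W (gcd c N))"
    by (rule sum.reindex_bij_witness[of _ "\<lambda>c. if c = N then 0 else c" "\<lambda>c. if c = 0 then N else c"]) (use N in auto)
  also have "\<dots> = (\<Sum>d | d dvd N. \<Sum>k\<in>totatives (N div d). W (gcd (k * d) N))"
    using N by (rule sum_by_gcd)
  also have "\<dots> = (\<Sum>d | d dvd N. \<Sum>k\<in>totatives (N div d). W d)"
  proof (intro sum.cong refl)
    fix d k assume d: "d \<in> {d. d dvd N}" and k: "k \<in> totatives (N div d)"
    have "gcd (k * d) N = gcd (k * d) (N div d * d)" using d by simp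
    also have "\<dots> = gcd k (N div d) * d" by (simp add: gcd_mult_distrib_nat mult.commute)
    also have "gcd k (N div d) = 1" using k by (simp add: totatives_def)
    finally show "W (gcd (k * d) N) = W d" by simp
  qed
  finally show ?thesis by (simp add: W_def totient_def)
qed

section \<open>Sums of Bernoulli values over the cusps\<close>

definition bern :: "real \<Rightarrow> real" where
  "bern x = (frac x)\<^sup>2 - frac x + 1 / 6"

lemma frac_of_int_div:
  assumes "n > 0"
  shows "frac (real_of_int x / of_int n) = of_int (x mod n) / of_int n"
proof (subst frac_unique_iff, intro conjI)
  have "x - x mod n = n * (x div n)" by (simp add: minus_mod_eq_mult_div)
  then have "real_of_int x - of_int (x mod n) = of_int n * of_int (x div n)"
    by (metis of_int_diff of_int_mult)
  then have "real_of_int x / of_int n - of_int (x mod n) / of_int n = of_int (x div n)"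
    using assms by (simp add: field_simps)
  then show "real_of_int x / of_int n - of_int (x mod n) / of_int n \<in> \<int>" by simp
  have "0 \<le> x mod n" "x mod n < n" using assms by auto
  then show "0 \<le> real_of_int (x mod n) / of_int n" "real_of_int (x mod n) / of_int n < 1"
    using assms by auto
qed

lemma bern_of_int_div:
  assumes "n > 0"
  shows "bern (real_of_int x / of_int n) = bern (of_int (x mod n) / of_int n)"
  using frac_of_int_div[OF assms, of x] frac_of_int_div[OF assms, of "x mod n"] by (simp add: bern_def)

lemma bern_cong:
  assumes "[x = y] (mod n)" "n > 0"
  shows "bern (real_of_int x / of_int n) = bern (real_of_int y / of_int n)"
  using bern_of_int_div[OF assms(2)] assms(1) by (metis cong_def)

lemma bern_minus: "bern (- x) = bern x"
  by (auto simp: bern_def frac_neg power2_eq_square algebra_simps)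

lemma bern_lt: "0 \<le> x \<Longrightarrow> x < 1 \<Longrightarrow> bern x = x\<^sup>2 - x + 1 / 6"
  by (simp add: bern_def frac_eq)

text \<open>The distribution relation of B_2 at the point 0. The induction runs over all partial
  sums with the denominator n held fixed.\<close>

lemma sum_bern_complete:
  assumes n: "n > 0"
  shows "(\<Sum>\<beta><n. bern (real \<beta> / real n)) = 1 / (6 * real n)"
proof -
  have s: "(\<Sum>\<beta><k. (real \<beta>)\<^sup>2 / (real n)\<^sup>2 - real \<beta> / real n + 1 / 6)
     = real k * (real k - 1) * (2 * real k - 1) / (6 * (real n)\<^sup>2) - real k * (real k - 1) / (2 * real n) + real k / 6" for k
  proof (induction k)
    case (Suc k)
    show ?case unfolding sum.lessThan_Suc Suc.IH using n by (simp add: field_simps power2_eq_square)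
  qed simp
  have "(\<Sum>\<beta><n. bern (real \<beta> / real n)) = (\<Sum>\<beta><n. (real \<beta>)\<^sup>2 / (real n)\<^sup>2 - real \<beta> / real n + 1 / 6)"
    by (intro sum.cong refl) (simp add: bern_lt power_divide)
  also have "\<dots> = 1 / (6 * real n)"
    unfolding s using n by (simp add: field_simps power2_eq_square)
  finally show ?thesis .
qed

text \<open>With h = gcd(j, n), the arguments run h times through all fractions with denominator n/h
  modulo 1, and each round contributes h / (6 n).\<close>

lemma sum_bern_dilate:
  assumes n: "n > 0"
  shows "(\<Sum>\<alpha><n. bern (real (j * \<alpha>) / real n)) = (real (gcd j n))\<^sup>2 / (6 * real n)"
proof -
  define h where "h = gcd j n"
  obtain j' where j': "j = h * j'" by (metis h_def dvdE gcd_dvd1)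
  obtain n' where n': "n = h * n'" by (metis h_def dvdE gcd_dvd2)
  have h0: "h > 0" using n by (simp add: h_def)
  have n'0: "n' > 0" using n n' by (cases n') auto
  have "h * gcd j' n' = h" using h_def j' n' by (metis gcd_mult_distrib_nat)
  then have cop: "coprime j' n'" using h0 by (simp add: coprime_iff_gcd_eq_1)
  define f where "f = (\<lambda>\<alpha>::nat. bern (real (j' * \<alpha>) / real n'))"
  have per: "bern (real x / real n') = bern (real (x mod n') / real n')" for x
    using bern_of_int_div[of "int n'" "int x"] n'0 by (simp flip: zmod_int)
  have f_mod: "f (\<alpha> mod n') = f \<alpha>" for \<alpha>
    unfolding f_def using per[of "j' * \<alpha>"] per[of "j' * (\<alpha> mod n')"] by (simp add: mod_mult_right_eq)
  have "(\<Sum>\<alpha><n. bern (real (j * \<alpha>) / real n)) = (\<Sum>\<alpha><h * n'. f \<alpha>)"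
    unfolding f_def n' j' using h0 by (intro sum.cong refl) simp
  also have "\<dots> = (\<Sum>m<h. \<Sum>\<alpha> = m * n'..<m * n' + n'. f \<alpha>)"
    by (rule sum.nat_group[symmetric])
  also have "\<dots> = (\<Sum>m<h. \<Sum>\<alpha><n'. f \<alpha>)"
  proof (rule sum.cong[OF refl])
    fix m
    show "(\<Sum>\<alpha> = m * n'..<m * n' + n'. f \<alpha>) = (\<Sum>\<alpha><n'. f \<alpha>)"
    proof (rule sum.reindex_bij_witness[of _ "\<lambda>\<alpha>. \<alpha> + m * n'" "\<lambda>\<alpha>. \<alpha> - m * n'"])
      fix \<alpha> assume "\<alpha> \<in> {m * n'..<m * n' + n'}"
      then have "m * n' \<le> \<alpha>" by simp
      then obtain b where "\<alpha> = m * n' + b" using le_Suc_ex by blast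
      then show "f (\<alpha> - m * n') = f \<alpha>" using f_mod[of \<alpha>] f_mod[of b] by simp
    qed auto
  qed
  also have "(\<Sum>\<alpha><n'. f \<alpha>) = (\<Sum>\<beta><n'. bern (real \<beta> / real n'))"
  proof -
    have inj: "inj_on (\<lambda>\<alpha>. (j' * \<alpha>) mod n') {..<n'}"
    proof (rule inj_onI)
      fix x y assume xy: "x \<in> {..<n'}" "y \<in> {..<n'}" "(j' * x) mod n' = (j' * y) mod n'"
      then have "[j' * x = j' * y] (mod n')" by (simp add: cong_def)
      then have "[x = y] (mod n')" using cop by (simp add: cong_mult_lcancel_nat)
      then show "x = y" using xy by (simp add: cong_def)
    qed
    then have "(\<lambda>\<alpha>. (j' * \<alpha>) mod n') ` {..<n'} = {..<n'}"
      using n'0 by (intro endo_inj_surj) auto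
    then have "bij_betw (\<lambda>\<alpha>. (j' * \<alpha>) mod n') {..<n'} {..<n'}" using inj by (simp add: bij_betw_def)
    then have "(\<Sum>\<beta><n'. bern (real \<beta> / real n')) = (\<Sum>\<alpha><n'. bern (real ((j' * \<alpha>) mod n') / real n'))"
      by (rule sum.reindex_bij_betw[symmetric])
    then show ?thesis unfolding f_def per[symmetric] by simp
  qed
  also have "(\<Sum>m<h. \<Sum>\<beta><n'. bern (real \<beta> / real n')) = (real h)\<^sup>2 / (6 * real n)"
    unfolding sum_bern_complete[OF n'0] using h0 n'0 by (simp add: n' power2_eq_square field_simps)
  finally show ?thesis by (simp add: h_def)
qed

text \<open>
  Write \<open>T(n)\<close> for the sum at level \<open>n\<close>. By the distribution relation and Gauss's totient sum
  the values of \<open>T\<close> over the divisors of \<open>n\<close> add up to \<open>gcd(j, n)\<^sup>2 / 6\<close>, which is also their sum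
  over the divisors of \<open>gcd(j, n)\<close>; now induct on \<open>n\<close>.
\<close>

lemma sum_bern_cusps_eq_0:
  assumes N: "N > 0" and jN: "\<not> N dvd j"
  shows "(\<Sum>g | g dvd N. real (totient (N div g)) * (\<Sum>\<alpha>\<in>totatives g. real g * bern (real (j * \<alpha>) / real g))) = 0"
proof -
  define W where "W = (\<lambda>g::nat. \<Sum>\<alpha>\<in>totatives g. real g * bern (real (j * \<alpha>) / real g))"
  define T where "T = (\<lambda>n::nat. \<Sum>g | g dvd n. real (totient (n div g)) * W g)"
  have W: "(\<Sum>d | d dvd n. real (n div d) * W d) = (real (gcd j n))\<^sup>2 / 6" if n: "n > 0" for n
  proof -
    define b where "b = (\<lambda>\<alpha>. bern (real (j * \<alpha>) / real n))"
    have "(\<Sum>\<alpha>\<in>{0<..n}. b \<alpha>) = (\<Sum>\<alpha><n. b \<alpha>)"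
    proof -
      have "bern (real (j * n) / real n) = bern (real (j * 0) / real n)"
        using n bern_cong[of "int (j * n)" 0 "int n"] by (simp add: cong_0_iff)
      then have "b n = b 0" by (simp add: b_def)
      then show ?thesis
        by (intro sum.reindex_bij_witness[of _ "\<lambda>c. if c = 0 then n else c" "\<lambda>c. if c = n then 0 else c"]) (use n in auto)
    qed
    also have "\<dots> = (real (gcd j n))\<^sup>2 / (6 * real n)"
      unfolding b_def by (rule sum_bern_dilate[OF n])
    finally have 1: "real n * (\<Sum>\<alpha>\<in>{0<..n}. b \<alpha>) = (real (gcd j n))\<^sup>2 / 6" using n by simp
    have "(\<Sum>\<alpha>\<in>{0<..n}. b \<alpha>) = (\<Sum>d | d dvd n. \<Sum>k\<in>totatives (n div d). b (k * d))"
      using n by (rule sum_by_gcd)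
    also have "\<dots> = (\<Sum>d | d dvd n. \<Sum>k\<in>totatives d. b (k * (n div d)))"
      by (rule sum.reindex_bij_witness[of _ "\<lambda>d. n div d" "\<lambda>d. n div d"]) (use n in \<open>auto elim!: dvdE\<close>)
    finally have "real n * (\<Sum>\<alpha>\<in>{0<..n}. b \<alpha>) = (\<Sum>d | d dvd n. real n * (\<Sum>k\<in>totatives d. b (k * (n div d))))"
      by (simp add: sum_distrib_left)
    also have "\<dots> = (\<Sum>d | d dvd n. real (n div d) * W d)"
    proof (rule sum.cong[OF refl])
      fix d assume "d \<in> {d. d dvd n}"
      then obtain e where e: "n = d * e" by blast
      have de: "d > 0" "e > 0" using n e by auto
      have "b (k * (n div d)) = bern (real (j * k) / real d)" for k
        using de by (simp add: b_def e)
      then show "real n * (\<Sum>k\<in>totatives d. b (k * (n div d))) = real (n div d) * W d"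
        using de by (simp add: W_def e sum_distrib_left mult_ac)
    qed
    finally show ?thesis using 1 by simp
  qed
  have T: "(\<Sum>d | d dvd n. T d) = (real (gcd j n))\<^sup>2 / 6" if n: "n > 0" for n
  proof -
    have fin: "finite {d. d dvd n}" using n by simp
    have "(\<Sum>d | d dvd n. T d) = (\<Sum>d | d dvd n. \<Sum>g | g \<in> {g. g dvd n} \<and> g dvd d. real (totient (d div g)) * W g)"
      unfolding T_def by (intro sum.cong refl) (auto intro: dvd_trans)
    also have "\<dots> = (\<Sum>g | g dvd n. \<Sum>d | d \<in> {d. d dvd n} \<and> g dvd d. real (totient (d div g)) * W g)"
      using fin by (rule sum.swap_restrict[OF _ fin])
    also have "\<dots> = (\<Sum>g | g dvd n. real (n div g) * W g)"
    proof (rule sum.cong[OF refl])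
      fix g assume "g \<in> {g. g dvd n}"
      then obtain e where e: "n = g * e" by blast
      have g0: "g > 0" using n e by auto
      have "(\<Sum>d | d \<in> {d. d dvd n} \<and> g dvd d. real (totient (d div g)) * W g) = (\<Sum>x | x dvd e. real (totient x) * W g)"
        by (rule sum.reindex_bij_witness[of _ "\<lambda>x. g * x" "\<lambda>d. d div g"]) (use g0 e in auto)
      also have "\<dots> = real (\<Sum>x | x dvd e. totient x) * W g" by (simp add: sum_distrib_right)
      finally show "(\<Sum>d | d \<in> {d. d dvd n} \<and> g dvd d. real (totient (d div g)) * W g) = real (n div g) * W g"
        using g0 by (simp only: totient_divisor_sum) (simp add: e)
    qed
    finally show ?thesis using W[OF n] by simp
  qed
  have "n > 0 \<Longrightarrow> \<not> n dvd j \<Longrightarrow> T n = 0" for n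
  proof (induction n rule: less_induct)
    case (less n)
    define h where "h = gcd j n"
    have h0: "h > 0" using less.prems by (simp add: h_def)
    have fin: "finite {d. d dvd n}" using less.prems by simp
    have "(\<Sum>d | d dvd n. T d) = (\<Sum>d | d dvd h. T d)"
      using T[OF less.prems(1)] T[OF h0] by (simp add: h_def)
    also have "{d. d dvd h} = {d. d dvd n} \<inter> {d. d dvd j}" by (auto simp: h_def)
    also have "(\<Sum>d | d dvd n. T d) = (\<Sum>d\<in>{d. d dvd n} \<inter> {d. d dvd j}. T d) + (\<Sum>d\<in>{d. d dvd n} - {d. d dvd j}. T d)"
      using fin by (rule sum.Int_Diff)
    finally have "(\<Sum>d\<in>{d. d dvd n} - {d. d dvd j}. T d) = 0" by simp
    moreover have "(\<Sum>d\<in>{d. d dvd n} - {d. d dvd j}. T d) = T n"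
    proof -
      have "(\<Sum>d\<in>{d. d dvd n} - {d. d dvd j}. T d) = (\<Sum>d\<in>{n}. T d)"
      proof (rule sum.mono_neutral_right)
        show "\<forall>i\<in>{d. d dvd n} - {d. d dvd j} - {n}. T i = 0"
        proof
          fix i assume i: "i \<in> {d. d dvd n} - {d. d dvd j} - {n}"
          then have "i \<le> n" using less.prems by (auto intro: dvd_imp_le)
          moreover have "i > 0" using i less.prems by (auto intro!: Nat.gr0I)
          ultimately show "T i = 0" using i by (intro less.IH) auto
        qed
      qed (use fin less.prems in auto)
      then show ?thesis by simp
    qed
    ultimately show ?case by simp
  qed
  then show ?thesis using N jN unfolding T_def W_def by blast
qed

section \<open>Invertibility of the Bernoulli matrix\<close>

lemma sum_root_of_unity:
  fixes z :: complex
  assumes "z ^ N = 1"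
  shows "(\<Sum>y<N. z ^ y) = (if z = 1 then of_nat N else 0)"
  using assms by (simp add: geometric_sum)

lemma sum_ee_residues:
  assumes N: "N > 0"
  shows "(\<Sum>y<N. ee (of_int (k * int y) / of_nat N)) = (if int N dvd k then of_nat N else 0)"
proof -
  define z where "z = ee (of_int k / of_nat N)"
  have zy: "z ^ y = ee (of_int (k * int y) / of_nat N)" for y
    by (simp add: z_def ee_power mult.commute)
  have "z ^ N = ee (of_int k)" unfolding zy using N by simp
  then have zN: "z ^ N = 1" by simp
  have "z = 1 \<longleftrightarrow> int N dvd k"
  proof
    assume "z = 1"
    then obtain n where "of_int k / of_nat N = complex_of_int n" unfolding z_def ee_eq_1_iff by blast
    then have "complex_of_int k = of_int (n * int N)" using N by (simp add: field_simps)
    then show "int N dvd k" by (simp only: of_int_eq_iff) simp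
  next
    assume "int N dvd k"
    then show "z = 1" unfolding z_def using N by (elim dvdE) simp
  qed
  then show ?thesis using sum_root_of_unity[OF zN] by (simp add: zy)
qed

text \<open>The finite Fourier transform of B_2 at a non-trivial frequency. Multiplication by z
  shifts the summation index, and telescoping gives linear equations for the first and second
  moments \<open>s1\<close> and \<open>s2\<close>.\<close>

lemma sum_quadratic_root_of_unity:
  fixes z :: complex
  assumes z: "z ^ N = 1" "z \<noteq> 1" and N: "N > 0"
  shows "(\<Sum>y<N. ((of_nat y)\<^sup>2 / (of_nat N)\<^sup>2 - of_nat y / of_nat N + 1 / 6) * z ^ y) = - 2 * z / (of_nat N * (z - 1)\<^sup>2)"
proof -
  define s0 where "s0 = (\<Sum>y<N. z ^ y)"
  define s1 where "s1 = (\<Sum>y<N. of_nat y * z ^ y)"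
  define s2 where "s2 = (\<Sum>y<N. (of_nat y)\<^sup>2 * z ^ y)"
  have s0: "s0 = 0" using sum_root_of_unity[OF z(1)] z(2) by (simp add: s0_def)
  have t1: "(\<Sum>y<n. of_nat (Suc y) * z ^ Suc y - of_nat y * z ^ y) = of_nat n * z ^ n" for n
    by (induction n) auto
  have "z * s1 + z * s0 - s1 = (\<Sum>y<N. of_nat (Suc y) * z ^ Suc y - of_nat y * z ^ y)"
    unfolding s1_def s0_def sum_distrib_left sum.distrib[symmetric] sum_subtractf[symmetric]
    by (intro sum.cong refl) (simp add: algebra_simps)
  then have e1: "(z - 1) * s1 = of_nat N" unfolding t1 by (simp add: s0 z algebra_simps)
  have t2: "(\<Sum>y<n. (of_nat (Suc y))\<^sup>2 * z ^ Suc y - (of_nat y)\<^sup>2 * z ^ y) = (of_nat n)\<^sup>2 * z ^ n" for n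
    by (induction n) auto
  have "z * s2 + 2 * z * s1 + z * s0 - s2 = (\<Sum>y<N. (of_nat (Suc y))\<^sup>2 * z ^ Suc y - (of_nat y)\<^sup>2 * z ^ y)"
    unfolding s2_def s1_def s0_def sum_distrib_left sum.distrib[symmetric] sum_subtractf[symmetric]
    by (intro sum.cong refl) (simp add: algebra_simps power2_eq_square)
  then have e2: "(z - 1) * s2 + 2 * z * s1 = (of_nat N)\<^sup>2" unfolding t2 by (simp add: s0 z algebra_simps)
  have "(\<Sum>y<N. ((of_nat y)\<^sup>2 / (of_nat N)\<^sup>2 - of_nat y / of_nat N + 1 / 6) * z ^ y)
      = (\<Sum>y<N. (1 / (of_nat N)\<^sup>2) * ((of_nat y)\<^sup>2 * z ^ y) - (1 / of_nat N) * (of_nat y * z ^ y) + 1 / 6 * z ^ y)"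
    by (intro sum.cong refl) (simp add: algebra_simps)
  also have "\<dots> = 1 / (of_nat N)\<^sup>2 * s2 - 1 / of_nat N * s1 + 1 / 6 * s0"
    unfolding s2_def s1_def s0_def by (simp only: sum.distrib sum_subtractf sum_distrib_left)
  also have "s1 = of_nat N / (z - 1)" using e1 z(2) by (simp add: field_simps)
  also have "s2 = ((of_nat N)\<^sup>2 - 2 * z * s1) / (z - 1)" using e2 z(2) by (simp add: field_simps)
  also have "s1 = of_nat N / (z - 1)" using e1 z(2) by (simp add: field_simps)
  also have "1 / (of_nat N)\<^sup>2 * (((of_nat N)\<^sup>2 - 2 * z * (of_nat N / (z - 1))) / (z - 1)) - 1 / of_nat N * (of_nat N / (z - 1)) + 1 / 6 * s0
     = - 2 * z / (of_nat N * (z - 1)\<^sup>2)"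
  proof -
    define w where "w = z - 1"
    have w: "w \<noteq> 0" "z = w + 1" using z(2) by (auto simp: w_def)
    have "complex_of_nat N \<noteq> 0" using N by simp
    then show ?thesis unfolding s0 w_def[symmetric] using w(1) by (simp add: field_simps power2_eq_square)
  qed
  finally show ?thesis .
qed

text \<open>On the unit circle (z - 1)^2 = -z |z - 1|^2. This is why the Fourier coefficients of B_2
  are real and positive.\<close>

lemma unit_circle_sq:
  fixes z :: complex
  assumes "norm z = 1" "z \<noteq> 1"
  shows "- z / (z - 1)\<^sup>2 = of_real (1 / (norm (z - 1))\<^sup>2)"
proof -
  have z: "z * cnj z = 1" using assms(1) by (simp add: complex_norm_square[symmetric])
  have z0: "z \<noteq> 0" using assms by auto
  have n0: "norm (z - 1) \<noteq> 0" using assms by simp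
  have nz: "complex_of_real ((norm (z - 1))\<^sup>2) = (z - 1) * (cnj z - 1)"
    using complex_norm_square[of "z - 1"] by simp
  have "z * complex_of_real ((norm (z - 1))\<^sup>2) = (z - 1) * (z * cnj z - z)"
    unfolding nz by (simp add: algebra_simps)
  also have "\<dots> = - (z - 1)\<^sup>2" unfolding z by (simp add: power2_eq_square algebra_simps)
  finally have "(z - 1)\<^sup>2 = - z * complex_of_real ((norm (z - 1))\<^sup>2)" by simp
  then show ?thesis using z0 n0 by simp
qed

text \<open>
  The coefficients add up to \<open>bern 0 = 1 / 6\<close>, so the last inequality says that the two
  coefficients at \<open>\<plusminus>1\<close> carry more than half of the total weight.
\<close>

lemma bern_fourier:
  assumes N: "N \<ge> 3"
  shows "\<exists>b :: nat \<Rightarrow> real. (\<forall>u<N. b u \<ge> 0) \<and> b 1 + b (N - 1) > 1 / 12 \<and>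
    (\<forall>x::int. complex_of_real (bern (of_int x / real N)) = (\<Sum>u<N. of_real (b u) * ee (of_int (int u * x) / of_nat N)))"
proof -
  define e where "e = (\<lambda>k::int. ee (of_int k / of_nat N))"
  have N0: "N > 0" and Nc: "complex_of_nat N \<noteq> 0" using N by auto
  have e_add: "e (k + l) = e k * e l" for k l by (simp add: e_def ee_add add_divide_distrib)
  have e_pow: "e k ^ y = e (k * int y)" for k y by (simp add: e_def ee_power mult.commute)
  have e1: "e k = 1 \<longleftrightarrow> int N dvd k" for k
  proof
    assume "e k = 1"
    then obtain n where "of_int k / of_nat N = complex_of_int n" unfolding e_def ee_eq_1_iff by blast
    then have "complex_of_int k = of_int (n * int N)" using N0 by (simp add: field_simps)
    then show "int N dvd k" by (simp only: of_int_eq_iff) simp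
  next
    assume "int N dvd k"
    then show "e k = 1" unfolding e_def using N0 by (elim dvdE) simp
  qed
  have sum_e: "(\<Sum>y<N. e (k * int y)) = (if int N dvd k then of_nat N else 0)" for k
    unfolding e_def by (rule sum_ee_residues[OF N0])
  have ne: "norm (e k) = 1" for k by (simp add: e_def norm_ee Im_divide)
  \<comment> \<open>The Fourier coefficients of \<open>bern (y / N)\<close> in a closed form that
    shows their sign.\<close>
  define b where "b = (\<lambda>u::nat. if u = 0 then 1 / (6 * (real N)\<^sup>2) else 2 / ((real N)\<^sup>2 * (norm (e (- int u) - 1))\<^sup>2))"
  have b: "complex_of_real (b u) = 1 / of_nat N * (\<Sum>y<N. of_real (bern (real y / real N)) * e (- int u * int y))"
    if u: "u < N" for u
  proof (cases "u = 0")
    case True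
    have "(\<Sum>y<N. of_real (bern (real y / real N)) * e (- int u * int y)) = complex_of_real (\<Sum>y<N. bern (real y / real N))"
      using True by (simp add: e_def)
    also have "\<dots> = of_real (1 / (6 * real N))" by (simp only: sum_bern_complete[OF N0])
    finally show ?thesis using True by (simp add: b_def power2_eq_square)
  next
    case False
    define z where "z = e (- int u)"
    have z1: "z \<noteq> 1" unfolding z_def e1 using u False by (auto dest: zdvd_imp_le)
    have zN: "z ^ N = 1" unfolding z_def e_pow e1 by simp
    have "(\<Sum>y<N. of_real (bern (real y / real N)) * e (- int u * int y))
       = (\<Sum>y<N. ((of_nat y)\<^sup>2 / (of_nat N)\<^sup>2 - of_nat y / of_nat N + 1 / 6) * z ^ y)"
      unfolding z_def e_pow by (intro sum.cong refl) (simp add: bern_lt power_divide)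
    also have "\<dots> = - 2 * z / (of_nat N * (z - 1)\<^sup>2)"
      by (rule sum_quadratic_root_of_unity[OF zN z1 N0])
    also have "\<dots> = 2 / of_nat N * (- z / (z - 1)\<^sup>2)" by simp
    also have "\<dots> = 2 / of_nat N * of_real (1 / (norm (z - 1))\<^sup>2)"
      by (subst unit_circle_sq[OF _ z1]) (simp_all add: z_def ne)
    finally show ?thesis using False by (simp add: b_def z_def power2_eq_square)
  qed
  have inv: "complex_of_real (bern (of_int x / real N)) = (\<Sum>u<N. of_real (b u) * e (int u * x))" for x
  proof -
    define x0 where "x0 = nat (x mod int N)"
    have x0: "x0 < N" "int x0 = x mod int N" using N0 by (auto simp: x0_def nat_less_iff)
    have dv: "int N dvd x - int y \<longleftrightarrow> y = x0" if "y < N" for y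
    proof -
      have "int N dvd x - int y \<longleftrightarrow> x mod int N = int y mod int N" by (metis mod_eq_dvd_iff)
      then show ?thesis using that x0 by (auto simp flip: zmod_int)
    qed
    have "(\<Sum>u<N. of_real (b u) * e (int u * x))
      = (\<Sum>u<N. \<Sum>y<N. 1 / of_nat N * of_real (bern (real y / real N)) * e ((x - int y) * int u))"
    proof (rule sum.cong[OF refl])
      fix u assume "u \<in> {..<N}"
      then have "of_real (b u) * e (int u * x) = (\<Sum>y<N. 1 / of_nat N * (of_real (bern (real y / real N)) * e (- int u * int y) * e (int u * x)))"
        by (simp add: b sum_distrib_left sum_distrib_right mult.assoc)
      also have "\<dots> = (\<Sum>y<N. 1 / of_nat N * of_real (bern (real y / real N)) * e ((x - int y) * int u))"
        by (intro sum.cong refl) (simp add: algebra_simps flip: e_add)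
      finally show "of_real (b u) * e (int u * x) = (\<Sum>y<N. 1 / of_nat N * of_real (bern (real y / real N)) * e ((x - int y) * int u))" .
    qed
    also have "\<dots> = (\<Sum>y<N. 1 / of_nat N * of_real (bern (real y / real N)) * (\<Sum>u<N. e ((x - int y) * int u)))"
      by (subst sum.swap) (simp only: sum_distrib_left)
    also have "\<dots> = (\<Sum>y<N. if y = x0 then complex_of_real (bern (real y / real N)) else 0)"
      unfolding sum_e using Nc by (intro sum.cong refl) (auto simp: dv)
    also have "\<dots> = of_real (bern (real x0 / real N))" using x0 by simp
    also have "bern (real x0 / real N) = bern (of_int x / real N)"
      using bern_of_int_div[of "int N" x] N0 x0(2) by (metis of_int_of_nat_eq of_nat_0_less_iff)
    finally show ?thesis ..
  qed
  have "b 1 + b (N - 1) > 1 / 12"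
  proof -
    have i: "real N > 0" using N0 by simp
    have nb: "norm (e (- 1) - 1) \<le> 2 * pi / real N"
    proof -
      have "e (- 1) = exp (\<i> * complex_of_real (- (2 * pi / real N)))"
        unfolding e_def ee_def by (simp add: field_simps)
      then have "norm (e (- 1) - 1) = 2 * \<bar>sin (- (2 * pi / real N) / 2)\<bar>" by (simp only: dist_exp_i_1)
      also have "\<dots> \<le> 2 * \<bar>- (2 * pi / real N) / 2\<bar>" by (intro mult_left_mono abs_sin_x_le_abs_x) auto
      finally show ?thesis by simp
    qed
    have "e (- int (N - 1)) = e 1"
    proof -
      have "e (- int (N - 1)) = e (1 + - int N)" using N0 by (intro arg_cong[where f = e]) simp
      also have "\<dots> = e 1" unfolding e_add using e1[of "- int N"] by simp
      finally show ?thesis .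
    qed
    moreover have "norm (e 1 - 1) = norm (e (- 1) - 1)"
    proof -
      have "e 1 * e (- 1) = 1" by (simp add: e_def flip: ee_add)
      then have "e 1 - 1 = - e 1 * (e (- 1) - 1)" by (simp add: algebra_simps)
      then show ?thesis by (simp add: norm_mult ne)
    qed
    ultimately have bb: "b (N - 1) = b 1" using N by (simp add: b_def)
    have pos: "norm (e (- 1) - 1) > 0" using e1[of "-1"] N by (auto dest: zdvd_imp_le)
    \<comment> \<open>A chord is shorter than its arc, so \<open>b 1\<close> is at least 1 / (2
      pi^2), which exceeds 1/24 because pi^2 < 12.\<close>
    have "(real N)\<^sup>2 * (norm (e (- 1) - 1))\<^sup>2 \<le> (real N)\<^sup>2 * (2 * pi / real N)\<^sup>2"
      using nb by (intro mult_left_mono power_mono) auto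
    also have "\<dots> = 4 * pi\<^sup>2" using i by (simp add: power_divide power_mult_distrib)
    also have "\<dots> < 48"
    proof -
      have "pi < 17 / 5" using pi_less_4 pi_approx by simp
      then have "pi\<^sup>2 < (17 / 5)\<^sup>2" by (intro power_strict_mono) auto
      then show ?thesis by (simp add: power2_eq_square)
    qed
    finally have "2 / ((real N)\<^sup>2 * (norm (e (- 1) - 1))\<^sup>2) > 2 / 48"
      using pos i by (intro divide_strict_left_mono) auto
    then have "b 1 > 1 / 24" by (simp add: b_def)
    then show ?thesis using bb by simp
  qed
  moreover have "\<forall>u<N. b u \<ge> 0" by (simp add: b_def)
  ultimately show ?thesis using inv unfolding e_def by blast
qed

text \<open>
  In terms of the even function \<open>c(y) = \<Sum>\<^sub>j v\<^sub>j (e(jy) + e(-jy))\<close> the hypothesis reads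
  \<open>\<Sum>\<^sub>u b\<^sub>u c(ux) = 0\<close>. At a point where \<open>|c|\<close> is maximal the terms \<open>u = \<plusminus>1\<close> outweigh
  all others, so \<open>c = 0\<close>.
\<close>

lemma bern_matrix_injective:
  fixes v :: "nat \<Rightarrow> real"
  assumes N: "N \<ge> 3" and h: "\<And>x::int. (\<Sum>j=1..N div 2. v j * bern (real j * of_int x / real N)) = 0"
    and l: "l \<in> {1..N div 2}"
  shows "v l = 0"
proof -
  obtain b :: "nat \<Rightarrow> real" where b: "\<And>u. u < N \<Longrightarrow> b u \<ge> 0" "b 1 + b (N - 1) > 1 / 12"
    and bern: "\<And>x::int. complex_of_real (bern (of_int x / real N)) = (\<Sum>u<N. of_real (b u) * ee (of_int (int u * x) / of_nat N))"
    using bern_fourier[OF N] by blast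
  have N0: "N > 0" using N by simp
  define e where "e = (\<lambda>k::int. ee (of_int k / of_nat N))"
  have e_add: "e (k + l) = e k * e l" for k l by (simp add: e_def ee_add add_divide_distrib)
  have e_N: "e (k * int N) = 1" for k using N0 by (simp add: e_def)
  have sum_e: "(\<Sum>y<N. e (k * int y)) = (if int N dvd k then of_nat N else 0)" for k
    unfolding e_def by (rule sum_ee_residues[OF N0])
  define c where "c = (\<lambda>y::int. \<Sum>j=1..N div 2. of_real (v j) * (e (int j * y) + e (- (int j * y))))"
  have c_neg: "c (- y) = c y" for y by (simp add: c_def add.commute)
  have c_per: "c (y + k * int N) = c y" for y k
  proof -
    have "e (int j * (y + k * int N)) = e (int j * y)" "e (- (int j * (y + k * int N))) = e (- (int j * y))" for j
    proof -
      have "int j * (y + k * int N) = int j * y + (int j * k) * int N" by (simp add: algebra_simps)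
      then show "e (int j * (y + k * int N)) = e (int j * y)" by (simp only: e_add e_N) simp
      have "- (int j * (y + k * int N)) = - (int j * y) + (- (int j * k)) * int N" by (simp add: algebra_simps)
      then show "e (- (int j * (y + k * int N))) = e (- (int j * y))" by (simp only: e_add e_N) simp
    qed
    then show ?thesis by (simp add: c_def)
  qed
  have hc: "(\<Sum>u<N. of_real (b u) * c (int u * x)) = 0" for x
  proof -
    have "(\<Sum>u<N. of_real (b u) * c (int u * x))
       = (\<Sum>j=1..N div 2. of_real (v j) * ((\<Sum>u<N. of_real (b u) * e (int u * (int j * x))) + (\<Sum>u<N. of_real (b u) * e (int u * (- (int j * x))))))"
      unfolding c_def sum_distrib_left sum.distrib[symmetric]
      by (subst sum.swap) (intro sum.cong refl, simp add: algebra_simps)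
    also have "\<dots> = (\<Sum>j=1..N div 2. of_real (v j) * (of_real (bern (of_int (int j * x) / real N)) + of_real (bern (of_int (- (int j * x)) / real N))))"
      unfolding bern e_def ..
    also have "\<dots> = (\<Sum>j=1..N div 2. of_real (2 * (v j * bern (real j * of_int x / real N))))"
      by (intro sum.cong refl) (simp add: bern_minus)
    also have "\<dots> = of_real (2 * (\<Sum>j=1..N div 2. v j * bern (real j * of_int x / real N)))"
      by (simp add: sum_distrib_left)
    finally show ?thesis unfolding h by simp
  qed
  have sumb: "(\<Sum>u<N. b u) = 1 / 6"
  proof -
    have "complex_of_real (\<Sum>u<N. b u) = of_real (bern (of_int 0 / real N))"
      unfolding bern by simp
    then have "(\<Sum>u<N. b u) = bern (of_int 0 / real N)" by (simp only: of_real_eq_iff)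
    then show ?thesis by (simp add: bern_def)
  qed
  define M where "M = Max ((\<lambda>y. norm (c (int y))) ` {..<N})"
  have fin: "finite ((\<lambda>y. norm (c (int y))) ` {..<N})" by simp
  have le_M: "norm (c y) \<le> M" for y
  proof -
    have "c y = c (y mod int N)"
      using c_per[of "y mod int N" "y div int N"] by (simp add: mult.commute)
    also have "y mod int N = int (nat (y mod int N))" using N0 by simp
    moreover have "nat (y mod int N) \<in> {..<N}" using N0 by (auto simp: nat_less_iff)
    from Max_ge[OF fin imageI[OF this]] have "norm (c (int (nat (y mod int N)))) \<le> M" by (simp only: M_def)
    ultimately show ?thesis by simp
  qed
  have "M \<in> (\<lambda>y. norm (c (int y))) ` {..<N}" unfolding M_def using N0 by (intro Max_in) auto
  then obtain x where x: "norm (c (int x)) = M" by auto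
  have "M \<ge> 0" using x by (metis norm_ge_zero)
  define b2 where "b2 = b 1 + b (N - 1)"
  define I where "I = {..<N} - {1, N - 1}"
  have split: "(\<Sum>u<N. f u) = f 1 + f (N - 1) + sum f I" for f :: "nat \<Rightarrow> 'a::comm_monoid_add"
  proof -
    have "(\<Sum>u<N. f u) = sum f {1, N - 1} + sum f I"
      unfolding I_def using N by (subst add.commute, intro sum.subset_diff) auto
    then show ?thesis using N by simp
  qed
  \<comment> \<open>The frequency N - 1 acts as -1, and \<open>c\<close> is even, so both dominant
    terms carry the same value \<open>c x\<close>.\<close>
  have "c (int (N - 1) * int x) = c (int x)"
  proof -
    have "int (N - 1) * int x = - int x + int x * int N" using N0 by (simp add: of_nat_diff algebra_simps)
    then show ?thesis by (simp only: c_per c_neg)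
  qed
  then have "of_real b2 * c (int x) + (\<Sum>u\<in>I. of_real (b u) * c (int u * int x)) = 0"
    using hc[of "int x"] unfolding split by (simp add: b2_def distrib_right)
  then have "of_real b2 * c (int x) = - (\<Sum>u\<in>I. of_real (b u) * c (int u * int x))"
    by (rule eq_neg_iff_add_eq_0[THEN iffD2])
  then have "norm (of_real b2 * c (int x)) = norm (\<Sum>u\<in>I. of_real (b u) * c (int u * int x))" by simp
  also have "\<dots> \<le> (\<Sum>u\<in>I. b u * M)"
    by (rule sum_norm_le) (use b(1) le_M in \<open>auto simp: norm_mult I_def intro!: mult_left_mono\<close>)
  also have "\<dots> = (1 / 6 - b2) * M"
  proof -
    have "(\<Sum>u\<in>I. b u) = 1 / 6 - b2" using sumb unfolding split b2_def by simp
    then show ?thesis by (simp flip: sum_distrib_right)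
  qed
  also have "norm (of_real b2 * c (int x)) = b2 * M"
  proof -
    have "b2 > 0" using b(2) by (simp add: b2_def)
    then show ?thesis by (simp add: norm_mult x)
  qed
  finally have "b2 * M \<le> (1 / 6 - b2) * M" .
  then have "(2 * b2 - 1 / 6) * M \<le> 0" by (simp add: algebra_simps)
  moreover have "2 * b2 - 1 / 6 > 0" using b(2) by (simp add: b2_def)
  ultimately have "M \<le> 0" by (simp add: mult_le_0_iff)
  then have c0: "c y = 0" for y using le_M[of y] by (metis norm_le_zero_iff order_trans)
  define m where "m = N div 2"
  \<comment> \<open>Fourier inversion recovers \<open>v l\<close> from \<open>c = 0\<close>. At l =
    N/2 the frequencies l and -l coincide, which only doubles the non-zero factor in front of
    \<open>v l\<close>.\<close>
  have "(\<Sum>y<N. c (int y) * e (- int l * int y))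
     = (\<Sum>y<N. \<Sum>j=1..m. of_real (v j) * (e ((int j - int l) * int y) + e ((- int j - int l) * int y)))"
    unfolding c_def sum_distrib_right m_def[symmetric]
    by (intro sum.cong refl) (simp add: algebra_simps flip: e_add)
  also have "\<dots> = (\<Sum>j=1..m. of_real (v j) * ((\<Sum>y<N. e ((int j - int l) * int y)) + (\<Sum>y<N. e ((- int j - int l) * int y))))"
    by (subst sum.swap) (simp only: sum.distrib sum_distrib_left distrib_left)
  also have "\<dots> = (\<Sum>j=1..m. if j = l then of_real (v l) * (of_nat N + (if 2 * l = N then of_nat N else 0)) else 0)"
  proof (rule sum.cong[OF refl])
    fix j assume j: "j \<in> {1..m}"
    have jl: "1 \<le> j" "j \<le> m" "1 \<le> l" "l \<le> m" "2 * m \<le> N" using j l by (auto simp: m_def)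
    have 1: "int N dvd int j - int l \<longleftrightarrow> j = l"
    proof
      assume d: "int N dvd int j - int l"
      show "j = l"
      proof (rule ccontr)
        assume "j \<noteq> l"
        then have "int N \<le> \<bar>int j - int l\<bar>" using d by (intro zdvd_imp_le) auto
        then show False using jl by linarith
      qed
    qed simp
    have 2: "int N dvd - int j - int l \<longleftrightarrow> j = l \<and> 2 * l = N"
    proof
      assume "int N dvd - int j - int l"
      then have "int N dvd int j + int l" by (metis dvd_minus_iff minus_add_distrib uminus_add_conv_diff add.commute diff_conv_add_uminus)
      then have "int N \<le> int j + int l" using jl by (intro zdvd_imp_le) auto
      then show "j = l \<and> 2 * l = N" using jl by linarith
    next
      assume "j = l \<and> 2 * l = N"
      then have "- int j - int l = - int N" by auto
      then show "int N dvd - int j - int l" by simp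
    qed
    show "of_real (v j) * ((\<Sum>y<N. e ((int j - int l) * int y)) + (\<Sum>y<N. e ((- int j - int l) * int y)))
       = (if j = l then of_real (v l) * (of_nat N + (if 2 * l = N then of_nat N else 0)) else 0)"
      unfolding sum_e 1 2 by auto
  qed
  also have "\<dots> = of_real (v l) * (of_nat N + (if 2 * l = N then of_nat N else 0))"
    using l by (simp add: m_def)
  finally have "of_real (v l) * (of_nat N + (if 2 * l = N then of_nat N else 0)) = (0::complex)" by (simp add: c0)
  moreover have "of_nat N + (if 2 * l = N then of_nat N else 0) \<noteq> (0::complex)"
    using N0 by (auto simp flip: of_nat_add)
  ultimately show ?thesis by simp
qed

section \<open>Orders at the cusps\<close>

lemma of_rat_frac: "real_of_rat (frac q) = frac (real_of_rat q)"
proof -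
  have "frac (real_of_rat q) = real_of_rat (frac q)"
  proof (subst frac_unique_iff, intro conjI)
    have "real_of_rat q - real_of_rat (frac q) = of_int \<lfloor>q\<rfloor>"
      by (simp add: frac_def of_rat_diff)
    then show "real_of_rat q - real_of_rat (frac q) \<in> \<int>" by simp
    show "0 \<le> real_of_rat (frac q)" by simp
    have "real_of_rat (frac q) < real_of_rat 1" by (simp only: of_rat_less frac_lt_1)
    then show "real_of_rat (frac q) < 1" by simp
  qed
  then show ?thesis ..
qed

lemma of_rat_B2_frac: "real_of_rat (B2 (frac q)) = bern (real_of_rat q)"
  by (simp add: B2_def bern_def of_rat_add of_rat_diff of_rat_power of_rat_divide of_rat_frac)

text \<open>
  The order at the \<open>i\<close>-th representative of the product with \<open>a\<^sub>0 = 2k\<close> and exponents \<open>w\<close>,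
  extended to rational exponents.
\<close>

definition ordr :: "nat \<Rightarrow> (nat \<Rightarrow> int \<times> int) \<Rightarrow> rat \<Rightarrow> (nat \<Rightarrow> rat) \<Rightarrow> nat \<Rightarrow> rat" where
  "ordr N cs k w i = k / 12 * of_int (cusp_gcd N (cs i)) +
     (\<Sum>j=1..N div 2. w j * (of_int (cusp_gcd N (cs i)) / 2 *
        B2 (frac (of_nat j * of_int (fst (cs i)) / of_int (cusp_gcd N (cs i))))))"

lemma of_rat_ordr:
  "real_of_rat (ordr N cs k w i) = of_int (cusp_gcd N (cs i)) * (of_rat k / 12 +
     (\<Sum>j=1..N div 2. of_rat (w j) * (bern (real j * of_int (fst (cs i)) / of_int (cusp_gcd N (cs i))) / 2)))"
  unfolding ordr_def of_rat_add of_rat_sum of_rat_mult of_rat_divide of_rat_B2_frac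
  by (simp add: distrib_left sum_distrib_left mult_ac)

lemma cusp_gcd_pos: "N > 0 \<Longrightarrow> cusp_gcd N x > 0"
  by (simp add: cusp_gcd_def gcd_pos_int)

lemma bern_even_cong:
  assumes e: "e \<in> {1, -1}" "[a' = e * a] (mod g)" and g: "g > 0"
  shows "bern (real j * of_int a' / of_int g) = bern (real j * of_int a / of_int g)"
proof -
  have "[int j * a' = int j * (e * a)] (mod g)" using e(2) by (rule cong_scalar_left)
  then have "bern (of_int (int j * a') / of_int g) = bern (of_int (int j * (e * a)) / of_int g)"
    using g by (rule bern_cong)
  also have "\<dots> = bern (of_int (int j * a) / of_int g)"
    using e(1) bern_minus[of "of_int (int j * a) / of_int g"] by auto
  finally show ?thesis by simp
qed

definition weighted_totient_sum :: "nat \<Rightarrow> nat" where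
  "weighted_totient_sum N = (\<Sum>d | d dvd N. d * totient d * totient (N div d))"

text \<open>The valence formula, with each orbit weighted by its size: the Bernoulli part cancels
  for every j between 1 and m, since such j is not divisible by N, and only the eta part survives.
  Counting keys instead of cusps doubles the sum, which turns k/12 into k/24.\<close>

lemma sum_ordr:
  assumes N: "N \<ge> 5" and cs: "cusp_orbit_reps N cs"
  shows "(\<Sum>i\<le>N div 2. of_nat (orbit_size N cs i) * ordr N cs k w i) = k * of_nat (weighted_totient_sum N) / 24"
proof -
  have N0: "N > 0" using N by simp
  define F where "F = (\<lambda>g a::int. if g > 0 then of_int g * (real_of_rat k / 12 +
     (\<Sum>j=1..N div 2. of_rat (w j) * (bern (real j * of_int a / of_int g) / 2))) else 0)"
  have F: "F g a' = F g a" if "e \<in> {1, -1}" "[a' = e * a] (mod g)" for g a a' e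
    unfolding F_def using bern_even_cong[OF that] by simp
  have F1: "F g a' = F g a" if "[a' = a] (mod g)" for g a a'
    by (rule F[of 1]) (use that in auto)
  have Fo: "F (cusp_gcd N (cs i)) (fst (cs i)) = real_of_rat (ordr N cs k w i)" for i
    using cusp_gcd_pos[OF N0, of "cs i"] by (simp add: F_def of_rat_ordr)
  have "(\<Sum>(c, \<alpha>)\<in>cusp_keys N. F (gcd c (int N)) \<alpha>)
      = 2 * (\<Sum>i\<le>N div 2. real (orbit_size N cs i) * F (cusp_gcd N (cs i)) (fst (cs i)))"
    by (rule sum_over_cusps[OF N cs]) (rule F)
  then have "2 * (\<Sum>i\<le>N div 2. real (orbit_size N cs i) * real_of_rat (ordr N cs k w i))
      = (\<Sum>(c, \<alpha>)\<in>cusp_keys N. F (gcd c (int N)) \<alpha>)"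
    unfolding Fo by (rule sym)
  also have "\<dots> = (\<Sum>g | g dvd N. real (totient (N div g)) * (\<Sum>\<alpha>\<in>totatives g. F (int g) (int \<alpha>)))"
    using N0 F1 by (rule sum_cusp_keys)
  also have "\<dots> = (\<Sum>g | g dvd N. real (totient (N div g)) * (real g * real (totient g) * (of_rat k / 12)) +
      (\<Sum>j=1..N div 2. of_rat (w j) / 2 * (real (totient (N div g)) * (\<Sum>\<alpha>\<in>totatives g. real g * bern (real (j * \<alpha>) / real g)))))"
  proof (rule sum.cong[OF refl])
    fix g assume "g \<in> {g. g dvd N}"
    then have g0: "g > 0" using N0 by (auto intro!: Nat.gr0I)
    have "(\<Sum>\<alpha>\<in>totatives g. F (int g) (int \<alpha>)) = (\<Sum>\<alpha>\<in>totatives g. real g * (real_of_rat k / 12) +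
        (\<Sum>j=1..N div 2. of_rat (w j) / 2 * (real g * bern (real (j * \<alpha>) / real g))))"
      using g0 by (intro sum.cong refl) (simp add: F_def distrib_left sum_distrib_left mult_ac)
    also have "\<dots> = real g * real (totient g) * (of_rat k / 12) +
        (\<Sum>j=1..N div 2. of_rat (w j) / 2 * (\<Sum>\<alpha>\<in>totatives g. real g * bern (real (j * \<alpha>) / real g)))"
    proof -
      have "(\<Sum>\<alpha>\<in>totatives g. \<Sum>j=1..N div 2. of_rat (w j) / 2 * (real g * bern (real (j * \<alpha>) / real g)))
        = (\<Sum>j=1..N div 2. of_rat (w j) / 2 * (\<Sum>\<alpha>\<in>totatives g. real g * bern (real (j * \<alpha>) / real g)))"
        by (subst sum.swap) (simp only: sum_distrib_left)
      then show ?thesis by (simp add: sum.distrib totient_def)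
    qed
    finally have 1: "(\<Sum>\<alpha>\<in>totatives g. F (int g) (int \<alpha>)) = real g * real (totient g) * (of_rat k / 12) +
        (\<Sum>j=1..N div 2. of_rat (w j) / 2 * (\<Sum>\<alpha>\<in>totatives g. real g * bern (real (j * \<alpha>) / real g)))" .
    show "real (totient (N div g)) * (\<Sum>\<alpha>\<in>totatives g. F (int g) (int \<alpha>)) =
        real (totient (N div g)) * (real g * real (totient g) * (of_rat k / 12)) +
      (\<Sum>j=1..N div 2. of_rat (w j) / 2 * (real (totient (N div g)) * (\<Sum>\<alpha>\<in>totatives g. real g * bern (real (j * \<alpha>) / real g))))"
      unfolding 1 distrib_left sum_distrib_left by (simp only: mult_ac)
  qed
  also have "\<dots> = of_rat k / 12 * real (weighted_totient_sum N) +
      (\<Sum>j=1..N div 2. of_rat (w j) / 2 * (\<Sum>g | g dvd N. real (totient (N div g)) * (\<Sum>\<alpha>\<in>totatives g. real g * bern (real (j * \<alpha>) / real g))))"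
  proof -
    have "(\<Sum>g | g dvd N. \<Sum>j=1..N div 2. of_rat (w j) / 2 * (real (totient (N div g)) * (\<Sum>\<alpha>\<in>totatives g. real g * bern (real (j * \<alpha>) / real g))))
      = (\<Sum>j=1..N div 2. of_rat (w j) / 2 * (\<Sum>g | g dvd N. real (totient (N div g)) * (\<Sum>\<alpha>\<in>totatives g. real g * bern (real (j * \<alpha>) / real g))))"
      by (subst sum.swap) (simp only: sum_distrib_left)
    moreover have "(\<Sum>g | g dvd N. real (totient (N div g)) * (real g * real (totient g) * (of_rat k / 12))) = of_rat k / 12 * real (weighted_totient_sum N)"
      by (simp add: weighted_totient_sum_def sum_distrib_left mult_ac)
    ultimately show ?thesis by (simp only: sum.distrib)
  qed
  also have "\<dots> = of_rat k / 12 * real (weighted_totient_sum N)"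
  proof -
    have "(\<Sum>g | g dvd N. real (totient (N div g)) * (\<Sum>\<alpha>\<in>totatives g. real g * bern (real (j * \<alpha>) / real g))) = 0"
      if "j \<in> {1..N div 2}" for j
    proof (rule sum_bern_cusps_eq_0[OF N0])
      show "\<not> N dvd j" using that N by (auto dest: dvd_imp_le)
    qed
    then show ?thesis by simp
  qed
  finally have "real_of_rat (\<Sum>i\<le>N div 2. of_nat (orbit_size N cs i) * ordr N cs k w i) = real_of_rat (k * of_nat (weighted_totient_sum N) / 24)"
    by (simp add: of_rat_sum of_rat_mult of_rat_divide)
  then show ?thesis by (simp only: of_rat_eq_iff)
qed

text \<open>The weight k ranges over the integers, so that differences and negative multiples of
  exponent vectors are covered; weight 0 gives the lattice itself.\<close>

definition lattice_cond :: "nat \<Rightarrow> int \<Rightarrow> int vec \<Rightarrow> bool" where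
  "lattice_cond N k a \<longleftrightarrow> a \<in> carrier_vec (N div 2) \<and> 12 dvd k + coord_sum N a \<and> int (N * gcd 2 N) dvd coord_sum2 N a"

text \<open>Replacing the fractional part by the number itself costs -j a n + g n (n + 1) / 2, where
  n is the floor, and this is an integer.\<close>

lemma half_B2_frac:
  fixes a g :: int and j :: nat
  assumes g: "g > 0"
  shows "\<exists>z::int. of_int g / 2 * B2 (frac (of_nat j * of_int a / of_int g))
    = of_int ((int j)\<^sup>2) * ((of_int a)\<^sup>2 / (2 * of_int g)) - of_int (int j) * (of_int a / 2) + of_int g / 12 + of_int z"
proof -
  define n where "n = \<lfloor>of_nat j * of_int a / of_int g :: rat\<rfloor>"
  have "even (n * (n + 1))" by simp
  then obtain h where h: "n * (n + 1) = 2 * h" by (rule evenE)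
  have h': "of_int n * (of_int n + 1) = (2 * of_int h :: rat)"
    by (metis h of_int_1 of_int_add of_int_mult of_int_numeral)
  have "of_int g / 2 * B2 (frac (of_nat j * of_int a / of_int g))
    = of_int ((int j)\<^sup>2) * ((of_int a)\<^sup>2 / (2 * of_int g)) - of_int (int j) * (of_int a / 2) + of_int g / 12
       + (- of_nat j * of_int a * of_int n + of_int g * (of_int n * (of_int n + 1)) / 2)"
    unfolding B2_def frac_def n_def[symmetric] using g by (simp add: field_simps power2_eq_square)
  also have "- of_nat j * of_int a * of_int n + of_int g * (of_int n * (of_int n + 1)) / 2 = (of_int (- int j * a * n + g * h) :: rat)"
    unfolding h' by simp
  finally show ?thesis by blast
qed

text \<open>With T = \<open>coord_sum2 N a\<close> = g U and S = sum j a_j, the order is, modulo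
  integers, \<alpha> (\<alpha> U - S) / 2 + g (k + sum a_j) / 12. The second term is integral by
  divisibility by 12; the first because U and S are both even for even N and of equal parity for odd
  N.\<close>

lemma ordr_integral:
  assumes N: "N > 0" and a: "lattice_cond N k a"
  shows "\<exists>z. ordr N cs (of_int k) (\<lambda>j. of_int (a $ (j - 1))) i = of_int z"
proof -
  define g where "g = cusp_gcd N (cs i)"
  define \<alpha> where "\<alpha> = fst (cs i)"
  have g0: "g > 0" unfolding g_def by (rule cusp_gcd_pos[OF N])
  define S where "S = (\<Sum>j=1..N div 2. int j * a $ (j - 1))"
  define T where "T = coord_sum2 N a"
  have par: "even T = even S"
  proof -
    have "T - S = (\<Sum>j=1..N div 2. (int j * (int j - 1)) * a $ (j - 1))"
      by (simp add: T_def S_def coord_sum2_def flip: sum_subtractf) (simp add: algebra_simps power2_eq_square)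
    moreover have "even \<dots>" by (intro dvd_sum) auto
    ultimately have "even (T - S)" by simp
    then show ?thesis by auto
  qed
  obtain n where n: "k + coord_sum N a = 12 * n" using a by (auto simp: lattice_cond_def)
  obtain V where V: "T = int (N * gcd 2 N) * V" using a by (auto simp: lattice_cond_def T_def)
  obtain h where h: "int N = g * h" unfolding g_def cusp_gcd_def by (metis dvdE gcd_dvd2)
  define U where "U = h * int (gcd 2 N) * V"
  have TU: "T = g * U" unfolding V U_def of_nat_mult h by simp
  have "even (\<alpha> * (\<alpha> * U - S))"
  proof (cases "even N")
    case True
    then have gc: "gcd 2 N = 2" by (metis gcd_nat.absorb1)
    then have "even U" "even T" by (simp_all add: U_def V)
    then show ?thesis using par by simp
  next
    case False
    then have "odd g" using h by (metis even_of_nat even_mult_iff)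
    then have "even U = even S" using par by (simp add: TU)
    then show ?thesis by auto
  qed
  then obtain W where W: "\<alpha> * (\<alpha> * U - S) = 2 * W" by (rule evenE)
  have "\<exists>z. \<forall>j. of_int g / 2 * B2 (frac (of_nat j * of_int \<alpha> / of_int g))
    = of_int ((int j)\<^sup>2) * ((of_int \<alpha>)\<^sup>2 / (2 * of_int g)) - of_int (int j) * (of_int \<alpha> / 2) + of_int g / 12 + of_int (z j)"
    using half_B2_frac[OF g0, of _ \<alpha>] by (intro choice) blast
  then obtain z :: "nat \<Rightarrow> int" where z: "\<And>j. of_int g / 2 * B2 (frac (of_nat j * of_int \<alpha> / of_int g))
    = of_int ((int j)\<^sup>2) * ((of_int \<alpha>)\<^sup>2 / (2 * of_int g)) - of_int (int j) * (of_int \<alpha> / 2) + of_int g / 12 + of_int (z j)"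
    by blast
  have "ordr N cs (of_int k) (\<lambda>j. of_int (a $ (j - 1))) i
    = of_int k / 12 * of_int g + (\<Sum>j=1..N div 2. (of_int \<alpha>)\<^sup>2 / (2 * of_int g) * of_int ((int j)\<^sup>2 * a $ (j - 1))
       - of_int \<alpha> / 2 * of_int (int j * a $ (j - 1)) + of_int g / 12 * of_int (a $ (j - 1)) + of_int (z j * a $ (j - 1)))"
    unfolding ordr_def g_def[symmetric] \<alpha>_def[symmetric] z
    by (intro arg_cong2[where f = "(+)"] sum.cong refl) (simp add: algebra_simps)
  also have "\<dots> = of_int k / 12 * of_int g + ((of_int \<alpha>)\<^sup>2 / (2 * of_int g) * of_int T - of_int \<alpha> / 2 * of_int S
      + of_int g / 12 * of_int (coord_sum N a) + of_int (\<Sum>j=1..N div 2. z j * a $ (j - 1)))"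
    unfolding T_def S_def coord_sum_def coord_sum2_def of_int_sum by (simp only: sum.distrib sum_subtractf sum_distrib_left)
  also have "\<dots> = (of_int (\<alpha> * (\<alpha> * U - S)) / 2 :: rat) + of_int (k + coord_sum N a) * of_int g / 12 + of_int (\<Sum>j=1..N div 2. z j * a $ (j - 1))"
    unfolding TU using g0 by (simp add: field_simps power2_eq_square)
  also have "\<dots> = of_int (W + n * g + (\<Sum>j=1..N div 2. z j * a $ (j - 1)))"
    unfolding W n by simp
  finally show ?thesis by blast
qed

lemma L_iff_ordr:
  assumes N: "N \<ge> 5" and cs: "cusp_orbit_reps N cs"
  shows "a \<in> L N k \<longleftrightarrow> lattice_cond N (int k) a \<and>
    (\<forall>i\<le>N div 2. ordr N cs (of_nat k) (\<lambda>j. of_int (a $ (j - 1))) i \<ge> 0)"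
proof (cases "a \<in> carrier_vec (N div 2)")
  case True
  have N0: "N > 0" and N2: "N \<ge> 2" using N by auto
  have co: "cusp_order N k a (of_int p / of_int g) = cusp_order N k a (of_int p' / of_int g)"
    if "e \<in> {1, -1}" "[p = e * p'] (mod g)" "g > 0" for p p' g e
    using bern_even_cong[OF that] unfolding cusp_order_def bern_def[symmetric] by simp
  have ord: "ordr N cs (of_nat k) (\<lambda>j. of_int (a $ (j - 1))) i \<ge> 0 \<longleftrightarrow>
      cusp_order N k a (of_int (fst (cs i)) / of_int (cusp_gcd N (cs i))) \<ge> 0" for i
  proof -
    have "real_of_rat (ordr N cs (of_nat k) (\<lambda>j. of_int (a $ (j - 1))) i) =
       of_int (cusp_gcd N (cs i)) * cusp_order N k a (of_int (fst (cs i)) / of_int (cusp_gcd N (cs i)))"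
      unfolding of_rat_ordr cusp_order_def bern_def[symmetric] by simp
    then have "0 \<le> real_of_rat (ordr N cs (of_nat k) (\<lambda>j. of_int (a $ (j - 1))) i) \<longleftrightarrow>
      cusp_order N k a (of_int (fst (cs i)) / of_int (cusp_gcd N (cs i))) \<ge> 0"
      using cusp_gcd_pos[OF N0, of "cs i"] by (simp add: zero_le_mult_iff)
    then show ?thesis by simp
  qed
  have "(\<forall>p r. coprime p r \<longrightarrow> cusp_order N k a (of_int p / of_int (gcd r (int N))) \<ge> 0)
    \<longleftrightarrow> (\<forall>i\<le>N div 2. cusp_order N k a (of_int (fst (cs i)) / of_int (cusp_gcd N (cs i))) \<ge> 0)"
  proof (intro iffI allI impI)
    fix i assume "\<forall>p r. coprime p r \<longrightarrow> cusp_order N k a (of_int p / of_int (gcd r (int N))) \<ge> 0" "i \<le> N div 2"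
    then show "cusp_order N k a (of_int (fst (cs i)) / of_int (cusp_gcd N (cs i))) \<ge> 0"
      using cusp_reps_coprime[OF cs] unfolding cusp_gcd_def by blast
  next
    fix p r :: int
    assume A: "\<forall>i\<le>N div 2. cusp_order N k a (of_int (fst (cs i)) / of_int (cusp_gcd N (cs i))) \<ge> 0" and "coprime p r"
    then obtain i e where i: "i \<le> N div 2" "cusp_gcd N (cs i) = gcd r (int N)" "e \<in> {1,-1}" "[p = e * fst (cs i)] (mod gcd r (int N))"
      using cusp_rep_exists[OF N cs] by blast
    have "gcd r (int N) > 0" using N0 by (simp add: gcd_pos_int)
    then show "cusp_order N k a (of_int p / of_int (gcd r (int N))) \<ge> 0"
      using A i co[OF i(3,4)] by metis
  qed
  then show ?thesis unfolding L_iff[OF N2 True] ord lattice_cond_def using True by simp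
next
  case False
  then show ?thesis by (simp add: L_def lattice_cond_def)
qed

text \<open>In weight 0 the weighted orders add up to 0, so vanishing at the first m representatives
  entails vanishing at the last. Every x/N, in lowest terms p/g with g | N, is realized by the cusp
  [p/g]; hence the sums vanish at all x/N and \<open>bern_matrix_injective\<close> applies.\<close>

lemma ordr_injective:
  assumes N: "N \<ge> 5" and cs: "cusp_orbit_reps N cs"
    and w: "\<And>i. i < N div 2 \<Longrightarrow> ordr N cs 0 w i = 0" and l: "l \<in> {1..N div 2}"
  shows "w l = 0"
proof -
  have N0: "N > 0" using N by simp
  define m where "m = N div 2"
  have w': "ordr N cs 0 w i = 0" if i: "i \<le> m" for i
  proof (cases "i = m")
    case True
    have "{..m} = insert m {..<m}" by auto
    then have "of_nat (orbit_size N cs m) * ordr N cs 0 w m = (\<Sum>i\<le>m. of_nat (orbit_size N cs i) * ordr N cs 0 w i)"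
      using w by (simp add: m_def)
    also have "\<dots> = 0" using sum_ordr[OF N cs, of 0 w] by (simp add: m_def)
    finally show ?thesis using orbit_size_pos[OF N cs, of m] True by (simp add: m_def)
  next
    case False
    then show ?thesis using w i by (simp add: m_def)
  qed
  have "real_of_rat (w l) = 0"
  proof (rule bern_matrix_injective[of N "\<lambda>j. real_of_rat (w j)"])
    fix x :: int
    define h where "h = gcd x (int N)"
    obtain p where p: "x = h * p" by (metis h_def dvdE gcd_dvd1)
    obtain g where g: "int N = h * g" by (metis h_def dvdE gcd_dvd2)
    have h0: "h > 0" using N0 by (simp add: h_def gcd_pos_int)
    then have g0: "g > 0" using g N0 by (metis of_nat_0_less_iff zero_less_mult_pos)
    have "h * gcd p g = gcd (h * p) (h * g)" using h0 gcd_mult_distrib_int[of h p g] by simp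
    also have "\<dots> = h" by (simp only: p[symmetric] g[symmetric] h_def[symmetric])
    finally have cop: "coprime p g" using h0 by (simp add: coprime_iff_gcd_eq_1)
    have gN: "gcd g (int N) = g" using g0 g by (simp add: gcd_proj1_if_dvd_int)
    obtain i e where i: "i \<le> m" "cusp_gcd N (cs i) = g" "e \<in> {1,-1}" "[p = e * fst (cs i)] (mod g)"
      using cusp_rep_exists[OF N cs cop] unfolding gN m_def by blast
    have "0 = real_of_rat (ordr N cs 0 w i)" using w'[OF i(1)] by simp
    then have "(\<Sum>j=1..N div 2. of_rat (w j) * (bern (real j * of_int (fst (cs i)) / of_int g) / 2)) = 0"
      unfolding of_rat_ordr i(2) using g0 by simp
    then have "(\<Sum>j=1..N div 2. of_rat (w j) * (bern (real j * of_int p / of_int g) / 2)) = 0"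
      using bern_even_cong[OF i(3,4) g0] by simp
    then have "(\<Sum>j=1..N div 2. of_rat (w j) * bern (real j * of_int p / of_int g)) = 0"
      by (simp flip: sum_divide_distrib)
    moreover have "real j * of_int p / of_int g = real j * of_int x / real N" for j
    proof -
      have "real N = of_int h * of_int g" by (metis g of_int_mult of_int_of_nat_eq)
      then show ?thesis using h0 by (simp add: p)
    qed
    ultimately show "(\<Sum>j=1..N div 2. real_of_rat (w j) * bern (real j * of_int x / real N)) = 0" by simp
  qed (use N l in auto)
  then show ?thesis by simp
qed

section \<open>The Bernoulli matrix\<close>

lemma A_mat_carrier: "A_mat N cs \<in> carrier_mat (N div 2) (N div 2)"
  by (simp add: A_mat_def)

lemma ordr_A_mat:
  assumes i: "i < N div 2" and w: "w \<in> carrier_vec (N div 2)"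
  shows "ordr N cs k (\<lambda>j. w $ (j - 1)) i = k / 12 * of_int (cusp_gcd N (cs i)) + (A_mat N cs *\<^sub>v w) $ i"
proof -
  have "(A_mat N cs *\<^sub>v w) $ i = (\<Sum>j<N div 2. A_mat N cs $$ (i, j) * w $ j)"
    using i w A_mat_carrier[of N cs] by (simp add: scalar_prod_def atLeast0LessThan)
  also have "\<dots> = (\<Sum>j=1..N div 2. A_mat N cs $$ (i, j - 1) * w $ (j - 1))"
    by (rule sum.reindex_bij_witness[of _ "\<lambda>j. j - 1" Suc]) auto
  also have "\<dots> = (\<Sum>j=1..N div 2. w $ (j - 1) * (of_int (cusp_gcd N (cs i)) / 2 *
        B2 (frac (of_nat j * of_int (fst (cs i)) / of_int (cusp_gcd N (cs i))))))"
    using i by (intro sum.cong refl) (auto simp: A_mat_def Let_def)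
  finally show ?thesis by (simp add: ordr_def)
qed

lemma det_A_mat_nonzero:
  assumes N: "N \<ge> 5" and cs: "cusp_orbit_reps N cs"
  shows "det (A_mat N cs) \<noteq> 0"
proof
  assume "det (A_mat N cs) = 0"
  then obtain w where w: "w \<in> carrier_vec (N div 2)" "w \<noteq> 0\<^sub>v (N div 2)" "A_mat N cs *\<^sub>v w = 0\<^sub>v (N div 2)"
    using det_0_iff_vec_prod_zero_field[OF A_mat_carrier] by blast
  have "ordr N cs 0 (\<lambda>j. w $ (j - 1)) i = 0" if "i < N div 2" for i
    using that by (simp only: ordr_A_mat[OF that w(1)] w(3)) simp
  then have "w $ (l - 1) = 0" if "l \<in> {1..N div 2}" for l
    using ordr_injective[OF N cs, of "\<lambda>j. w $ (j - 1)"] that by blast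
  then have "w $ i = 0" if "i < N div 2" for i using that by (metis One_nat_def Suc_leI atLeastAtMost_iff diff_Suc_1 le_add1 plus_1_eq_Suc)
  then have "w = 0\<^sub>v (N div 2)" using w(1) by (intro eq_vecI) auto
  then show False using w(2) by simp
qed

section \<open>The lattice of exponents\<close>

lemma coord_sum_alt: "coord_sum N a = (\<Sum>i<N div 2. a $ i)"
  unfolding coord_sum_def by (rule sum.reindex_bij_witness[of _ Suc "\<lambda>j. j - 1"]) auto

lemma coord_sum2_alt: "coord_sum2 N a = (\<Sum>i<N div 2. (int (i + 1))\<^sup>2 * a $ i)"
  unfolding coord_sum2_def by (rule sum.reindex_bij_witness[of _ Suc "\<lambda>j. j - 1"]) auto

lemma lattice_cond_add:
  assumes "lattice_cond N k a" "lattice_cond N l b"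
  shows "lattice_cond N (k + l) (a + b)"
proof -
  have ab: "a \<in> carrier_vec (N div 2)" "b \<in> carrier_vec (N div 2)" using assms by (auto simp: lattice_cond_def)
  have "coord_sum N (a + b) = coord_sum N a + coord_sum N b" "coord_sum2 N (a + b) = coord_sum2 N a + coord_sum2 N b"
    using ab unfolding coord_sum_alt coord_sum2_alt by (simp_all add: sum.distrib distrib_left)
  moreover have "k + l + (coord_sum N a + coord_sum N b) = (k + coord_sum N a) + (l + coord_sum N b)" by simp
  ultimately show ?thesis using assms by (auto simp only: lattice_cond_def intro!: dvd_add add_carrier_vec)
qed

lemma lattice_cond_smult:
  assumes "lattice_cond N k a"
  shows "lattice_cond N (c * k) (c \<cdot>\<^sub>v a)"
proof -
  have a: "a \<in> carrier_vec (N div 2)" using assms by (auto simp: lattice_cond_def)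
  have "coord_sum N (c \<cdot>\<^sub>v a) = c * coord_sum N a" "coord_sum2 N (c \<cdot>\<^sub>v a) = c * coord_sum2 N a"
    using a unfolding coord_sum_alt coord_sum2_alt by (simp_all add: sum_distrib_left mult.left_commute)
  moreover have "c * k + c * coord_sum N a = c * (k + coord_sum N a)" by (simp add: distrib_left)
  ultimately show ?thesis using assms by (auto simp only: lattice_cond_def intro!: dvd_mult smult_carrier_vec[THEN iffD2])
qed

text \<open>The entries are added, not overwritten, so j may coincide with one of the first three
  positions; j = 1 with s = 0 serves as a placeholder. All columns thereby share one formula for
  their coordinate sums.\<close>

definition ivec :: "nat \<Rightarrow> int \<Rightarrow> int \<Rightarrow> int \<Rightarrow> int \<Rightarrow> nat \<Rightarrow> int vec" where
  "ivec m p q r s j = vec m (\<lambda>i. (if i = 0 then p else 0) + (if i = 1 then q else 0) +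
     (if i = 2 then r else 0) + (if i = j - 1 then s else 0))"

lemma ivec_coord_sums:
  assumes "N div 2 \<ge> 3" "1 \<le> j" "j \<le> N div 2"
  shows "coord_sum N (ivec (N div 2) p q r s j) = p + q + r + s"
    "coord_sum2 N (ivec (N div 2) p q r s j) = p + 4 * q + 9 * r + (int j)\<^sup>2 * s"
proof -
  have d: "(\<Sum>i<N div 2. f i * (if i = c then x else 0)) = f c * x" if "c < N div 2" for c x and f :: "nat \<Rightarrow> int"
  proof -
    have "(\<Sum>i<N div 2. f i * (if i = c then x else 0)) = (\<Sum>i<N div 2. if i = c then f i * x else 0)"
      by (intro sum.cong) auto
    then show ?thesis using that by simp
  qed
  have "coord_sum N (ivec (N div 2) p q r s j) = (\<Sum>i<N div 2. 1 * (if i = 0 then p else 0)) +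
      (\<Sum>i<N div 2. 1 * (if i = 1 then q else 0)) + (\<Sum>i<N div 2. 1 * (if i = 2 then r else 0)) +
      (\<Sum>i<N div 2. 1 * (if i = j - 1 then s else 0))"
    unfolding coord_sum_alt sum.distrib[symmetric] by (intro sum.cong refl) (simp add: ivec_def)
  also have "\<dots> = p + q + r + s" using assms by (subst d; simp)+
  finally show "coord_sum N (ivec (N div 2) p q r s j) = p + q + r + s" .
  have "coord_sum2 N (ivec (N div 2) p q r s j) = (\<Sum>i<N div 2. (int (i + 1))\<^sup>2 * (if i = 0 then p else 0)) +
      (\<Sum>i<N div 2. (int (i + 1))\<^sup>2 * (if i = 1 then q else 0)) + (\<Sum>i<N div 2. (int (i + 1))\<^sup>2 * (if i = 2 then r else 0)) +
      (\<Sum>i<N div 2. (int (i + 1))\<^sup>2 * (if i = j - 1 then s else 0))"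
    unfolding coord_sum2_alt sum.distrib[symmetric] distrib_left[symmetric] by (intro sum.cong refl) (simp add: ivec_def)
  also have "\<dots> = (int (0 + 1))\<^sup>2 * p + (int (1 + 1))\<^sup>2 * q + (int (2 + 1))\<^sup>2 * r + (int (j - 1 + 1))\<^sup>2 * s"
    using assms by (intro arg_cong2[where f = "(+)"] d) auto
  also have "\<dots> = p + 4 * q + 9 * r + (int j)\<^sup>2 * s" using assms by simp
  finally show "coord_sum2 N (ivec (N div 2) p q r s j) = p + 4 * q + 9 * r + (int j)\<^sup>2 * s" .
qed

lemma lattice_cond_ivec:
  assumes "N div 2 \<ge> 3" "1 \<le> j" "j \<le> N div 2" "12 dvd k + (p + q + r + s)"
    "int (N * gcd 2 N) dvd p + 4 * q + 9 * r + (int j)\<^sup>2 * s"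
  shows "lattice_cond N k (ivec (N div 2) p q r s j)"
  unfolding lattice_cond_def ivec_coord_sums[OF assms(1-3)] using assms(4,5) by (simp add: ivec_def)

text \<open>Here \<open>j\<^sub>1 = 3\<close>, since \<open>m \<ge> 3\<close> for \<open>N \<ge> 6\<close>.\<close>

definition Bcols :: "nat \<Rightarrow> int vec list" where
  "Bcols N = (let m = N div 2; M = int (N * gcd 2 N); r = 2 * M mod 3 in
     [ivec m 16 (- 4) 0 0 1, ivec m ((5 * r - M) div 3) ((M - 8 * r) div 3) r 0 1] @
     map (\<lambda>j. ivec m (((int j)\<^sup>2 - 4) div 3) (- (((int j)\<^sup>2 - 1) div 3)) 0 1 j) (filter (\<lambda>j. \<not> 3 dvd j) [4..<m + 1]) @
     [ivec m 5 (- 8) 3 0 1] @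
     map (\<lambda>j. ivec m (((int j)\<^sup>2 - 9) div 3) (- (((int j)\<^sup>2 - 9) div 3)) (- 1) 1 j) (filter (\<lambda>j. 3 dvd j) [4..<m + 1]))"

lemma int_square_mod_3:
  fixes j :: nat
  assumes "\<not> 3 dvd j"
  shows "(3 :: int) dvd (int j)\<^sup>2 - 1" "(3 :: int) dvd (int j)\<^sup>2 - 4"
proof -
  have "int j mod 3 = 1 \<or> int j mod 3 = 2" using assms by presburger
  then have "(int j)\<^sup>2 mod 3 = 1" by (auto simp: power2_eq_square mod_mult_eq[of "int j" 3 "int j", symmetric])
  then show "(3 :: int) dvd (int j)\<^sup>2 - 1" "(3 :: int) dvd (int j)\<^sup>2 - 4" by presburger+
qed

lemma of_int_div_3:
  assumes "(3 :: int) dvd x"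
  shows "rat_of_int (x div 3) = of_int x / 3"
  using assms by (auto elim!: dvdE)

text \<open>This is the reason for choosing r_N congruent to 2 M: modulo 3 the numerators become 10
  M - M and M - 16 M.\<close>

lemma mod_3_dvd:
  fixes M :: int
  shows "3 dvd 5 * (2 * M mod 3) - M" "3 dvd M - 8 * (2 * M mod 3)"
  by presburger+

lemma B_mat_eq_cols:
  assumes N: "N \<ge> 6"
  shows "B_mat N = mat_of_cols (N div 2) (map (map_vec of_int) (Bcols N))"
proof -
  define m where "m = N div 2"
  have m3: "m \<ge> 3" using N by (simp add: m_def)
  define M where "M = N * gcd 2 N"
  define r where "r = 2 * int M mod 3"
  have M3: "(3 :: int) dvd 5 * r - int M" "(3 :: int) dvd int M - 8 * r" unfolding r_def by (rule mod_3_dvd)+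
  have "int (2 * M mod 3) = r" unfolding r_def zmod_int by simp
  then have rr: "rat_of_nat (2 * M mod 3) = of_int r" by (metis of_int_of_nat_eq)
  have upt: "[3..<m + 1] = 3 # [4..<m + 1]" using m3 by (simp add: upt_conv_Cons numeral_eq_Suc)
  define js where "js = filter (\<lambda>j. 3 dvd j) [4..<m + 1]"
  have f1: "filter (\<lambda>j. 3 dvd j) [3..<m + 1] = 3 # js" and f2: "filter (\<lambda>j. \<not> 3 dvd j) [3..<m + 1] = filter (\<lambda>j. \<not> 3 dvd j) [4..<m + 1]"
    unfolding upt js_def by simp_all
  define e where "e = (\<lambda>j. unit_vec m (j - 1) :: rat vec)"
  define sq where "sq = (\<lambda>j. of_nat (j\<^sup>2) :: rat)"
  have sqi: "sq j = of_int ((int j)\<^sup>2)" for j by (simp add: sq_def)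
  have "B_mat N = mat_of_cols m (
     [16 \<cdot>\<^sub>v e 1 - 4 \<cdot>\<^sub>v e 2,
      ((- of_nat M + 5 * of_nat (2 * M mod 3)) / 3) \<cdot>\<^sub>v e 1 + ((of_nat M - 8 * of_nat (2 * M mod 3)) / 3) \<cdot>\<^sub>v e 2 + of_nat (2 * M mod 3) \<cdot>\<^sub>v e 3] @
     map (\<lambda>j. ((sq j - 4) / 3) \<cdot>\<^sub>v e 1 - ((sq j - 1) / 3) \<cdot>\<^sub>v e 2 + e j)
       (filter (\<lambda>j. \<not> 3 dvd j) [4..<m + 1]) @
     [(sq 3 - 4) \<cdot>\<^sub>v e 1 - (sq 3 - 1) \<cdot>\<^sub>v e 2 + 3 \<cdot>\<^sub>v e 3] @
     map (\<lambda>j. ((sq j - sq 3) / 3) \<cdot>\<^sub>v (e 1 - e 2) - e 3 + e j) js)"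
    using N f1 f2 unfolding B_mat_def Let_def m_def[symmetric] M_def[symmetric] e_def sq_def by simp
  also have "16 \<cdot>\<^sub>v e 1 - 4 \<cdot>\<^sub>v e 2 = map_vec of_int (ivec m 16 (- 4) 0 0 1)"
    using m3 by (intro eq_vecI) (auto simp: e_def ivec_def)
  also have "((- of_nat M + 5 * of_nat (2 * M mod 3)) / 3) \<cdot>\<^sub>v e 1 + ((of_nat M - 8 * of_nat (2 * M mod 3)) / 3) \<cdot>\<^sub>v e 2 + of_nat (2 * M mod 3) \<cdot>\<^sub>v e 3
     = map_vec of_int (ivec m ((5 * r - int M) div 3) ((int M - 8 * r) div 3) r 0 1)"
    unfolding rr using m3 of_int_div_3[OF M3(1)] of_int_div_3[OF M3(2)]
    by (intro eq_vecI) (auto simp: e_def ivec_def)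
  also have "(sq 3 - 4) \<cdot>\<^sub>v e 1 - (sq 3 - 1) \<cdot>\<^sub>v e 2 + 3 \<cdot>\<^sub>v e 3 = map_vec of_int (ivec m 5 (- 8) 3 0 1)"
    using m3 by (intro eq_vecI) (auto simp: e_def ivec_def sq_def)
  also have "map (\<lambda>j. ((sq j - 4) / 3) \<cdot>\<^sub>v e 1 - ((sq j - 1) / 3) \<cdot>\<^sub>v e 2 + e j) (filter (\<lambda>j. \<not> 3 dvd j) [4..<m + 1])
     = map (map_vec of_int \<circ> (\<lambda>j. ivec m (((int j)\<^sup>2 - 4) div 3) (- (((int j)\<^sup>2 - 1) div 3)) 0 1 j)) (filter (\<lambda>j. \<not> 3 dvd j) [4..<m + 1])"
  proof (rule map_cong[OF refl])
    fix j assume "j \<in> set (filter (\<lambda>j. \<not> 3 dvd j) [4..<m + 1])"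
    then have j: "\<not> 3 dvd j" "4 \<le> j" "j \<le> m" by auto
    note d = of_int_div_3[OF int_square_mod_3(1)[OF j(1)]] of_int_div_3[OF int_square_mod_3(2)[OF j(1)]]
    show "((sq j - 4) / 3) \<cdot>\<^sub>v e 1 - ((sq j - 1) / 3) \<cdot>\<^sub>v e 2 + e j =
      (map_vec of_int \<circ> (\<lambda>j. ivec m (((int j)\<^sup>2 - 4) div 3) (- (((int j)\<^sup>2 - 1) div 3)) 0 1 j)) j"
      unfolding o_def sqi using m3 j(2,3) d by (intro eq_vecI) (auto simp: e_def ivec_def)
  qed
  also have "map (\<lambda>j. ((sq j - sq 3) / 3) \<cdot>\<^sub>v (e 1 - e 2) - e 3 + e j) js
     = map (map_vec of_int \<circ> (\<lambda>j. ivec m (((int j)\<^sup>2 - 9) div 3) (- (((int j)\<^sup>2 - 9) div 3)) (- 1) 1 j)) js"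
  proof (rule map_cong[OF refl])
    fix j assume "j \<in> set js"
    then have j: "3 dvd j" "4 \<le> j" "j \<le> m" by (auto simp: js_def)
    have "(3::int) dvd (int j)\<^sup>2" using j(1) by (metis dvd_power int_dvd_int_iff of_nat_numeral dvd_trans zero_less_numeral pos2)
    then have "(3::int) dvd (int j)\<^sup>2 - 9" by simp
    note d = of_int_div_3[OF this]
    show "((sq j - sq 3) / 3) \<cdot>\<^sub>v (e 1 - e 2) - e 3 + e j =
      (map_vec of_int \<circ> (\<lambda>j. ivec m (((int j)\<^sup>2 - 9) div 3) (- (((int j)\<^sup>2 - 9) div 3)) (- 1) 1 j)) j"
      unfolding o_def sqi using m3 j(2,3) d by (intro eq_vecI) (auto simp: e_def ivec_def)
  qed
  finally show ?thesis
    unfolding Bcols_def Let_def m_def[symmetric] M_def[symmetric] r_def[symmetric] js_def[symmetric]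
    by (simp only: map_append list.map map_map)
qed

lemma Bcols_set:
  "set (Bcols N) = {ivec (N div 2) 16 (- 4) 0 0 1,
     ivec (N div 2) ((5 * (2 * int (N * gcd 2 N) mod 3) - int (N * gcd 2 N)) div 3)
       ((int (N * gcd 2 N) - 8 * (2 * int (N * gcd 2 N) mod 3)) div 3) (2 * int (N * gcd 2 N) mod 3) 0 1,
     ivec (N div 2) 5 (- 8) 3 0 1} \<union>
     (\<lambda>j. ivec (N div 2) (((int j)\<^sup>2 - 4) div 3) (- (((int j)\<^sup>2 - 1) div 3)) 0 1 j) ` {j. 4 \<le> j \<and> j \<le> N div 2 \<and> \<not> 3 dvd j} \<union>
     (\<lambda>j. ivec (N div 2) (((int j)\<^sup>2 - 9) div 3) (- (((int j)\<^sup>2 - 9) div 3)) (- 1) 1 j) ` {j. 4 \<le> j \<and> j \<le> N div 2 \<and> 3 dvd j}"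
proof -
  have "set (filter P [4..<N div 2 + 1]) = {j. 4 \<le> j \<and> j \<le> N div 2 \<and> P j}" for P by auto
  moreover have "set ([a, b] @ map f xs @ [c] @ map g ys) = {a, b, c} \<union> f ` set xs \<union> g ` set ys"
    for a b c :: "int vec" and f g and xs ys :: "nat list" by auto
  ultimately show ?thesis unfolding Bcols_def Let_def by (simp only:)
qed

lemma length_Bcols: "N \<ge> 6 \<Longrightarrow> length (Bcols N) = N div 2"
  using sum_length_filter_compl[of "\<lambda>j. 3 dvd j" "[4..<N div 2 + 1]"] unfolding Bcols_def Let_def
  by (simp del: upt_Suc)

text \<open>The first column has coordinate sum 12 and second moment 0, the second has sum 0 and
  second moment N gcd(2, N), and for all others both vanish.\<close>

lemma Bcols_lattice_cond:
  assumes N: "N \<ge> 6" and b: "b \<in> set (Bcols N)"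
  shows "lattice_cond N 0 b"
proof -
  have m3: "N div 2 \<ge> 3" using N by simp
  define M where "M = int (N * gcd 2 N)"
  define r where "r = 2 * M mod 3"
  have M3: "(3 :: int) dvd 5 * r - M" "(3 :: int) dvd M - 8 * r" unfolding r_def by (rule mod_3_dvd)+
  have c2: "lattice_cond N 0 (ivec (N div 2) ((5 * r - M) div 3) ((M - 8 * r) div 3) r 0 1)"
  proof -
    obtain x where x: "5 * r - M = 3 * x" using M3(1) by blast
    obtain y where y: "M - 8 * r = 3 * y" using M3(2) by blast
    have "x + y + r = 0" "x + 4 * y + 9 * r = M" using x y by linarith+
    then show ?thesis using m3 unfolding x y by (intro lattice_cond_ivec) (auto simp: M_def)
  qed
  have f: "lattice_cond N 0 (ivec (N div 2) (((int j)\<^sup>2 - 4) div 3) (- (((int j)\<^sup>2 - 1) div 3)) 0 1 j)"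
    if j: "4 \<le> j" "j \<le> N div 2" "\<not> 3 dvd j" for j
  proof -
    obtain x where x: "(int j)\<^sup>2 - 4 = 3 * x" using int_square_mod_3(2)[OF j(3)] by blast
    then have y: "(int j)\<^sup>2 - 1 = 3 * (x + 1)" by simp
    have "(int j)\<^sup>2 = 3 * x + 4" using x by simp
    then show ?thesis using m3 j unfolding x y by (intro lattice_cond_ivec) auto
  qed
  have g: "lattice_cond N 0 (ivec (N div 2) (((int j)\<^sup>2 - 9) div 3) (- (((int j)\<^sup>2 - 9) div 3)) (- 1) 1 j)"
    if j: "4 \<le> j" "j \<le> N div 2" "3 dvd j" for j
  proof -
    obtain k where "j = 3 * k" using j(3) by blast
    then have x: "(int j)\<^sup>2 - 9 = 3 * (3 * (int k)\<^sup>2 - 3)" by (simp add: power_mult_distrib)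
    then have "(int j)\<^sup>2 = 3 * (3 * (int k)\<^sup>2 - 3) + 9" by simp
    then show ?thesis using m3 j unfolding x by (intro lattice_cond_ivec) auto
  qed
  have c1: "lattice_cond N 0 (ivec (N div 2) 16 (- 4) 0 0 1)" "lattice_cond N 0 (ivec (N div 2) 5 (- 8) 3 0 1)"
    using m3 by (auto intro!: lattice_cond_ivec)
  show ?thesis using b c1 c2 f g unfolding Bcols_set M_def[symmetric] r_def[symmetric] by auto
qed

lemma B_mat_5: "B_mat 5 = mat_of_cols 2 (map (map_vec of_int) [vec_of_list [16, -4], vec_of_list [-5, 5]])"
  unfolding B_mat_def
  by (intro eq_matI) (auto simp: mat_of_rows_list_def mat_of_cols_def less_Suc_eq numeral_2_eq_2)

definition Bcolumns :: "nat \<Rightarrow> int vec list" where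
  "Bcolumns N = (if N = 5 then [vec_of_list [16, -4], vec_of_list [-5, 5]] else Bcols N)"

lemma B_mat_columns:
  assumes "N \<ge> 5"
  shows "B_mat N = mat_of_cols (N div 2) (map (map_vec of_int) (Bcolumns N))"
    "length (Bcolumns N) = N div 2" "\<And>b. b \<in> set (Bcolumns N) \<Longrightarrow> lattice_cond N 0 b"
proof -
  show "B_mat N = mat_of_cols (N div 2) (map (map_vec of_int) (Bcolumns N))"
    "length (Bcolumns N) = N div 2"
    using assms B_mat_eq_cols[of N] length_Bcols[of N] B_mat_5 by (auto simp: Bcolumns_def)
  have "lattice_cond 5 0 (vec_of_list [16, -4])" "lattice_cond 5 0 (vec_of_list [-5, 5])"
  proof -
    have d: "(5::nat) div 2 = Suc (Suc 0)" by simp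
    have "coprime (2::nat) 5" by simp
    then have g: "gcd (2::nat) 5 = 1" by (simp only: coprime_iff_gcd_eq_1)
    show "lattice_cond 5 0 (vec_of_list [16, -4])" "lattice_cond 5 0 (vec_of_list [-5, 5])"
      unfolding lattice_cond_def coord_sum_alt coord_sum2_alt d g by (auto intro!: carrier_vecI)
  qed
  then show "lattice_cond N 0 b" if "b \<in> set (Bcolumns N)" for b
    using that assms Bcols_lattice_cond[of N b] by (auto simp: Bcolumns_def split: if_splits)
qed

lemma B_mat_carrier:
  assumes "N \<ge> 5"
  shows "B_mat N \<in> carrier_mat (N div 2) (N div 2)"
  using B_mat_columns(1,2)[OF assms] by (metis length_map mat_of_cols_carrier(1))

lemma Bcolumns_carrier:
  assumes "N \<ge> 5" "b \<in> set (Bcolumns N)"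
  shows "b \<in> carrier_vec (N div 2)"
  using B_mat_columns(3)[OF assms] by (simp add: lattice_cond_def)

lemma B_mat_col:
  assumes N: "N \<ge> 5" and j: "j < N div 2"
  shows "col (B_mat N) j = map_vec of_int (Bcolumns N ! j)"
  using B_mat_columns(1,2)[OF N] j Bcolumns_carrier[OF N, of "Bcolumns N ! j"] by simp

lemma B_mat_image:
  assumes N: "N \<ge> 5" and x: "x \<in> carrier_vec (N div 2)"
  shows "\<exists>a. lattice_cond N 0 a \<and> B_mat N *\<^sub>v map_vec of_int x = map_vec of_int a"
proof -
  define m where "m = N div 2"
  define b where "b = (\<lambda>j. Bcolumns N ! j)"
  have b: "b j \<in> carrier_vec m" "lattice_cond N 0 (b j)" if "j < m" for j
    using B_mat_columns(2,3)[OF N] Bcolumns_carrier[OF N] that by (auto simp: b_def m_def)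
  define a where "a = vec m (\<lambda>i. \<Sum>j<m. x $ j * b j $ i)"
  have "B_mat N *\<^sub>v map_vec of_int x = map_vec of_int a"
  proof (rule eq_vecI)
    fix i assume "i < dim_vec (map_vec rat_of_int a)"
    then have i: "i < m" by (simp add: a_def)
    have Bij: "B_mat N $$ (i, j) = of_int (b j $ i)" if "j < m" for j
    proof -
      have "B_mat N $$ (i, j) = col (B_mat N) j $ i" using i that B_mat_carrier[OF N] by (simp add: m_def)
      then show ?thesis using B_mat_col[OF N, of j] b(1)[OF that] i that by (simp add: m_def b_def)
    qed
    have "(B_mat N *\<^sub>v map_vec of_int x) $ i = (\<Sum>j<m. B_mat N $$ (i, j) * of_int (x $ j))"
      using i x B_mat_carrier[OF N] by (simp add: scalar_prod_def atLeast0LessThan m_def)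
    also have "\<dots> = of_int (\<Sum>j<m. x $ j * b j $ i)"
      unfolding of_int_sum using Bij by (intro sum.cong refl) (simp add: mult.commute)
    finally show "(B_mat N *\<^sub>v map_vec of_int x) $ i = map_vec of_int a $ i" using i by (simp add: a_def)
  qed (use B_mat_carrier[OF N] in \<open>simp add: a_def m_def\<close>)
  moreover have "lattice_cond N 0 a"
  proof -
    have "coord_sum N a = (\<Sum>j<m. x $ j * coord_sum N (b j))"
      unfolding coord_sum_alt m_def[symmetric] a_def sum_distrib_left
      by (subst sum.swap) (auto intro!: sum.cong)
    moreover have "coord_sum2 N a = (\<Sum>j<m. x $ j * coord_sum2 N (b j))"
      unfolding coord_sum2_alt m_def[symmetric] a_def sum_distrib_left
      by (subst sum.swap) (auto intro!: sum.cong simp: sum_distrib_left mult_ac)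
    ultimately show ?thesis using b(2)
      unfolding lattice_cond_def by (auto intro!: dvd_sum simp: a_def m_def)
  qed
  ultimately show ?thesis by blast
qed

section \<open>The columns generate the exponent lattice\<close>

definition B_image :: "nat \<Rightarrow> int vec set" where
  "B_image N = {a \<in> carrier_vec (N div 2). \<exists>x\<in>carrier_vec (N div 2). B_mat N *\<^sub>v map_vec of_int x = map_vec of_int a}"

lemma B_image_add:
  assumes N: "N \<ge> 5" and "a \<in> B_image N" "b \<in> B_image N"
  shows "a + b \<in> B_image N"
proof -
  obtain x y where x: "x \<in> carrier_vec (N div 2)" "B_mat N *\<^sub>v map_vec of_int x = map_vec of_int a"
    and y: "y \<in> carrier_vec (N div 2)" "B_mat N *\<^sub>v map_vec of_int y = map_vec of_int b"
    using assms(2,3) unfolding B_image_def by blast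
  have ab: "a \<in> carrier_vec (N div 2)" "b \<in> carrier_vec (N div 2)" using assms by (auto simp: B_image_def)
  have "map_vec rat_of_int (x + y) = map_vec of_int x + map_vec of_int y" using x(1) y(1) by (intro eq_vecI) auto
  then have "B_mat N *\<^sub>v map_vec of_int (x + y) = map_vec of_int a + map_vec of_int b"
    using x y B_mat_carrier[OF N] by (simp add: mult_add_distrib_mat_vec)
  also have "\<dots> = map_vec of_int (a + b)" using ab by (intro eq_vecI) auto
  finally show ?thesis unfolding B_image_def using ab x(1) y(1) by (auto intro!: bexI[of _ "x + y"])
qed

lemma B_image_smult:
  assumes N: "N \<ge> 5" and "a \<in> B_image N"
  shows "c \<cdot>\<^sub>v a \<in> B_image N"
proof -
  obtain x where x: "x \<in> carrier_vec (N div 2)" "B_mat N *\<^sub>v map_vec of_int x = map_vec of_int a"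
    using assms(2) unfolding B_image_def by blast
  have a: "a \<in> carrier_vec (N div 2)" using assms by (auto simp: B_image_def)
  have "map_vec rat_of_int (c \<cdot>\<^sub>v x) = of_int c \<cdot>\<^sub>v map_vec of_int x" by (intro eq_vecI) auto
  then have "B_mat N *\<^sub>v map_vec of_int (c \<cdot>\<^sub>v x) = of_int c \<cdot>\<^sub>v map_vec of_int a"
    using x B_mat_carrier[OF N] by (simp add: mult_mat_vec)
  also have "\<dots> = map_vec of_int (c \<cdot>\<^sub>v a)" by (intro eq_vecI) auto
  finally show ?thesis unfolding B_image_def using a x(1) by (auto intro!: bexI[of _ "c \<cdot>\<^sub>v x"])
qed

lemma B_image_column:
  assumes N: "N \<ge> 5" and b: "b \<in> set (Bcolumns N)"
  shows "b \<in> B_image N"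
proof -
  obtain j where j: "j < N div 2" "b = Bcolumns N ! j"
    using b B_mat_columns(2)[OF N] by (metis in_set_conv_nth)
  have "map_vec rat_of_int (unit_vec (N div 2) j) = unit_vec (N div 2) j"
    using j by (intro eq_vecI) (auto simp: unit_vec_def)
  have "B_mat N *\<^sub>v map_vec of_int (unit_vec (N div 2) j) = map_vec of_int b"
  proof -
    have "B_mat N *\<^sub>v unit_vec (N div 2) j = col (B_mat N) j"
      using B_mat_carrier[OF N] j(1) by (intro eq_vecI) (auto simp: scalar_prod_right_unit)
    then show ?thesis using B_mat_col[OF N j(1)] \<open>map_vec rat_of_int (unit_vec (N div 2) j) = unit_vec (N div 2) j\<close>
      by (simp add: j(2))
  qed
  then show ?thesis unfolding B_image_def using Bcolumns_carrier[OF N b]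
    by (auto intro!: bexI[of _ "unit_vec (N div 2) j"])
qed

text \<open>Elimination from the last coordinate down: for each 0-based position n >= 3, some column
  has entry 1 there and 0 beyond. In the remaining three coordinates, multiples of the first two
  columns remove the coordinate sum and the second moment, and what is left is a multiple of (5, -8,
  3).\<close>

lemma B_image_lattice:
  assumes N: "N \<ge> 5" and a: "lattice_cond N 0 a"
  shows "a \<in> B_image N"
proof (cases "N = 5")
  case True
  have d: "(5::nat) div 2 = Suc (Suc 0)" by simp
  have "coprime (2::nat) 5" by simp
  then have g: "gcd (2::nat) 5 = 1" by (simp only: coprime_iff_gcd_eq_1)
  have ac: "a \<in> carrier_vec 2" using a True by (simp add: lattice_cond_def)
  have c: "12 dvd a $ 0 + a $ Suc 0" "5 dvd a $ 0 + 4 * a $ Suc 0"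
    using a unfolding lattice_cond_def True coord_sum_alt coord_sum2_alt d g by auto
  obtain u where u: "a $ 0 + a $ Suc 0 = 12 * u" using c(1) by blast
  \<comment> \<open>After \<open>u\<close> times the first column is subtracted, the second
    coordinate is \<open>a $ Suc 0 + 4 * u\<close>; its divisibility by 5 supplies the coefficient
    of the second column.\<close>
  have "5 dvd 3 * (a $ Suc 0 + 4 * u)"
  proof -
    have "3 * (a $ Suc 0 + 4 * u) = (a $ 0 + 4 * a $ Suc 0) - (a $ 0 + a $ Suc 0) + 12 * u" by simp
    also have "\<dots> = a $ 0 + 4 * a $ Suc 0" unfolding u by simp
    finally show ?thesis using c(2) by (simp only:)
  qed
  moreover have "5 dvd 3 * x \<Longrightarrow> 5 dvd x" for x :: int by presburger
  ultimately have "5 dvd a $ Suc 0 + 4 * u" by blast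
  then obtain y where y: "a $ Suc 0 + 4 * u = 5 * y" by blast
  have "a = u \<cdot>\<^sub>v vec_of_list [16, -4] + y \<cdot>\<^sub>v vec_of_list [-5, 5]"
  proof (rule eq_vecI)
    fix i assume "i < dim_vec (u \<cdot>\<^sub>v vec_of_list [16, -4] + y \<cdot>\<^sub>v vec_of_list [-5, 5 :: int])"
    then have "i = 0 \<or> i = Suc 0" by auto
    then show "a $ i = (u \<cdot>\<^sub>v vec_of_list [16, -4] + y \<cdot>\<^sub>v vec_of_list [-5, 5]) $ i"
      using u y by auto
  qed (use ac in auto)
  moreover have "vec_of_list [16, -4] \<in> B_image N" "vec_of_list [-5, 5] \<in> B_image N"
    by (rule B_image_column[OF N]; simp add: Bcolumns_def True)+
  ultimately show ?thesis using B_image_add[OF N] B_image_smult[OF N] by metis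
next
  case False
  then have N6: "N \<ge> 6" using N by simp
  define m where "m = N div 2"
  have m3: "m \<ge> 3" using N6 by (simp add: m_def)
  have col: "b \<in> B_image N" if "b \<in> set (Bcols N)" for b
    using B_image_column[OF N, of b] False that by (simp add: Bcolumns_def)
  have colL: "lattice_cond N 0 b" if "b \<in> set (Bcols N)" for b
    using Bcols_lattice_cond[OF N6 that] .
  define M where "M = int (N * gcd 2 N)"
  define r where "r = 2 * M mod 3"
  obtain x0 where x0: "5 * r - M = 3 * x0" using mod_3_dvd(1)[of M] unfolding r_def by blast
  obtain y0 where y0: "M - 8 * r = 3 * y0" using mod_3_dvd(2)[of M] unfolding r_def by blast
  have c1: "ivec m 16 (- 4) 0 0 1 \<in> B_image N" and c3: "ivec m 5 (- 8) 3 0 1 \<in> B_image N"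
    by (rule col; simp add: Bcols_set m_def)+
  have c2: "ivec m x0 y0 r 0 1 \<in> B_image N"
  proof -
    have "ivec m ((5 * r - M) div 3) ((M - 8 * r) div 3) r 0 1 \<in> B_image N"
      by (rule col, unfold Bcols_set, fold m_def M_def r_def) blast
    then show ?thesis by (simp add: x0 y0)
  qed
  have step: "\<exists>C. C \<in> B_image N \<and> lattice_cond N 0 C \<and> C $ n = 1 \<and> (\<forall>i<m. i > n \<longrightarrow> C $ i = 0)" if n: "3 \<le> n" "n < m" for n
  proof (cases "3 dvd n + 1")
    case True
    define C where "C = ivec m (((int (n + 1))\<^sup>2 - 9) div 3) (- (((int (n + 1))\<^sup>2 - 9) div 3)) (- 1) 1 (n + 1)"
    have "C \<in> set (Bcols N)" unfolding Bcols_set m_def[symmetric] C_def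
      by (rule UnI2, rule imageI) (use True n in auto)
    then show ?thesis using col colL n by (intro exI[of _ C]) (auto simp: C_def ivec_def)
  next
    case False
    define C where "C = ivec m (((int (n + 1))\<^sup>2 - 4) div 3) (- (((int (n + 1))\<^sup>2 - 1) div 3)) 0 1 (n + 1)"
    have "C \<in> set (Bcols N)" unfolding Bcols_set m_def[symmetric] C_def
      by (rule UnI1, rule UnI2, rule imageI) (use False n in auto)
    then show ?thesis using col colL n by (intro exI[of _ C]) (auto simp: C_def ivec_def)
  qed
  have "lattice_cond N 0 a \<Longrightarrow> \<forall>i<m. i \<ge> n \<longrightarrow> a $ i = 0 \<Longrightarrow> a \<in> B_image N" if "3 \<le> n" "n \<le> m" for n a
    using that
  proof (induction n arbitrary: a rule: nat_induct_at_least)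
    case base
    have ac: "a \<in> carrier_vec m" and s: "12 dvd coord_sum N a" "M dvd coord_sum2 N a"
      using base by (auto simp: lattice_cond_def m_def M_def)
    have z: "a $ i = 0" if "i < m" "i \<ge> 3" for i using base that by blast
    have split: "(\<Sum>i<m. f i) = f 0 + f 1 + f 2" if "\<And>i. i < m \<Longrightarrow> i \<ge> 3 \<Longrightarrow> f i = 0" for f :: "nat \<Rightarrow> int"
    proof -
      have "(\<Sum>i<m. f i) = (\<Sum>i<3. f i)" using m3 that by (intro sum.mono_neutral_right) auto
      then show ?thesis by (simp add: numeral_3_eq_3 numeral_2_eq_2)
    qed
    have "coord_sum N a = a $ 0 + a $ 1 + a $ 2"
      unfolding coord_sum_alt m_def[symmetric] by (rule split) (use z in auto)
    then obtain u where u: "a $ 0 + a $ 1 + a $ 2 = 12 * u" using s(1) by auto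
    have "coord_sum2 N a = (int (0 + 1))\<^sup>2 * a $ 0 + (int (1 + 1))\<^sup>2 * a $ 1 + (int (2 + 1))\<^sup>2 * a $ 2"
      unfolding coord_sum2_alt m_def[symmetric] by (rule split) (use z in auto)
    then obtain v where v: "a $ 0 + 4 * a $ 1 + 9 * a $ 2 = M * v" using s(2) by auto
    define b0 where "b0 = a $ 0 - 16 * u - v * x0"
    define b1 where "b1 = a $ 1 + 4 * u - v * y0"
    define b2 where "b2 = a $ 2 - v * r"
    have xyr: "x0 + y0 + r = 0" "x0 + 4 * y0 + 9 * r = M" using x0 y0 by linarith+
    have "b0 + b1 + b2 = (a $ 0 + a $ 1 + a $ 2) - 12 * u - v * (x0 + y0 + r)"
      by (simp add: b0_def b1_def b2_def algebra_simps)
    then have e1: "b0 + b1 + b2 = 0" unfolding u xyr by simp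
    have "b0 + 4 * b1 + 9 * b2 = (a $ 0 + 4 * a $ 1 + 9 * a $ 2) - v * (x0 + 4 * y0 + 9 * r)"
      by (simp add: b0_def b1_def b2_def algebra_simps)
    then have e2: "b0 + 4 * b1 + 9 * b2 = 0" unfolding v xyr by simp
    \<comment> \<open>The integer vectors orthogonal to (1, 1, 1) and (1, 4, 9) are the multiples of
      (5, -8, 3); since -8 + 3 * 3 = 1, this expression reads off the coefficient.\<close>
    define w where "w = b1 + 3 * b2"
    have "3 * w - b2 = (b0 + 4 * b1 + 9 * b2) - (b0 + b1 + b2)" by (simp add: w_def)
    then have w: "b2 = 3 * w" unfolding e1 e2 by simp
    then have w1: "b1 = - 8 * w" by (simp add: w_def)
    have "b0 = - b1 - b2" using e1 by (simp add: eq_neg_iff_add_eq_0 algebra_simps)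
    then have w': "b1 = - 8 * w" "b0 = 5 * w" using w w1 by simp_all
    have "a = u \<cdot>\<^sub>v ivec m 16 (- 4) 0 0 1 + v \<cdot>\<^sub>v ivec m x0 y0 r 0 1 + w \<cdot>\<^sub>v ivec m 5 (- 8) 3 0 1"
    proof (rule eq_vecI)
      fix i assume "i < dim_vec (u \<cdot>\<^sub>v ivec m 16 (- 4) 0 0 1 + v \<cdot>\<^sub>v ivec m x0 y0 r 0 1 + w \<cdot>\<^sub>v ivec m 5 (- 8) 3 0 1)"
      then have i: "i < m" by (simp add: ivec_def)
      then consider "i = 0" | "i = 1" | "i = 2" | "i \<ge> 3" by linarith
      then show "a $ i = (u \<cdot>\<^sub>v ivec m 16 (- 4) 0 0 1 + v \<cdot>\<^sub>v ivec m x0 y0 r 0 1 + w \<cdot>\<^sub>v ivec m 5 (- 8) 3 0 1) $ i"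
        using i w w' z[OF i] by cases (auto simp: ivec_def b0_def b1_def b2_def)
    qed (use ac in \<open>auto simp: ivec_def\<close>)
    then show ?case using c1 c2 c3 B_image_add[OF N] B_image_smult[OF N] by metis
  next
    case (Suc n)
    obtain C where C: "C \<in> B_image N" "lattice_cond N 0 C" "C $ n = 1" "\<And>i. i < m \<Longrightarrow> i > n \<Longrightarrow> C $ i = 0"
      using step[of n] Suc by auto
    have dims: "a \<in> carrier_vec m" "C \<in> carrier_vec m" using Suc.prems C(2) by (auto simp: lattice_cond_def m_def)
    define a' where "a' = a + (- (a $ n)) \<cdot>\<^sub>v C"
    have "lattice_cond N 0 a'" unfolding a'_def
      using lattice_cond_add[OF Suc.prems(1) lattice_cond_smult[OF C(2), of "- (a $ n)"]] by simp
    moreover have "\<forall>i<m. i \<ge> n \<longrightarrow> a' $ i = 0"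
    proof (intro allI impI)
      fix i assume i: "i < m" "n \<le> i"
      show "a' $ i = 0"
      proof (cases "i = n")
        case True
        then show ?thesis using i dims C(3) by (simp add: a'_def)
      next
        case False
        then show ?thesis using i dims C(4)[of i] Suc.prems(2) by (simp add: a'_def)
      qed
    qed
    ultimately have "a' \<in> B_image N" using Suc by auto
    then have "a' + (a $ n) \<cdot>\<^sub>v C \<in> B_image N" using B_image_add[OF N] B_image_smult[OF N] C(1) by blast
    moreover have "a' + (a $ n) \<cdot>\<^sub>v C = a" using dims by (intro eq_vecI) (auto simp: a'_def)
    ultimately show ?case by simp
  qed
  from this[of m a] show ?thesis using a m3 by auto
qed

text \<open>The multiple \<open>K\<close> of any unit vector satisfies both congruences, so it lies
  in the image of B_N; collecting the preimages gives a matrix X with B_N X equal to K times the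
  identity.\<close>

lemma det_B_mat_nonzero:
  assumes N: "N \<ge> 5"
  shows "det (B_mat N) \<noteq> 0"
proof -
  define m where "m = N div 2"
  define K where "K = 12 * int (N * gcd 2 N)"
  have K0: "K \<noteq> 0" using N by (simp add: K_def)
  have "\<exists>x\<in>carrier_vec m. B_mat N *\<^sub>v map_vec of_int x = map_vec of_int (K \<cdot>\<^sub>v unit_vec m i)" if "i < m" for i
  proof -
    have "lattice_cond N 0 (K \<cdot>\<^sub>v unit_vec m i)"
      unfolding lattice_cond_def coord_sum_alt coord_sum2_alt m_def[symmetric]
      by (auto simp: K_def intro!: dvd_sum)
    then show ?thesis using B_image_lattice[OF N] by (auto simp: B_image_def m_def)
  qed
  then obtain x where x: "\<And>i. i < m \<Longrightarrow> x i \<in> carrier_vec m"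
      "\<And>i. i < m \<Longrightarrow> B_mat N *\<^sub>v map_vec of_int (x i) = map_vec of_int (K \<cdot>\<^sub>v unit_vec m i)"
    by metis
  define X where "X = mat m m (\<lambda>(i, j). rat_of_int (x j $ i))"
  have X: "X \<in> carrier_mat m m" by (simp add: X_def)
  have B: "B_mat N \<in> carrier_mat m m" using B_mat_carrier[OF N] by (simp add: m_def)
  have "B_mat N * X = of_int K \<cdot>\<^sub>m 1\<^sub>m m"
  proof (rule eq_matI)
    fix i j assume "i < dim_row (of_int K \<cdot>\<^sub>m 1\<^sub>m m :: rat mat)" "j < dim_col (of_int K \<cdot>\<^sub>m 1\<^sub>m m :: rat mat)"
    then have ij: "i < m" "j < m" by auto
    have "col X j = map_vec of_int (x j)" using x(1)[OF ij(2)] ij(2) by (intro eq_vecI) (auto simp: X_def)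
    then have "(B_mat N * X) $$ (i, j) = (B_mat N *\<^sub>v map_vec of_int (x j)) $ i"
      using ij B X by simp
    also have "\<dots> = (of_int K \<cdot>\<^sub>m 1\<^sub>m m) $$ (i, j)" unfolding x(2)[OF ij(2)] using ij by (auto simp: unit_vec_def)
    finally show "(B_mat N * X) $$ (i, j) = (of_int K \<cdot>\<^sub>m 1\<^sub>m m) $$ (i, j)" .
  qed (use B X in auto)
  then have "det (B_mat N) * det X = of_int K ^ m"
    using det_mult[OF B X] by (simp add: det_smult)
  then show ?thesis using K0 by auto
qed

text \<open>The coordinates of a^(1) add up to -1, which cancels the weight 1; the second moment is
  5 for N = 5 and 0 otherwise.\<close>

lemma a1_vec_integral:
  assumes N: "N \<ge> 5"
  shows "\<exists>a. lattice_cond N 1 a \<and> a1_vec N = map_vec of_int a"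
proof (cases "N = 5")
  case True
  have d: "(5::nat) div 2 = Suc (Suc 0)" by simp
  have "coprime (2::nat) 5" by simp
  then have g: "gcd (2::nat) 5 = 1" by (simp only: coprime_iff_gcd_eq_1)
  have "lattice_cond 5 1 (vec_of_list [-3, 2])"
    unfolding lattice_cond_def coord_sum_alt coord_sum2_alt d g by (auto intro!: carrier_vecI)
  moreover have "a1_vec 5 = map_vec of_int (vec_of_list [-3, 2])"
    by (intro eq_vecI) (auto simp: a1_vec_def less_Suc_eq)
  ultimately show ?thesis using True by blast
next
  case False
  then have m3: "N div 2 \<ge> 3" using N by simp
  have "lattice_cond N 1 (ivec (N div 2) (- 3) 3 (- 1) 0 1)"
    using m3 by (intro lattice_cond_ivec) auto
  moreover have "a1_vec N = map_vec of_int (ivec (N div 2) (- 3) 3 (- 1) 0 1)"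
    using False by (intro eq_vecI) (auto simp: a1_vec_def ivec_def)
  ultimately show ?thesis by blast
qed

section \<open>Counting by characters of the class group\<close>

lemma invertible_mat_inverse:
  fixes P :: "'a :: comm_ring_1 mat"
  assumes P: "P \<in> carrier_mat m m" and inv: "invertible_mat P"
  obtains P' where "P' \<in> carrier_mat m m" "P * P' = 1\<^sub>m m" "P' * P = 1\<^sub>m m"
proof -
  obtain P' where P': "P * P' = 1\<^sub>m (dim_row P)" "P' * P = 1\<^sub>m (dim_row P')"
    using inv by (auto simp: invertible_mat_def inverts_mat_def)
  have "dim_col (P * P') = dim_col P'" "dim_col (P' * P) = dim_col P" by auto
  then have "dim_col P' = m" "dim_row P' = m" unfolding P' using P by auto
  then have "P' \<in> carrier_mat m m" by auto
  then show ?thesis using that P' P by auto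
qed

lemma sum_omega_powers:
  assumes d: "d > 0"
  shows "(\<Sum>j<d. omega d powi (int j * n)) = (if int d dvd n then of_nat d else 0)"
proof -
  have "omega d = ee (1 / of_nat d)" by (simp add: omega_def ee_def)
  then have "omega d powi (int j * n) = ee (of_int (n * int j) / of_nat d)" for j
    by (simp add: ee_powi mult.commute)
  then show ?thesis using sum_ee_residues[OF d, of n] by simp
qed

lemma character_sum:
  fixes d :: "nat \<Rightarrow> nat" and n :: "nat \<Rightarrow> int"
  assumes d: "\<And>i. i < m \<Longrightarrow> d i > 0"
  shows "(\<Sum>j \<in> (\<Pi>\<^sub>E i\<in>{..<m}. {..<d i}). \<Prod>i<m. omega (d i) powi (int (j i) * n i))
    = (if \<forall>i<m. int (d i) dvd n i then of_nat (\<Prod>i<m. d i) else 0)"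
proof -
  have "(\<Sum>j \<in> (\<Pi>\<^sub>E i\<in>{..<m}. {..<d i}). \<Prod>i<m. omega (d i) powi (int (j i) * n i))
    = (\<Prod>i<m. \<Sum>x<d i. omega (d i) powi (int x * n i))"
    by (subst prod_sum_PiE) auto
  also have "\<dots> = (\<Prod>i<m. if int (d i) dvd n i then of_nat (d i) else 0)"
    by (intro prod.cong refl) (simp add: sum_omega_powers d)
  also have "\<dots> = (if \<forall>i<m. int (d i) dvd n i then of_nat (\<Prod>i<m. d i) else 0)"
  proof (cases "\<forall>i<m. int (d i) dvd n i")
    case True
    then show ?thesis by (simp add: of_nat_prod)
  next
    case False
    then have "\<exists>i\<in>{..<m}. (if int (d i) dvd n i then of_nat (d i) else 0 :: complex) = 0" by auto
    then have "(\<Prod>i<m. if int (d i) dvd n i then of_nat (d i) else 0 :: complex) = 0"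
      by (subst prod_zero_iff) auto
    then show ?thesis using False by simp
  qed
  finally show ?thesis .
qed

locale cusp_smith =
  fixes N m :: nat and cs :: "nat \<Rightarrow> int \<times> int" and P Q :: "int mat" and d :: "nat \<Rightarrow> nat"
  assumes N: "N \<ge> 5" and m: "m = N div 2" and cs: "cusp_orbit_reps N cs"
    and snf: "smith_normal_form m (V_mat N cs) P Q d"
begin

abbreviation "\<mu> \<equiv> orbit_size N cs"

definition ratm :: "int mat \<Rightarrow> rat mat" where "ratm = map_mat of_int"
definition ratv :: "int vec \<Rightarrow> rat vec" where "ratv = map_vec of_int"

lemma ratm_carrier [simp]: "A \<in> carrier_mat m m \<Longrightarrow> ratm A \<in> carrier_mat m m"
  by (simp add: ratm_def)

lemma ratv_carrier [simp]: "v \<in> carrier_vec m \<Longrightarrow> ratv v \<in> carrier_vec m"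
  by (simp add: ratv_def)

lemma ratm_mult_vec: "A \<in> carrier_mat m m \<Longrightarrow> v \<in> carrier_vec m \<Longrightarrow> ratv (A *\<^sub>v v) = ratm A *\<^sub>v ratv v"
  unfolding ratm_def ratv_def by (rule of_int_hom.mult_mat_vec_hom)

lemma ratm_mult: "A \<in> carrier_mat m m \<Longrightarrow> B \<in> carrier_mat m m \<Longrightarrow> ratm (A * B) = ratm A * ratm B"
  unfolding ratm_def by (rule of_int_hom.mat_hom_mult)

lemma ratv_uminus: "ratv (- w) = - ratv w"
  unfolding ratv_def by (intro eq_vecI) auto

lemma ratm_one [simp]: "ratm (1\<^sub>m m) = 1\<^sub>m m"
  unfolding ratm_def by (intro eq_matI) auto

definition A where "A = A_mat N cs"
definition B where "B = B_mat N"
definition V where "V = V_mat N cs"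
definition D where "D = mat_diag m (\<lambda>i. rat_of_nat (d i))"

lemma mult_carrier [simp]: "X \<in> carrier_mat m m \<Longrightarrow> Y \<in> carrier_mat m m \<Longrightarrow> X * Y \<in> carrier_mat m m"
  by (rule mult_carrier_mat)

lemma mult_vec_carrier [simp]: "X \<in> carrier_mat m m \<Longrightarrow> v \<in> carrier_vec m \<Longrightarrow> X *\<^sub>v v \<in> carrier_vec m"
  by (rule mult_mat_vec_carrier)

lemma carriers [simp]: "A \<in> carrier_mat m m" "B \<in> carrier_mat m m" "V \<in> carrier_mat m m" "D \<in> carrier_mat m m"
    "P \<in> carrier_mat m m" "Q \<in> carrier_mat m m"
proof -
  show A: "A \<in> carrier_mat m m" using A_mat_carrier[of N cs] unfolding A_def m .
  show B: "B \<in> carrier_mat m m" using B_mat_carrier[OF N] unfolding B_def m .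
  show "V \<in> carrier_mat m m" unfolding V_def V_mat_def using A B unfolding A_def B_def by simp
  show "D \<in> carrier_mat m m" unfolding D_def by simp
  show "P \<in> carrier_mat m m" "Q \<in> carrier_mat m m" using snf unfolding smith_normal_form_def by blast+
qed

lemma V_eq: "V = A * B"
  by (simp add: V_def A_def B_def V_mat_def)

lemma PVQ: "ratm P * V * ratm Q = D"
  using snf by (simp add: smith_normal_form_def ratm_def V_def D_def)

definition Pinv where "Pinv = (SOME P'. P' \<in> carrier_mat m m \<and> P * P' = 1\<^sub>m m \<and> P' * P = 1\<^sub>m m)"
definition Qinv where "Qinv = (SOME Q'. Q' \<in> carrier_mat m m \<and> Q * Q' = 1\<^sub>m m \<and> Q' * Q = 1\<^sub>m m)"

lemma Pinv: "Pinv \<in> carrier_mat m m" "P * Pinv = 1\<^sub>m m" "Pinv * P = 1\<^sub>m m"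
proof -
  have "\<exists>P'. P' \<in> carrier_mat m m \<and> P * P' = 1\<^sub>m m \<and> P' * P = 1\<^sub>m m"
    using snf invertible_mat_inverse[of P m] by (auto simp: smith_normal_form_def)
  from someI_ex[OF this] show "Pinv \<in> carrier_mat m m" "P * Pinv = 1\<^sub>m m" "Pinv * P = 1\<^sub>m m" by (simp_all add: Pinv_def)
qed

lemma Qinv: "Qinv \<in> carrier_mat m m" "Q * Qinv = 1\<^sub>m m" "Qinv * Q = 1\<^sub>m m"
proof -
  have "\<exists>Q'. Q' \<in> carrier_mat m m \<and> Q * Q' = 1\<^sub>m m \<and> Q' * Q = 1\<^sub>m m"
    using snf invertible_mat_inverse[of Q m] by (auto simp: smith_normal_form_def)
  from someI_ex[OF this] show "Qinv \<in> carrier_mat m m" "Q * Qinv = 1\<^sub>m m" "Qinv * Q = 1\<^sub>m m" by (simp_all add: Qinv_def)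
qed

lemma ratm_Pinv: "ratm P * ratm Pinv = 1\<^sub>m m" "ratm Pinv * ratm P = 1\<^sub>m m"
  using Pinv by (simp_all flip: ratm_mult)

lemma ratm_Qinv: "ratm Q * ratm Qinv = 1\<^sub>m m" "ratm Qinv * ratm Q = 1\<^sub>m m"
  using Qinv by (simp_all flip: ratm_mult)

lemma PV: "ratm P * V = D * ratm Qinv"
proof -
  have "D * ratm Qinv = (ratm P * V * ratm Q) * ratm Qinv" by (simp only: PVQ)
  also have "\<dots> = (ratm P * V) * (ratm Q * ratm Qinv)"
    by (rule assoc_mult_mat[of _ m m _ m _ m]) (simp_all add: Qinv)
  finally show ?thesis by (simp add: ratm_Qinv right_mult_one_mat[of _ m m])
qed

lemma VQ: "V * ratm Q = ratm Pinv * D"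
proof -
  have "ratm Pinv * D = ratm Pinv * (ratm P * (V * ratm Q))"
    unfolding PVQ[symmetric] by (subst assoc_mult_mat[of _ m m _ m _ m]) simp_all
  also have "\<dots> = (ratm Pinv * ratm P) * (V * ratm Q)"
    by (rule assoc_mult_mat[of _ m m _ m _ m, symmetric]) (simp_all add: Pinv)
  finally show ?thesis by (simp add: ratm_Pinv left_mult_one_mat[of _ m m])
qed

lemma det_int_unit:
  fixes X Y :: "int mat"
  assumes "X \<in> carrier_mat m m" "Y \<in> carrier_mat m m" "X * Y = 1\<^sub>m m"
  shows "\<bar>rat_of_int (det X)\<bar> = 1"
proof -
  have "det X * det Y = 1" using det_mult[OF assms(1,2)] assms(3) by simp
  then have "\<bar>det X\<bar> = 1" by (metis abs_mult abs_zmult_eq_1 abs_one)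
  then show ?thesis by (metis of_int_1 of_int_abs)
qed

lemma abs_det_V: "\<bar>det V\<bar> = of_nat (\<Prod>i<m. d i)"
proof -
  have "det D = (\<Prod>i<m. of_nat (d i))"
    unfolding D_def by (subst det_upper_triangular[where n = m]) (auto simp: mat_diag_def upper_triangular_def prod_list_diag_prod atLeast0LessThan)
  moreover have "det D = det (ratm P) * det V * det (ratm Q)"
  proof -
    have "det (ratm P * V * ratm Q) = det (ratm P * V) * det (ratm Q)" by (rule det_mult[of _ m]) simp_all
    also have "det (ratm P * V) = det (ratm P) * det V" by (rule det_mult[of _ m]) simp_all
    finally show ?thesis by (simp only: PVQ)
  qed
  moreover have "det (ratm X) = of_int (det X)" for X unfolding ratm_def by simp
  ultimately have "(\<Prod>i<m. rat_of_nat (d i)) = of_int (det P) * det V * of_int (det Q)" by simp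
  from arg_cong[OF this, of abs] show ?thesis
    using det_int_unit[OF _ Pinv(1,2)] det_int_unit[OF _ Qinv(1,2)] by (simp add: abs_mult abs_prod of_nat_prod)
qed

lemma det_AB: "det A \<noteq> 0" "det V \<noteq> 0"
proof -
  show A: "det A \<noteq> 0" unfolding A_def by (rule det_A_mat_nonzero[OF N cs])
  have "det V = det A * det B" unfolding V_eq by (rule det_mult[of _ m]) simp_all
  then show "det V \<noteq> 0" using A det_B_mat_nonzero[OF N] by (simp add: B_def)
qed

lemma d_pos: "i < m \<Longrightarrow> d i > 0"
  using abs_det_V det_AB(2) by (metis abs_0_eq finite_lessThan gr0I lessThan_iff of_nat_0 prod_zero_iff)

lemma mu_pos: "i \<le> m \<Longrightarrow> \<mu> i > 0"
  using orbit_size_pos[OF N cs] by (simp add: m)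

section \<open>Orders in vector form and the degree\<close>

definition ord :: "nat \<Rightarrow> int vec \<Rightarrow> nat \<Rightarrow> rat" where
  "ord k a i = ordr N cs (of_nat k) (\<lambda>j. of_int (a $ (j - 1))) i"

text \<open>Exactness of the division by 24: the orders belonging to a^(1) in weight 1 are integers,
  and their weighted sum over the orbits is \<open>weighted_totient_sum N / 24\<close>.\<close>

lemma weighted_totient_sum_R: "weighted_totient_sum N = 24 * R N"
proof -
  obtain a where a: "lattice_cond N 1 a" using a1_vec_integral[OF N] by blast
  have "\<exists>z. \<forall>i. ord 1 a i = of_int (z i)"
    unfolding ord_def using ordr_integral[OF _ a] N by (intro choice) auto
  then obtain z where z: "\<And>i. ord 1 a i = of_int (z i)" by blast
  have "(\<Sum>i\<le>m. of_nat (\<mu> i) * ord 1 a i) = 1 * of_nat (weighted_totient_sum N) / 24"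
    unfolding ord_def m using sum_ordr[OF N cs] by simp
  then have "rat_of_int (int (weighted_totient_sum N)) = of_int (24 * (\<Sum>i\<le>m. int (\<mu> i) * z i))"
    by (simp add: z[simplified])
  then have "int (weighted_totient_sum N) = 24 * (\<Sum>i\<le>m. int (\<mu> i) * z i)" by (simp only: of_int_eq_iff)
  then have "24 dvd weighted_totient_sum N" by (metis dvd_triv_left int_dvd_int_iff of_nat_numeral)
  then show ?thesis by (simp add: R_def weighted_totient_sum_def)
qed

lemma sum_ord: "(\<Sum>i\<le>m. of_nat (\<mu> i) * ord k a i) = of_nat (R N * k)"
  unfolding ord_def m using sum_ordr[OF N cs, of "of_nat k"] weighted_totient_sum_R by simp

definition gv :: "rat vec" where "gv = vec m (\<lambda>r. of_int (cusp_gcd N (cs r)))"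
text \<open>The order vector of the weight 1 product with exponents a^(1), at the first m
  representatives. The vector \<alpha> of the characters is -P times it.\<close>

definition v1 :: "rat vec" where "v1 = (1 / 12) \<cdot>\<^sub>v gv + A *\<^sub>v a1_vec N"
definition al :: "int vec" where "al = alpha N cs P"

lemma gv_carrier [simp]: "gv \<in> carrier_vec m" by (simp add: gv_def)

lemma a1_carrier [simp]: "a1_vec N \<in> carrier_vec m"
  using a1_vec_integral[OF N] by (auto simp: lattice_cond_def m)

lemma v1_carrier [simp]: "v1 \<in> carrier_vec m"
  by (auto simp: v1_def intro!: add_carrier_vec mult_mat_vec_carrier[of _ m m])

lemma ord_vec:
  assumes "a \<in> carrier_vec m"
  shows "vec m (ord k a) = (of_nat k / 12) \<cdot>\<^sub>v gv + A *\<^sub>v ratv a"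
proof (rule eq_vecI)
  fix i assume "i < dim_vec ((of_nat k / 12) \<cdot>\<^sub>v gv + A *\<^sub>v ratv a)"
  then have i: "i < m" using carriers(1) by (auto simp del: carriers)
  have "ord k a i = ordr N cs (of_nat k) (\<lambda>j. ratv a $ (j - 1)) i"
    unfolding ord_def ordr_def using assms by (intro arg_cong2[where f = "(+)"] sum.cong refl) (auto simp: ratv_def m)
  also have "\<dots> = of_nat k / 12 * of_int (cusp_gcd N (cs i)) + (A *\<^sub>v ratv a) $ i"
    using ordr_A_mat[of i N "ratv a" cs] i assms ratv_carrier[OF assms] by (simp add: A_def m)
  finally show "vec m (ord k a) $ i = ((of_nat k / 12) \<cdot>\<^sub>v gv + A *\<^sub>v ratv a) $ i"
    using i carriers(1) by (auto simp: gv_def simp del: carriers)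
qed (use carriers(1) in \<open>auto simp del: carriers\<close>)

lemma ratv_inj: "ratv a = ratv b \<Longrightarrow> a = b"
  unfolding ratv_def by (metis of_int_hom.vec_hom_inj)

lemma v1_integral: "\<exists>z\<in>carrier_vec m. v1 = ratv z"
proof -
  obtain a where a: "lattice_cond N 1 a" "a1_vec N = map_vec of_int a" using a1_vec_integral[OF N] by blast
  have ac: "a \<in> carrier_vec m" using a by (simp add: lattice_cond_def m)
  have v: "v1 = vec m (ord 1 a)" unfolding ord_vec[OF ac] v1_def a(2) ratv_def by simp
  have "\<exists>z. \<forall>i. ord 1 a i = of_int (z i)"
    unfolding ord_def using ordr_integral[OF _ a(1)] N by (intro choice) auto
  then obtain z where z: "\<And>i. ord 1 a i = of_int (z i)" by blast
  have "v1 = ratv (vec m z)" unfolding v ratv_def by (intro eq_vecI) (auto simp: z[simplified])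
  then show ?thesis by (intro bexI[of _ "vec m z"]) auto
qed

lemma al: "al \<in> carrier_vec m" "ratv al = - (ratm P *\<^sub>v v1)"
proof -
  obtain z where z: "z \<in> carrier_vec m" "v1 = ratv z" using v1_integral by blast
  have e: "- (ratm P *\<^sub>v v1) = ratv (- (P *\<^sub>v z))"
    using ratm_mult_vec[OF carriers(5) z(1)] z(2) by (simp only: ratv_uminus)
  have "al = map_vec floor (- (ratm P *\<^sub>v v1))"
    unfolding al_def alpha_def v1_def gv_def ratm_def A_def m[symmetric] ..
  also have "\<dots> = - (P *\<^sub>v z)" unfolding e ratv_def by (intro eq_vecI) auto
  finally have al: "al = - (P *\<^sub>v z)" .
  show "al \<in> carrier_vec m" unfolding al using mult_vec_carrier[OF carriers(5) z(1)] by simp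
  show "ratv al = - (ratm P *\<^sub>v v1)" unfolding al e ..
qed

lemma ratv_index: "a \<in> carrier_vec m \<Longrightarrow> i < m \<Longrightarrow> ratv a $ i = of_int (a $ i)"
  by (auto simp: ratv_def)

lemma smult_add_index:
  "a \<in> carrier_vec m \<Longrightarrow> b \<in> carrier_vec m \<Longrightarrow> i < m \<Longrightarrow> (c \<cdot>\<^sub>v a + b) $ i = c * a $ i + b $ (i :: nat)"
  for a b :: "rat vec"
  by auto

lemma minus_smult_uminus_index:
  "a \<in> carrier_vec m \<Longrightarrow> b \<in> carrier_vec m \<Longrightarrow> i < m \<Longrightarrow> (a - c \<cdot>\<^sub>v (- b)) $ i = a $ i + c * b $ (i :: nat)"
  for a b :: "rat vec"
  by auto

lemma lattice_cond_param:
  assumes a: "lattice_cond N (int k) a"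
  shows "\<exists>x\<in>carrier_vec m. ratv a = of_nat k \<cdot>\<^sub>v a1_vec N + B *\<^sub>v ratv x"
proof -
  obtain b where b: "lattice_cond N 1 b" "a1_vec N = ratv b"
    using a1_vec_integral[OF N] unfolding ratv_def by blast
  have ac: "a \<in> carrier_vec m" and bc: "b \<in> carrier_vec m" using a b by (auto simp: lattice_cond_def m)
  define c where "c = a + (- int k) \<cdot>\<^sub>v b"
  have "lattice_cond N 0 c" unfolding c_def
    using lattice_cond_add[OF a lattice_cond_smult[OF b(1), of "- int k"]] by simp
  then obtain x where x: "x \<in> carrier_vec m" "B *\<^sub>v ratv x = ratv c"
    using B_image_lattice[OF N] by (auto simp: B_image_def B_def ratv_def m)
  have "ratv a = of_nat k \<cdot>\<^sub>v ratv b + ratv c"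
    unfolding c_def ratv_def using ac bc by (intro eq_vecI) auto
  then have "ratv a = of_nat k \<cdot>\<^sub>v a1_vec N + B *\<^sub>v ratv x" unfolding b(2) x(2) .
  then show ?thesis using x(1) by blast
qed

lemma lattice_cond_of_param:
  assumes x: "x \<in> carrier_vec m"
  shows "\<exists>a. lattice_cond N (int k) a \<and> ratv a = of_nat k \<cdot>\<^sub>v a1_vec N + B *\<^sub>v ratv x"
proof -
  obtain b where b: "lattice_cond N 1 b" "a1_vec N = ratv b"
    using a1_vec_integral[OF N] unfolding ratv_def by blast
  obtain c where c: "lattice_cond N 0 c" "B *\<^sub>v ratv x = ratv c"
    using B_mat_image[OF N, of x] x by (auto simp: B_def ratv_def m)
  have bc: "b \<in> carrier_vec m" "c \<in> carrier_vec m" using b c by (auto simp: lattice_cond_def m)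
  have "lattice_cond N (int k) (int k \<cdot>\<^sub>v b + c)"
    using lattice_cond_add[OF lattice_cond_smult[OF b(1), of "int k"] c(1)] by simp
  moreover have "ratv (int k \<cdot>\<^sub>v b + c) = of_nat k \<cdot>\<^sub>v a1_vec N + B *\<^sub>v ratv x"
    unfolding c(2) b(2) unfolding ratv_def using bc by (intro eq_vecI) auto
  ultimately show ?thesis by blast
qed

lemma ord_param:
  assumes a: "a \<in> carrier_vec m" and x: "x \<in> carrier_vec m"
    and ax: "ratv a = of_nat k \<cdot>\<^sub>v a1_vec N + B *\<^sub>v ratv x"
  shows "vec m (ord k a) = of_nat k \<cdot>\<^sub>v v1 + V *\<^sub>v ratv x"
proof -
  have "A *\<^sub>v ratv a = of_nat k \<cdot>\<^sub>v (A *\<^sub>v a1_vec N) + V *\<^sub>v ratv x"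
    unfolding ax V_eq using x
    by (simp add: mult_add_distrib_mat_vec[of _ m m] mult_mat_vec[of _ m m] assoc_mult_mat_vec[of _ m m _ m])
  moreover have "(of_nat k / 12) \<cdot>\<^sub>v gv + (of_nat k \<cdot>\<^sub>v (A *\<^sub>v a1_vec N) + V *\<^sub>v ratv x)
      = of_nat k \<cdot>\<^sub>v v1 + V *\<^sub>v ratv x"
  proof -
    have "(c / 12) \<cdot>\<^sub>v g + (c \<cdot>\<^sub>v p + r) = c \<cdot>\<^sub>v ((1 / 12) \<cdot>\<^sub>v g + p) + r"
      if "g \<in> carrier_vec m" "p \<in> carrier_vec m" "r \<in> carrier_vec m" for g p r :: "rat vec" and c
      using that by (intro eq_vecI) (auto simp: algebra_simps)
    from this[OF gv_carrier mult_vec_carrier[OF carriers(1) a1_carrier] mult_vec_carrier[OF carriers(3) ratv_carrier[OF x]]]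
    show ?thesis unfolding v1_def .
  qed
  ultimately show ?thesis unfolding ord_vec[OF a] by simp
qed

text \<open>Multiplication by P carries the lattice V Z^m to diag(d) Z^m, so membership in the coset
  of k v1 splits into m separate congruences; the vector \<open>al\<close> records the
  coset.\<close>

lemma coset_iff:
  assumes z: "z \<in> carrier_vec m"
  shows "(\<exists>x\<in>carrier_vec m. ratv z = of_nat k \<cdot>\<^sub>v v1 + V *\<^sub>v ratv x) \<longleftrightarrow>
    (\<forall>i<m. int (d i) dvd (P *\<^sub>v z) $ i + int k * al $ i)"
proof
  assume "\<exists>x\<in>carrier_vec m. ratv z = of_nat k \<cdot>\<^sub>v v1 + V *\<^sub>v ratv x"
  then obtain x where x: "x \<in> carrier_vec m" "ratv z = of_nat k \<cdot>\<^sub>v v1 + V *\<^sub>v ratv x" by blast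
  define y where "y = Qinv *\<^sub>v x"
  have y: "y \<in> carrier_vec m" using x Qinv by (simp add: y_def)
  have "ratv (P *\<^sub>v z) = ratm P *\<^sub>v (of_nat k \<cdot>\<^sub>v v1 + V *\<^sub>v ratv x)"
    using ratm_mult_vec[OF carriers(5) z] x(2) by simp
  also have "\<dots> = of_nat k \<cdot>\<^sub>v (ratm P *\<^sub>v v1) + (ratm P * V) *\<^sub>v ratv x"
    using x(1) by (simp add: mult_add_distrib_mat_vec[of _ m m] mult_mat_vec[of _ m m] assoc_mult_mat_vec[of _ m m _ m])
  also have "(ratm P * V) *\<^sub>v ratv x = D *\<^sub>v ratv y"
    unfolding PV y_def using x(1) Qinv(1) by (simp add: ratm_mult_vec assoc_mult_mat_vec[of _ m m _ m])
  finally have e: "ratv (P *\<^sub>v z) = of_nat k \<cdot>\<^sub>v (ratm P *\<^sub>v v1) + D *\<^sub>v ratv y" .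
  show "\<forall>i<m. int (d i) dvd (P *\<^sub>v z) $ i + int k * al $ i"
  proof (intro allI impI)
    fix i assume i: "i < m"
    have Pz: "P *\<^sub>v z \<in> carrier_vec m" using z by simp
    have "rat_of_int ((P *\<^sub>v z) $ i) = ratv (P *\<^sub>v z) $ i" using Pz i by (simp only: ratv_index)
    also have "\<dots> = of_nat k * (ratm P *\<^sub>v v1) $ i + (D *\<^sub>v ratv y) $ i"
      unfolding e by (rule smult_add_index) (use y i in simp_all)
    also have "(ratm P *\<^sub>v v1) $ i = - of_int (al $ i)"
    proof -
      have "ratm P *\<^sub>v v1 \<in> carrier_vec m" by simp
      then have "ratv al $ i = - ((ratm P *\<^sub>v v1) $ i)" unfolding al(2) using i by (metis carrier_vecD index_uminus_vec(1))
      moreover have "ratv al $ i = of_int (al $ i)" using al(1) i by (auto simp: ratv_def)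
      ultimately show ?thesis by simp
    qed
    also have "(D *\<^sub>v ratv y) $ i = of_nat (d i) * of_int (y $ i)"
      using i y by (auto simp: D_def mat_diag_def scalar_prod_def ratv_def if_distrib[of "\<lambda>x. x * _"] sum.delta cong: if_cong)
    finally have "rat_of_int ((P *\<^sub>v z) $ i + int k * al $ i) = of_int (int (d i) * y $ i)" by simp
    then have "(P *\<^sub>v z) $ i + int k * al $ i = int (d i) * y $ i" by (simp only: of_int_eq_iff)
    then show "int (d i) dvd (P *\<^sub>v z) $ i + int k * al $ i" by simp
  qed
next
  assume dv: "\<forall>i<m. int (d i) dvd (P *\<^sub>v z) $ i + int k * al $ i"
  define y where "y = vec m (\<lambda>i. ((P *\<^sub>v z) $ i + int k * al $ i) div int (d i))"
  have y: "y \<in> carrier_vec m" by (simp add: y_def)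
  define w where "w = ratv z - of_nat k \<cdot>\<^sub>v v1"
  have w: "w \<in> carrier_vec m" unfolding w_def using z by (intro minus_carrier_vec smult_carrier_vec[THEN iffD2]) auto
  have Pz: "P *\<^sub>v z \<in> carrier_vec m" using z by simp
  have "D *\<^sub>v ratv y = ratm P *\<^sub>v w"
  proof (rule eq_vecI)
    have "ratm P *\<^sub>v w = ratv (P *\<^sub>v z) - of_nat k \<cdot>\<^sub>v (ratm P *\<^sub>v v1)"
      unfolding w_def using z by (simp add: mult_minus_distrib_mat_vec[of _ m m] mult_mat_vec[of _ m m] ratm_mult_vec)
    also have "ratm P *\<^sub>v v1 = - ratv al" unfolding al(2) by simp
    finally have e: "ratm P *\<^sub>v w = ratv (P *\<^sub>v z) - of_nat k \<cdot>\<^sub>v (- ratv al)" .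
    have dims: "dim_vec (ratm P *\<^sub>v w) = m" by (rule carrier_vecD) (use w in simp)
    then show "dim_vec (D *\<^sub>v ratv y) = dim_vec (ratm P *\<^sub>v w)" by (simp add: D_def mat_diag_def)
    fix i assume "i < dim_vec (ratm P *\<^sub>v w)"
    then have i: "i < m" using dims by simp
    have "(D *\<^sub>v ratv y) $ i = of_nat (d i) * of_int (y $ i)"
      using i y by (auto simp: D_def mat_diag_def scalar_prod_def ratv_def if_distrib[of "\<lambda>x. x * _"] sum.delta cong: if_cong)
    also have "\<dots> = rat_of_int (int (d i) * y $ i)" by simp
    also have "int (d i) * y $ i = (P *\<^sub>v z) $ i + int k * al $ i" using dv i by (simp add: y_def)
    also have "rat_of_int ((P *\<^sub>v z) $ i + int k * al $ i) = (ratm P *\<^sub>v w) $ i"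
      unfolding e using minus_smult_uminus_index[OF ratv_carrier[OF Pz] ratv_carrier[OF al(1)] i]
      by (simp only: ratv_index[OF Pz i] ratv_index[OF al(1) i]) simp
    finally show "(D *\<^sub>v ratv y) $ i = (ratm P *\<^sub>v w) $ i" .
  qed
  then have "ratm Pinv *\<^sub>v (D *\<^sub>v ratv y) = ratm Pinv *\<^sub>v (ratm P *\<^sub>v w)" by simp
  then have "(ratm Pinv * D) *\<^sub>v ratv y = (ratm Pinv * ratm P) *\<^sub>v w"
    using y w Pinv(1) by (simp add: assoc_mult_mat_vec[of _ m m _ m])
  then have "(V * ratm Q) *\<^sub>v ratv y = w" unfolding VQ[symmetric] ratm_Pinv using w by simp
  then have "V *\<^sub>v ratv (Q *\<^sub>v y) = w" using y by (simp add: ratm_mult_vec assoc_mult_mat_vec[of _ m m _ m])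
  then have "ratv z = of_nat k \<cdot>\<^sub>v v1 + V *\<^sub>v ratv (Q *\<^sub>v y)"
    unfolding w_def using ratv_carrier[OF z] v1_carrier by (intro eq_vecI) (auto simp del: v1_carrier)
  then show "\<exists>x\<in>carrier_vec m. ratv z = of_nat k \<cdot>\<^sub>v v1 + V *\<^sub>v ratv x" using y by (intro bexI[of _ "Q *\<^sub>v y"]) auto
qed

section \<open>Effective divisors and their count\<close>

definition exponents :: "nat \<Rightarrow> (nat \<Rightarrow> nat) set" where
  "exponents n = {e \<in> {..m} \<rightarrow>\<^sub>E UNIV. (\<Sum>i\<le>m. \<mu> i * e i) = n}"

text \<open>Effective Galois-stable cuspidal divisors of degree k R_N in a fixed class. Only the
  first m multiplicities enter the congruences, since the degree determines the last one.\<close>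

definition admissible :: "nat \<Rightarrow> (nat \<Rightarrow> nat) set" where
  "admissible k = {e \<in> exponents (R N * k). \<forall>i<m. int (d i) dvd (P *\<^sub>v vec m (\<lambda>r. int (e r))) $ i + int k * al $ i}"

lemma exponents_bound:
  assumes "e \<in> exponents n" "i \<le> m"
  shows "e i \<le> n"
proof -
  have "e i \<le> \<mu> i * e i" using mu_pos[OF assms(2)] by simp
  also have "\<dots> \<le> (\<Sum>i\<le>m. \<mu> i * e i)" using assms(2) by (intro member_le_sum) auto
  finally show ?thesis using assms(1) by (simp add: exponents_def)
qed

lemma finite_exponents: "finite (exponents n)"
proof (rule finite_subset)
  show "exponents n \<subseteq> {..m} \<rightarrow>\<^sub>E {..n}"
  proof
    fix e assume e: "e \<in> exponents n"
    then have "e \<in> {..m} \<rightarrow>\<^sub>E UNIV" by (simp add: exponents_def)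
    then show "e \<in> {..m} \<rightarrow>\<^sub>E {..n}"
      using exponents_bound[OF e] by (intro PiE_I) (auto dest: PiE_arb)
  qed
qed (auto intro!: finite_PiE)

lemma ord_integral:
  assumes "lattice_cond N (int k) a"
  shows "\<exists>z. ord k a i = of_int z"
  using ordr_integral[OF _ assms, of cs i] N unfolding ord_def by simp

lemma L_iff_ord: "a \<in> L N k \<longleftrightarrow> lattice_cond N (int k) a \<and> (\<forall>i\<le>m. ord k a i \<ge> 0)"
  unfolding L_iff_ordr[OF N cs] ord_def m ..

text \<open>Restricted to \<open>{..m}\<close> so that the tuples are extensional, as in the index
  set of \<open>weighted_h\<close>. The floor is taken of integers only when a satisfies the lattice
  conditions.\<close>

definition orders :: "nat \<Rightarrow> int vec \<Rightarrow> nat \<Rightarrow> nat" where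
  "orders k a = restrict (\<lambda>i. nat \<lfloor>ord k a i\<rfloor>) {..m}"

lemma ord_orders:
  assumes "a \<in> L N k" "i \<le> m"
  shows "ord k a i = of_nat (orders k a i)"
proof -
  obtain z where z: "ord k a i = of_int z" using assms ord_integral[of k a i] by (auto simp: L_iff_ord)
  moreover have "ord k a i \<ge> 0" using assms by (simp add: L_iff_ord)
  ultimately have "z \<ge> 0" by simp
  then show ?thesis using assms(2) by (simp add: orders_def z)
qed

text \<open>Injectivity is the invertibility of A_N. For surjectivity, the congruences place the
  first m multiplicities in the coset of k v1, so some exponent vector has them as its orders; the
  degree relation settles the last one.\<close>

lemma bij_orders: "bij_betw (orders k) (L N k) (admissible k)"
proof (rule bij_betw_imageI)
  show "inj_on (orders k) (L N k)"
  proof (rule inj_onI)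
    fix a b assume ab: "a \<in> L N k" "b \<in> L N k" "orders k a = orders k b"
    have c: "a \<in> carrier_vec m" "b \<in> carrier_vec m" using ab by (auto simp: L_def m)
    have "vec m (ord k a) = vec m (ord k b)"
      using ab ord_orders by (intro eq_vecI) auto
    then have e: "(of_nat k / 12) \<cdot>\<^sub>v gv + A *\<^sub>v ratv a = (of_nat k / 12) \<cdot>\<^sub>v gv + A *\<^sub>v ratv b"
      unfolding ord_vec[OF c(1)] ord_vec[OF c(2)] .
    have Ac: "A *\<^sub>v ratv a \<in> carrier_vec m" "A *\<^sub>v ratv b \<in> carrier_vec m" using c by simp_all
    have "A *\<^sub>v ratv a = A *\<^sub>v ratv b"
    proof (rule eq_vecI)
      fix i assume "i < dim_vec (A *\<^sub>v ratv b)"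
      then have i: "i < m" unfolding carrier_vecD[OF Ac(2)] .
      from arg_cong[OF e, of "\<lambda>v. v $ i"] show "(A *\<^sub>v ratv a) $ i = (A *\<^sub>v ratv b) $ i"
        unfolding smult_add_index[OF gv_carrier Ac(1) i] smult_add_index[OF gv_carrier Ac(2) i] by (rule add_left_imp_eq)
    qed (simp only: carrier_vecD[OF Ac(1)] carrier_vecD[OF Ac(2)])
    then have "A *\<^sub>v (ratv a - ratv b) = 0\<^sub>v m"
      using c Ac by (simp add: mult_minus_distrib_mat_vec[of _ m m])
    then have "ratv a - ratv b = 0\<^sub>v m"
      using det_0_iff_vec_prod_zero_field[OF carriers(1)] det_AB(1) c by (metis minus_carrier_vec ratv_carrier)
    then have "ratv a = ratv b"
      using ratv_carrier[OF c(1)] ratv_carrier[OF c(2)] by (metis eq_vecI carrier_vecD index_minus_vec(1) index_zero_vec(1) right_minus_eq)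
    then show "a = b" by (rule ratv_inj)
  qed
next
  show "orders k ` L N k = admissible k"
  proof (intro equalityI subsetI)
    fix e assume "e \<in> orders k ` L N k"
    then obtain a where a: "a \<in> L N k" "e = orders k a" by blast
    have lc: "lattice_cond N (int k) a" and c: "a \<in> carrier_vec m" using a(1) by (auto simp: L_iff_ord lattice_cond_def m)
    obtain x where x: "x \<in> carrier_vec m" "ratv a = of_nat k \<cdot>\<^sub>v a1_vec N + B *\<^sub>v ratv x"
      using lattice_cond_param[OF lc] by blast
    define z where "z = vec m (\<lambda>r. int (e r))"
    have z: "z \<in> carrier_vec m" by (simp add: z_def)
    have "ratv z = vec m (ord k a)" unfolding ratv_def z_def using ord_orders[OF a(1)] a(2) by (intro eq_vecI) auto
    then have "ratv z = of_nat k \<cdot>\<^sub>v v1 + V *\<^sub>v ratv x" using ord_param[OF c x] by simp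
    then have dv: "\<forall>i<m. int (d i) dvd (P *\<^sub>v z) $ i + int k * al $ i" using coset_iff[OF z] x(1) by blast
    have "rat_of_nat (\<Sum>i\<le>m. \<mu> i * e i) = (\<Sum>i\<le>m. of_nat (\<mu> i) * ord k a i)"
      using ord_orders[OF a(1)] a(2) by simp
    also have "\<dots> = rat_of_nat (R N * k)" by (rule sum_ord)
    finally have "(\<Sum>i\<le>m. \<mu> i * e i) = R N * k" by (simp only: of_nat_eq_iff)
    then have "e \<in> exponents (R N * k)" using a(2) by (auto simp: exponents_def orders_def)
    then show "e \<in> admissible k" using dv by (simp add: admissible_def z_def)
  next
    fix e assume e: "e \<in> admissible k"
    define z where "z = vec m (\<lambda>r. int (e r))"
    have z: "z \<in> carrier_vec m" by (simp add: z_def)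
    have "\<forall>i<m. int (d i) dvd (P *\<^sub>v z) $ i + int k * al $ i" using e by (simp add: admissible_def z_def)
    then obtain x where x: "x \<in> carrier_vec m" "ratv z = of_nat k \<cdot>\<^sub>v v1 + V *\<^sub>v ratv x"
      using coset_iff[OF z] by blast
    obtain a where a: "lattice_cond N (int k) a" "ratv a = of_nat k \<cdot>\<^sub>v a1_vec N + B *\<^sub>v ratv x"
      using lattice_cond_of_param[OF x(1)] by blast
    have c: "a \<in> carrier_vec m" using a by (simp add: lattice_cond_def m)
    have oz: "vec m (ord k a) = ratv z" using ord_param[OF c x(1) a(2)] x(2) by simp
    have o1: "ord k a i = of_nat (e i)" if "i < m" for i
      using arg_cong[OF oz, of "\<lambda>v. v $ i"] that by (simp add: ratv_def z_def)
    have ex: "e \<in> exponents (R N * k)" using e by (simp add: admissible_def)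
    \<comment> \<open>Both tuples have the same weighted sum and agree below m, and the last orbit
      size is positive.\<close>
    have om: "ord k a m = of_nat (e m)"
    proof -
      have s: "{..m} = insert m {..<m}" by auto
      have "of_nat (\<mu> m) * ord k a m + (\<Sum>i<m. of_nat (\<mu> i) * ord k a i) = rat_of_nat (R N * k)"
        using sum_ord[of k a] unfolding s by simp
      moreover have "rat_of_nat (R N * k) = of_nat (\<mu> m) * of_nat (e m) + (\<Sum>i<m. of_nat (\<mu> i) * of_nat (e i))"
      proof -
        have "R N * k = (\<Sum>i\<le>m. \<mu> i * e i)" using ex by (simp add: exponents_def)
        then show ?thesis unfolding s by simp
      qed
      ultimately have "of_nat (\<mu> m) * ord k a m = of_nat (\<mu> m) * of_nat (e m)" using o1 by simp
      then show ?thesis using mu_pos[of m] by simp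
    qed
    have oe: "ord k a i = of_nat (e i)" if "i \<le> m" for i using o1 om that by (cases "i = m") auto
    then have aL: "a \<in> L N k" using a(1) by (simp add: L_iff_ord)
    have "orders k a = e"
    proof (rule ext)
      fix i
      show "orders k a i = e i"
        using oe[of i] ex by (auto simp: orders_def exponents_def PiE_def extensional_def)
    qed
    then show "e \<in> orders k ` L N k" using aL by blast
  qed
qed

text \<open>Collecting the powers of each \<open>omega (d i)\<close> leaves one character evaluated
  at P e + k \<alpha>; its sum over j then detects admissibility of e.\<close>

lemma xi_chi_term:
  "xi N cs P d j ^ k * (\<Prod>i\<le>m. chi N P d i j ^ e i)
    = (\<Prod>i<m. omega (d i) powi (int (j i) * ((P *\<^sub>v vec m (\<lambda>r. int (e r))) $ i + int k * al $ i)))"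
proof -
  have om: "omega n \<noteq> 0" for n by (simp add: omega_def)
  have "{..m} = insert m {..<m}" by auto
  then have "(\<Prod>i\<le>m. chi N P d i j ^ e i) = (\<Prod>r<m. chi N P d r j ^ e r)"
    by (simp add: chi_def m)
  also have "\<dots> = (\<Prod>r<m. \<Prod>i<m. omega (d i) powi (int (j i) * P $$ (i, r) * int (e r)))"
    by (intro prod.cong refl) (simp add: chi_def m prod_power_distrib power_int_power')
  also have "\<dots> = (\<Prod>i<m. \<Prod>r<m. omega (d i) powi (int (j i) * P $$ (i, r) * int (e r)))"
    by (rule prod.swap)
  also have "\<dots> = (\<Prod>i<m. omega (d i) powi (int (j i) * (P *\<^sub>v vec m (\<lambda>r. int (e r))) $ i))"
  proof (rule prod.cong[OF refl])
    fix i assume "i \<in> {..<m}"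
    then have i: "i < m" by simp
    have "(\<Prod>r\<in>I. omega (d i) powi f r) = omega (d i) powi (\<Sum>r\<in>I. f r)" for I and f :: "nat \<Rightarrow> int"
      using om by (induction I rule: infinite_finite_induct) (auto simp: power_int_add)
    moreover have "(P *\<^sub>v vec m (\<lambda>r. int (e r))) $ i = (\<Sum>r<m. P $$ (i, r) * int (e r))"
      using i carriers(5) by (auto simp: scalar_prod_def atLeast0LessThan simp del: carriers)
    ultimately show "(\<Prod>r<m. omega (d i) powi (int (j i) * P $$ (i, r) * int (e r))) = omega (d i) powi (int (j i) * (P *\<^sub>v vec m (\<lambda>r. int (e r))) $ i)"
      by (simp add: sum_distrib_left mult.assoc)
  qed
  finally have 1: "(\<Prod>i\<le>m. chi N P d i j ^ e i) = (\<Prod>i<m. omega (d i) powi (int (j i) * (P *\<^sub>v vec m (\<lambda>r. int (e r))) $ i))" .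
  have 2: "xi N cs P d j ^ k = (\<Prod>i<m. omega (d i) powi (int (j i) * (int k * al $ i)))"
    by (simp add: xi_def m prod_power_distrib power_int_power' al_def mult_ac)
  show ?thesis unfolding 1 2 prod.distrib[symmetric]
    by (intro prod.cong refl) (simp add: om power_int_add[symmetric] algebra_simps)
qed

text \<open>Orthogonality of the characters of the product of the groups Z/d_i, whose order is |det
  V|.\<close>

theorem card_L:
  "of_nat (card (L N k)) = 1 / of_rat \<bar>det V\<bar> *
    (\<Sum>j \<in> (\<Pi>\<^sub>E i\<in>{..<m}. {..<d i}). xi N cs P d j ^ k * weighted_h m \<mu> (R N * k) (\<lambda>i. chi N P d i j))"
proof -
  define n where "n = (\<lambda>e i. (P *\<^sub>v vec m (\<lambda>r. int (e r))) $ i + int k * al $ i)"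
  define W where "W = exponents (R N * k)"
  define dd where "dd = (\<Prod>i<m. d i)"
  have dd0: "dd \<noteq> 0" using d_pos by (auto simp: dd_def)
  have "(\<Sum>j \<in> (\<Pi>\<^sub>E i\<in>{..<m}. {..<d i}). xi N cs P d j ^ k * weighted_h m \<mu> (R N * k) (\<lambda>i. chi N P d i j))
    = (\<Sum>j \<in> (\<Pi>\<^sub>E i\<in>{..<m}. {..<d i}). \<Sum>e\<in>W. \<Prod>i<m. omega (d i) powi (int (j i) * n e i))"
    unfolding weighted_h_def W_def exponents_def n_def sum_distrib_left xi_chi_term ..
  also have "\<dots> = (\<Sum>e\<in>W. if \<forall>i<m. int (d i) dvd n e i then of_nat dd else 0)"
    unfolding dd_def by (subst sum.swap, subst character_sum[OF d_pos]) auto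
  also have "\<dots> = of_nat dd * of_nat (card {e \<in> W. \<forall>i<m. int (d i) dvd n e i})"
    using finite_exponents by (simp add: sum.If_cases W_def Int_def)
  also have "{e \<in> W. \<forall>i<m. int (d i) dvd n e i} = admissible k"
    by (simp add: admissible_def W_def n_def)
  also have "card (admissible k) = card (L N k)" using bij_betw_same_card[OF bij_orders] by simp
  finally show ?thesis using dd0 unfolding abs_det_V dd_def[symmetric] by simp
qed

text \<open>The last multiplicity is determined by the others, and each of these is at most k R_N.
  Only the order of growth k^m matters later.\<close>

lemma card_L_le: "card (L N k) \<le> (R N * k + 1) ^ m"
proof -
  have "inj_on (\<lambda>e. restrict e {..<m}) (exponents (R N * k))"
  proof (rule inj_onI)
    fix e f assume ef: "e \<in> exponents (R N * k)" "f \<in> exponents (R N * k)" "restrict e {..<m} = restrict f {..<m}"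
    have lt: "e i = f i" if "i < m" for i using fun_cong[OF ef(3), of i] that by simp
    have s: "{..m} = insert m {..<m}" by auto
    have "(\<Sum>i\<le>m. \<mu> i * e i) = (\<Sum>i\<le>m. \<mu> i * f i)" using ef by (simp add: exponents_def)
    then have "\<mu> m * e m = \<mu> m * f m" unfolding s using lt by simp
    then have "e m = f m" using mu_pos[of m] by simp
    then have "e i = f i" if "i \<le> m" for i using lt that by (cases "i = m") auto
    then show "e = f" using ef(1,2) unfolding exponents_def
      by (intro PiE_ext[of e "{..m}" "\<lambda>_. UNIV" f]) auto
  qed
  moreover have "(\<lambda>e. restrict e {..<m}) ` exponents (R N * k) \<subseteq> {..<m} \<rightarrow>\<^sub>E {..R N * k}"
  proof (rule image_subsetI)
    fix e assume e: "e \<in> exponents (R N * k)"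
    show "restrict e {..<m} \<in> {..<m} \<rightarrow>\<^sub>E {..R N * k}"
      using exponents_bound[OF e] by (intro PiE_I) auto
  qed
  moreover have "finite ({..<m} \<rightarrow>\<^sub>E {..R N * k})" by (intro finite_PiE) auto
  ultimately have "card (exponents (R N * k)) \<le> card ({..<m} \<rightarrow>\<^sub>E {..R N * k})"
    by (metis card_image card_mono)
  also have "\<dots> = (R N * k + 1) ^ m" by (simp add: card_PiE)
  finally have "card (exponents (R N * k)) \<le> (R N * k + 1) ^ m" .
  moreover have "card (L N k) = card (admissible k)" using bij_betw_same_card[OF bij_orders] .
  moreover have "card (admissible k) \<le> card (exponents (R N * k))"
    using finite_exponents by (intro card_mono) (auto simp: admissible_def)
  ultimately show ?thesis by linarith
qed

end

section \<open>Quasipolynomials\<close>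

text \<open>Otherwise p or -p, whichever has positive leading coefficient, would eventually exceed
  its bound, because subtracting a polynomial of degree at most m leaves the leading term intact.
  Two-sided bounds are assumed so that both signs are handled alike.\<close>

lemma degree_le_of_growth:
  fixes p :: "real poly"
  assumes bound: "\<And>t::nat. poly p (real t) \<le> C * (real t + 1) ^ m" "\<And>t::nat. - C * (real t + 1) ^ m \<le> poly p (real t)"
  shows "degree p \<le> m"
proof (rule ccontr)
  assume "\<not> degree p \<le> m"
  then have n: "degree p > m" by simp
  have aux: "False" if lc: "lead_coeff q > 0" and dq: "degree q > m"
    and b: "\<And>t::nat. poly q (real t) \<le> C * (real t + 1) ^ m" for q
  proof -
    define u where "u = q - Polynomial.smult C ([:1, 1:] ^ m)"
    have ds: "degree (Polynomial.smult C ([:1, 1:] ^ m)) < degree q"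
      using dq degree_power_le[of "[:1, 1 :: real:]" m] by (intro le_less_trans[OF degree_smult_le]) simp
    have "degree u = degree q" unfolding u_def diff_conv_add_uminus using ds by (intro degree_add_eq_left) simp
    moreover have "coeff (Polynomial.smult C ([:1, 1:] ^ m)) (degree q) = 0" by (rule coeff_eq_0[OF ds])
    ultimately have "lead_coeff u = lead_coeff q" by (simp only: u_def coeff_diff, simp?)
    then have "lead_coeff u > 0" using lc by simp
    then obtain x0 where x0: "\<And>x. x \<ge> x0 \<Longrightarrow> poly u x \<ge> lead_coeff u" using poly_pinfty_gt_lc by blast
    obtain t :: nat where "x0 \<le> real t" using real_arch_simple by blast
    then have "poly u (real t) > 0" using x0 \<open>lead_coeff u > 0\<close> by (meson less_le_trans)
    then show False using b[of t] by (simp add: u_def poly_power add.commute)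
  qed
  show False
  proof (cases "lead_coeff p > 0")
    case True
    then show False using aux[OF True n bound(1)] by blast
  next
    case False
    moreover have "lead_coeff p \<noteq> 0" using n by auto
    ultimately have "lead_coeff p < 0" by linarith
    then have "lead_coeff (- p) > 0" by simp
    moreover have "poly (- p) (real t) \<le> C * (real t + 1) ^ m" for t using bound(2)[of t] by simp
    ultimately show False using aux[of "- p"] n by simp
  qed
qed

lemma sum_pascal:
  fixes g :: "nat \<Rightarrow> real"
  shows "(\<Sum>a\<le>Suc n. (- 1) ^ a * of_nat (Suc n choose a) * g a)
    = (\<Sum>a\<le>n. (- 1) ^ a * of_nat (n choose a) * (g a - g (Suc a)))"
proof -
  have "(\<Sum>a\<le>Suc n. (- 1) ^ a * of_nat (Suc n choose a) * g a)
     = g 0 + (\<Sum>a\<le>n. (- 1) ^ Suc a * of_nat (n choose a) * g (Suc a)) + (\<Sum>a\<le>n. (- 1) ^ Suc a * of_nat (n choose Suc a) * g (Suc a))"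
    by (simp only: sum.atMost_Suc_shift binomial_Suc_Suc of_nat_add distrib_left distrib_right sum.distrib) simp
  also have "g 0 + (\<Sum>a\<le>n. (- 1) ^ Suc a * of_nat (n choose a) * g (Suc a)) + (\<Sum>a\<le>n. (- 1) ^ Suc a * of_nat (n choose Suc a) * g (Suc a))
    = (\<Sum>a\<le>Suc n. (- 1) ^ a * of_nat (n choose a) * g a) + (\<Sum>a\<le>n. (- 1) ^ Suc a * of_nat (n choose a) * g (Suc a))"
    by (simp only: sum.atMost_Suc_shift) simp
  also have "(\<Sum>a\<le>Suc n. (- 1) ^ a * of_nat (n choose a) * g a) = (\<Sum>a\<le>n. (- 1) ^ a * of_nat (n choose a) * g a)"
    by simp
  also have "(\<Sum>a\<le>n. (- 1) ^ a * of_nat (n choose a) * g a) + (\<Sum>a\<le>n. (- 1) ^ Suc a * of_nat (n choose a) * g (Suc a))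
    = (\<Sum>a\<le>n. (- 1) ^ a * of_nat (n choose a) * (g a - g (Suc a)))"
    unfolding sum.distrib[symmetric] by (intro sum.cong refl) (simp add: algebra_simps)
  finally show ?thesis .
qed

text \<open>Pascal's rule peels off one backward difference, and the difference p(x) - p(x - 1) has
  smaller degree since the leading terms cancel.\<close>

lemma finite_difference_poly_eq_0:
  fixes p :: "real poly"
  assumes "degree p \<le> n"
  shows "(\<Sum>a\<le>Suc n. (- 1) ^ a * of_nat (Suc n choose a) * poly p (x - of_nat a)) = 0"
  using assms
proof (induction n arbitrary: p)
  case 0
  then obtain c where "p = [:c:]" using degree_eq_zeroE[of p] by auto
  then show ?case by simp
next
  case (Suc n)
  define q where "q = p - pcompose p [:-1, 1:]"
  have dc: "degree (pcompose p [:-1, 1:]) = degree p" by (simp add: degree_pcompose)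
  have "degree q \<le> n"
  proof (cases "degree p = Suc n")
    case True
    have "coeff (pcompose p [:-1, 1:]) (degree p) = lead_coeff p"
      using lead_coeff_comp[of "[:-1, 1:]" p] dc by simp
    then have "coeff q (Suc n) = 0" using True by (simp add: q_def)
    moreover have "degree q \<le> Suc n" unfolding q_def using True dc by (intro degree_diff_le) auto
    ultimately show ?thesis by (metis le_SucE leading_coeff_0_iff degree_0 zero_le)
  next
    case False
    then have "degree p \<le> n" using Suc.prems by simp
    then show ?thesis unfolding q_def using dc by (intro degree_diff_le) auto
  qed
  from Suc.IH[OF this] have "(\<Sum>a\<le>Suc n. (- 1) ^ a * of_nat (Suc n choose a) * poly q (x - of_nat a)) = 0" .
  moreover have "poly q (x - of_nat a) = poly p (x - of_nat a) - poly p (x - of_nat (Suc a))" for a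
    by (simp add: q_def poly_pcompose algebra_simps)
  ultimately show ?case unfolding sum_pascal[of "Suc n"] by simp
qed

text \<open>The generating function of f is G / (1 - X)^(m+1). The coefficients of G are differences
  of f, and beyond index m they are full differences of order m + 1, hence zero; expanding the
  denominator gives the binomials.\<close>

lemma polynomial_sequence_binomial_basis:
  fixes f :: "nat \<Rightarrow> real" and p :: "real poly"
  assumes f: "\<And>t. f t = poly p (real t)" and dp: "degree p \<le> m"
  shows "f t = (\<Sum>l\<le>m. (\<Sum>a\<le>l. (- 1) ^ a * of_nat (Suc m choose a) * f (l - a)) * of_nat ((t + m - l) choose m))"
proof -
  define F where "F = Abs_fps f"
  define A :: "real fps" where "A = (1 - fps_X) ^ Suc m"
  define G where "G = A * F"
  have A: "A = Abs_fps (\<lambda>k. of_nat (Suc m choose k) * (- 1) ^ k)"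
  proof -
    have "- fps_const 1 * fps_X = fps_const (- 1) * (fps_X :: real fps)" by (simp only: fps_const_neg)
    then have "A = fps_compose (fps_binomial (of_nat (Suc m))) (fps_const (- 1) * fps_X)"
      using one_minus_const_fps_X_power[of "1::real" "Suc m"] unfolding A_def by (simp only: fps_const_1_eq_1 mult_1_left, simp?)
    then show ?thesis
      by (simp only: fps_compose_linear fps_binomial_nth binomial_gbinomial) (simp only: mult.commute)
  qed
  have iA: "inverse A = Abs_fps (\<lambda>k. of_nat ((m + k) choose k))"
    using one_minus_const_fps_X_neg_power'[of "Suc m" "1::real"] unfolding A_def by simp
  have A0: "fps_nth A 0 \<noteq> 0" by (simp add: A)
  have G: "fps_nth G s = (\<Sum>a\<le>s. (- 1) ^ a * of_nat (Suc m choose a) * f (s - a))" for s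
    unfolding G_def A F_def fps_mult_nth by (simp add: atLeast0AtMost mult_ac)
  have G0: "fps_nth G s = 0" if s: "s > m" for s
  proof -
    \<comment> \<open>Since s > m, all a up to m + 1 satisfy a <= s: the sum is a complete
      difference and \<open>s - a\<close> is never truncated.\<close>
    have "fps_nth G s = (\<Sum>a\<le>Suc m. (- 1) ^ a * of_nat (Suc m choose a) * f (s - a))"
      unfolding G using s by (intro sum.mono_neutral_right) (auto simp: binomial_eq_0)
    also have "\<dots> = (\<Sum>a\<le>Suc m. (- 1) ^ a * of_nat (Suc m choose a) * poly p (real s - of_nat a))"
      using s by (intro sum.cong refl) (auto simp: f of_nat_diff)
    also have "\<dots> = 0" by (rule finite_difference_poly_eq_0[OF dp])
    finally show ?thesis .
  qed
  have "G * inverse A = (A * inverse A) * F" by (simp only: G_def mult_ac)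
  then have "G * inverse A = F" unfolding inverse_mult_eq_1'[OF A0] by simp
  then have "f t = fps_nth (G * inverse A) t" by (simp only: F_def fps_nth_Abs_fps)
  also have "\<dots> = (\<Sum>i\<le>t. fps_nth G i * of_nat ((m + (t - i)) choose (t - i)))"
    unfolding iA fps_mult_nth by (simp add: atLeast0AtMost)
  also have "\<dots> = (\<Sum>i\<le>t. fps_nth G i * of_nat ((t + m - i) choose m))"
  proof (intro sum.cong refl)
    fix i assume "i \<in> {..t}"
    then have "m + (t - i) = t + m - i" "t + m - i - m = t - i" "m \<le> t + m - i" by auto
    then show "fps_nth G i * of_nat ((m + (t - i)) choose (t - i)) = fps_nth G i * of_nat ((t + m - i) choose m)"
      using binomial_symmetric[of m "t + m - i"] by simp
  qed
  \<comment> \<open>For i > t the upper entry of the binomial is below m, so the added terms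
    vanish.\<close>
  also have "\<dots> = (\<Sum>i\<le>max t m. fps_nth G i * of_nat ((t + m - i) choose m))"
    by (intro sum.mono_neutral_left) (auto simp: binomial_eq_0)
  also have "\<dots> = (\<Sum>i\<le>m. fps_nth G i * of_nat ((t + m - i) choose m))"
    using G0 by (intro sum.mono_neutral_right) auto
  finally show ?thesis unfolding G .
qed

section \<open>Restriction to one residue class modulo E\<close>

theorem theorem4p4:
  fixes N m E :: nat and cs :: "nat \<Rightarrow> int \<times> int"
    and P Q :: "int mat" and d :: "nat \<Rightarrow> nat"
  assumes "N \<ge> 5" and "m = N div 2"
    and "E \<ge> 1" and "\<exists>D. quasipolynomial D E (\<lambda>k. real (card (L N k)))"
    and "cusp_orbit_reps N cs"
    and "smith_normal_form m (V_mat N cs) P Q d"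
  shows "\<forall>r<E.
    (\<forall>t. int (card (L N (E * t + r)))
        = (\<Sum>l\<le>m. p_coeff N E r l * int ((t + m - l) choose m))) \<and>
    (\<forall>s\<le>m. complex_of_int (p_coeff N E r s)
        = 1 / of_rat \<bar>det (V_mat N cs)\<bar> *
          (\<Sum>j \<in> (\<Pi>\<^sub>E i\<in>{..<m}. {..<d i}). \<Sum>a\<le>s.
             (-1) ^ a * of_nat ((m + 1) choose a) * xi N cs P d j ^ (E * (s - a) + r) *
             weighted_h m (orbit_size N cs) (R N * (E * (s - a) + r)) (\<lambda>i. chi N P d i j)))"
proof (intro allI impI conjI)
  interpret cusp_smith N m cs P Q d
    using assms by unfold_locales
  fix r assume "r < E"
  {
    fix t
    define f where "f = (\<lambda>t. real (card (L N (E * t + r))))"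
    obtain D c where per: "\<And>i k. i \<le> D \<Longrightarrow> c i (k + E) = c i k"
      and quasi: "\<And>k. real (card (L N k)) = (\<Sum>i\<le>D. c i k * real k ^ i)"
      using assms(4) unfolding quasipolynomial_def by metis
    have per': "c i (E * t + r) = c i r" if "i \<le> D" for i t
      by (induction t) (use per[OF that, of "E * _ + r"] in \<open>auto simp: algebra_simps\<close>)
    \<comment> \<open>Along k = E t + r the periodic coefficients are frozen at their values at r,
      which leaves an honest polynomial in t whose degree is so far bounded only by the unspecified
      D.\<close>
    define p where "p = (\<Sum>i\<le>D. Polynomial.smult (c i r) ([:real r, real E:] ^ i))"
    have f: "f t = poly p (real t)" for t
    proof -
      have "f t = (\<Sum>i\<le>D. c i (E * t + r) * real (E * t + r) ^ i)" by (simp only: f_def quasi)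
      also have "\<dots> = (\<Sum>i\<le>D. c i r * (real r + real t * real E) ^ i)"
      proof (rule sum.cong[OF refl])
        fix i assume "i \<in> {..D}"
        then have "c i (E * t + r) = c i r" by (intro per') simp
        then show "c i (E * t + r) * real (E * t + r) ^ i = c i r * (real r + real t * real E) ^ i"
          by (simp only:) (simp add: algebra_simps)
      qed
      finally show ?thesis by (simp add: p_def poly_sum poly_power)
    qed
    \<comment> \<open>Chosen so that R_N (E t + r) + 1 is at most (R_N (E + r) + 1) (t + 1) for
      every t, including t = 0.\<close>
    define C where "C = real ((R N * (E + r) + 1) ^ m)"
    have fb: "f t \<le> C * (real t + 1) ^ m" for t
    proof -
      have "R N * (E * t + r) + 1 \<le> (R N * (E + r) + 1) * (t + 1)"
        by (simp add: algebra_simps)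
      then have "(R N * (E * t + r) + 1) ^ m \<le> ((R N * (E + r) + 1) * (t + 1)) ^ m" by (rule power_mono) simp
      then have "card (L N (E * t + r)) \<le> ((R N * (E + r) + 1) * (t + 1)) ^ m" using card_L_le order_trans by blast
      then have "real (card (L N (E * t + r))) \<le> real (((R N * (E + r) + 1) * (t + 1)) ^ m)" by (simp only: of_nat_le_iff)
      then show ?thesis by (simp only: f_def C_def of_nat_power of_nat_mult of_nat_add of_nat_1 power_mult_distrib)
    qed
    have "degree p \<le> m"
    proof (rule degree_le_of_growth)
      show "poly p (real t) \<le> C * (real t + 1) ^ m" for t using fb f by metis
      have "0 \<le> f t" for t by (simp add: f_def)
      moreover have "0 \<le> C * (real t + 1) ^ m" for t :: nat by (simp add: C_def)
      ultimately show "- C * (real t + 1) ^ m \<le> poly p (real t)" for t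
        unfolding f[symmetric] by (smt (verit) mult_minus_left)
    qed
    from polynomial_sequence_binomial_basis[OF f this, of t]
    have "real_of_int (int (card (L N (E * t + r)))) = of_int (\<Sum>l\<le>m. p_coeff N E r l * int ((t + m - l) choose m))"
      by (simp add: f_def p_coeff_def assms(2))
    then show "int (card (L N (E * t + r))) = (\<Sum>l\<le>m. p_coeff N E r l * int ((t + m - l) choose m))"
      by (simp only: of_int_eq_iff)
  next
    fix s assume "s \<le> m"
    let ?X = "\<lambda>j k. xi N cs P d j ^ k * weighted_h m (orbit_size N cs) (R N * k) (\<lambda>i. chi N P d i j)"
    let ?J = "\<Pi>\<^sub>E i\<in>{..<m}. {..<d i}"
    have "complex_of_int (p_coeff N E r s) = (\<Sum>a\<le>s. (-1) ^ a * of_nat ((m + 1) choose a) * of_nat (card (L N (E * (s - a) + r))))"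
      by (simp add: p_coeff_def assms(2))
    also have "\<dots> = (\<Sum>a\<le>s. 1 / of_rat \<bar>det V\<bar> * (\<Sum>j\<in>?J. (-1) ^ a * of_nat ((m + 1) choose a) * ?X j (E * (s - a) + r)))"
      unfolding card_L sum_distrib_left by (intro sum.cong refl) (simp only: mult_ac)
    also have "\<dots> = 1 / of_rat \<bar>det V\<bar> * (\<Sum>a\<le>s. \<Sum>j\<in>?J. (-1) ^ a * of_nat ((m + 1) choose a) * ?X j (E * (s - a) + r))"
      by (rule sum_distrib_left[symmetric])
    also have "(\<Sum>a\<le>s. \<Sum>j\<in>?J. (-1) ^ a * of_nat ((m + 1) choose a) * ?X j (E * (s - a) + r))
      = (\<Sum>j\<in>?J. \<Sum>a\<le>s. (-1) ^ a * of_nat ((m + 1) choose a) * ?X j (E * (s - a) + r))"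
      by (rule sum.swap)
    finally show "complex_of_int (p_coeff N E r s)
        = 1 / of_rat \<bar>det (V_mat N cs)\<bar> *
          (\<Sum>j \<in> (\<Pi>\<^sub>E i\<in>{..<m}. {..<d i}). \<Sum>a\<le>s.
             (-1) ^ a * of_nat ((m + 1) choose a) * xi N cs P d j ^ (E * (s - a) + r) *
             weighted_h m (orbit_size N cs) (R N * (E * (s - a) + r)) (\<lambda>i. chi N P d i j))"
      unfolding V_def by (simp only: mult.assoc)
  }
qed

end
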